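(* For every $n\geq 1$, $$Z_n^{20V}=\det_{0\leq i,j\leq n-1}\Big( g_{20V}(u,v)\big\vert_{u^iv^j}\Big),\qquad g_{20V}(u,v)=\frac{(1+u^2)(1+2u-u^2)}{(1-u^2v)\big((1-u)^2-v(1+u)^2\big)}=\frac{\left(\frac{1+u}{1-u}\right)^2}{1-v\left(\frac{1+u}{1-u}\right)^2}-\frac{u^2}{1-vu^2}.$$
   Context: Notation: for a formal power series $f(u,v)$, $f(u,v)\vert_{u^iv^j}$ denotes the coefficient of $u^iv^j$ in its expansion around $(0,0)$. The 20V model with DWBC3 boundary conditions on the quadrangle $\mathcal Q_n$: let $V=\{(x,y)\in\mathbb Z^2: 1\le x\le n,\ 1\le y\le 2n-1,\ x+y\ge n+1\}$. Each vertex $p\in V$ has three incoming edges (from $p-(1,0)$, $p+(0,1)$, $p+(-1,1)$) and three outgoing edges (to $p+(1,0)$, $p-(0,1)$, $p+(1,-1)$). Edges joining two vertices of $V$ are internal; an incident edge whose other endpoint is not in $V$ is a boundary edge. Boundary edges are fixed: the edge from $(0,y)$ to $(1,y)$ is occupied for every $(1,y)\in V$; the edge from $p$ to $p-(0,1)$ is occupied whenever $p\in V$ and $p-(0,1)\notin V$; all other boundary edges are empty. A configuration is an assignment occupied/empty to the internal edges such that at every vertex the number of occupied incoming edges equals the number of occupied outgoing edges (this is the osculating Schröder path form of the ice rule on the triangular lattice, with the paper's DWBC3 boundary orientations). $Z_n^{20V}$ is the number of configurations. *)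

theory Defs
  imports "Jordan_Normal_Form.Determinant" "HOL-Computational_Algebra.Formal_Power_Series"
begin

type_synonym point = "int \<times> int"

text \<open>An edge is a directed pair (tail, head); paths travel right, down or diagonally down-right.\<close>
type_synonym edge = "point \<times> point"

fun in_edges :: "point \<Rightarrow> edge set" where
  "in_edges (x, y) = {((x - 1, y), (x, y)), ((x, y + 1), (x, y)), ((x - 1, y + 1), (x, y))}"

fun out_edges :: "point \<Rightarrow> edge set" where
  "out_edges (x, y) = {((x, y), (x + 1, y)), ((x, y), (x, y - 1)), ((x, y), (x + 1, y - 1))}"

definition quadrangle :: "nat \<Rightarrow> point set" where
  "quadrangle n =
     {(x, y). 1 \<le> x \<and> x \<le> int n \<and> 1 \<le> y \<and> y \<le> 2 * int n - 1 \<and> x + y \<ge> int n + 1}"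

definition incident_edges :: "nat \<Rightarrow> edge set" where
  "incident_edges n = (\<Union>p \<in> quadrangle n. in_edges p \<union> out_edges p)"

definition internal_edges :: "nat \<Rightarrow> edge set" where
  "internal_edges n = {e \<in> incident_edges n. fst e \<in> quadrangle n \<and> snd e \<in> quadrangle n}"

definition boundary_edges :: "nat \<Rightarrow> edge set" where
  "boundary_edges n = incident_edges n - internal_edges n"

definition dwbc3_occupied :: "nat \<Rightarrow> edge set" where
  "dwbc3_occupied n =
     {((0, y), (1, y)) |y. (1, y) \<in> quadrangle n} \<union>
     {((x, y), (x, y - 1)) |x y. (x, y) \<in> quadrangle n \<and> (x, y - 1) \<notin> quadrangle n}"

text \<open>A configuration is encoded as the set of all its occupied edges. Its boundary part is forced,
  so such sets correspond bijectively to occupied/empty assignments on the internal edges.\<close>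
definition dwbc3_configurations :: "nat \<Rightarrow> edge set set" where
  "dwbc3_configurations n =
     {S. S \<subseteq> incident_edges n \<and> S \<inter> boundary_edges n = dwbc3_occupied n \<and>
         (\<forall>p \<in> quadrangle n. card (S \<inter> in_edges p) = card (S \<inter> out_edges p))}"

definition Z_20V :: "nat \<Rightarrow> nat" where
  "Z_20V n = card (dwbc3_configurations n)"

text \<open>Bivariate formal power series in \<open>u\<close> and \<open>v\<close> are represented as power series in \<open>v\<close> whose
  coefficients are power series in \<open>u\<close>.\<close>

definition fps_u :: "rat fps fps" where
  "fps_u = fps_const fps_X"

definition fps_v :: "rat fps fps" where
  "fps_v = fps_X"

definition coeff_uv :: "rat fps fps \<Rightarrow> nat \<Rightarrow> nat \<Rightarrow> rat" where
  "coeff_uv f i j = fps_nth (fps_nth f j) i"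

text \<open>The division is the one of \<^typ>\<open>rat fps fps\<close>. It is a true division here, see
  \<open>g_20V_mult_denominator\<close> below, because the denominator has constant coefficient 1.\<close>
definition g_20V :: "rat fps fps" where
  "g_20V = (1 + fps_u\<^sup>2) * (1 + 2 * fps_u - fps_u\<^sup>2) /
     ((1 - fps_u\<^sup>2 * fps_v) * ((1 - fps_u)\<^sup>2 - fps_v * (1 + fps_u)\<^sup>2))"

lemma dwbc3_occupied_subset_boundary: "dwbc3_occupied n \<subseteq> boundary_edges n"
proof
  fix e assume "e \<in> dwbc3_occupied n"
  then consider (left) y where "e = ((0, y), (1, y))" "(1, y) \<in> quadrangle n"
    | (bottom) x y where "e = ((x, y), (x, y - 1))" "(x, y) \<in> quadrangle n"
        "(x, y - 1) \<notin> quadrangle n"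
    unfolding dwbc3_occupied_def by blast
  then show "e \<in> boundary_edges n"
  proof cases
    case left
    have "e \<in> in_edges (1, y)" using left(1) by simp
    then have "e \<in> incident_edges n" using left(2) unfolding incident_edges_def by blast
    moreover have "fst e \<notin> quadrangle n" using left(1) by (simp add: quadrangle_def)
    ultimately show ?thesis
      unfolding boundary_edges_def internal_edges_def by blast
  next
    case bottom
    have "e \<in> out_edges (x, y)" using bottom(1) by simp
    then have "e \<in> incident_edges n" using bottom(2) unfolding incident_edges_def by blast
    moreover have "snd e \<notin> quadrangle n" using bottom(1,3) by simp
    ultimately show ?thesis
      unfolding boundary_edges_def internal_edges_def by blast
  qed
qed

lemma fps_fps_divide_times_cancel:
  fixes f h :: "rat fps fps"
  assumes "fps_nth (fps_nth h 0) 0 \<noteq> 0"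
  shows "f / h * h = f"
proof -
  have h0: "fps_nth h 0 \<noteq> 0" using assms by auto
  have "fps_nth h 0 * inverse (fps_nth h 0) = 1"
    using assms by (rule inverse_mult_eq_1')
  then have "h * inverse h = 1"
    unfolding fps_inverse_def by (rule fps_right_inverse)
  then have inv: "inverse h * h = 1"
    by (simp add: mult.commute)
  have "subdegree h = 0" using h0 by simp
  then have "f / h = f * inverse h" using h0 by (auto simp: fps_divide_def)
  then show ?thesis using inv by (simp add: mult.assoc)
qed

lemma g_20V_mult_denominator:
  "g_20V * ((1 - fps_u\<^sup>2 * fps_v) * ((1 - fps_u)\<^sup>2 - fps_v * (1 + fps_u)\<^sup>2)) =
     (1 + fps_u\<^sup>2) * (1 + 2 * fps_u - fps_u\<^sup>2)"
  unfolding g_20V_def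
  by (rule fps_fps_divide_times_cancel)
    (simp add: fps_u_def fps_v_def power2_eq_square)

end

theory Submission
  imports Defs "HOL-Computational_Algebra.Polynomial_FPS"
begin

text \<open>
  Each vertex of the 20-vertex model factorizes into three six-vertex crossings (of a horizontal and
  a diagonal, a horizontal and a vertical, a diagonal and a vertical line). By the Yang-Baxter
  equation all vertical lines can be pulled to the left of all crossings of horizontal with diagonal
  lines. After that these crossings see only empty lines, and each vertical line only interacts with
  the \<open>2 n - 1\<close> rows in which occupied horizontal and empty diagonal lines alternate on the left;
  the other rows stay empty. This is a special point of a six-vertex model with \<open>n\<close> pairs of rows
  joined by U-turns on the left.

  The U-turn model has a determinant for arbitrary parameters of the pairs and of the columns. Its
  partition function is symmetric in the columns, quasi-invariant under a reflection of the parameter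
  of a pair, a polynomial of low degree in that parameter, and it reduces to a smaller instance at the
  values where the corner vertex is frozen. These values determine the polynomial, and the
  determinant \<open>det (1 / q(u\<^sub>i, v\<^sub>j))\<close> passes the same test. Letting first the column
  and then the row parameters tend to \<open>0\<close> turns the determinant into one of Taylor coefficients.
\<close>

section \<open>Local vertex operators and the Yang-Baxter equation\<close>

text \<open>The reduced homogeneous model has no free parameter, hence nothing to interpolate in; so
  every pair of rows and every column gets its own parameter, although only the point where all of
  them vanish is wanted. The U-turn fits because the weights of horizontal and diagonal lines are
  mirror images: at \<open>p = (1, 0)\<close>, \<open>s = 0\<close> the reflection turns
  \<open>diag_weight\<close> into \<open>hor_weight\<close>, and there \<open>uturn\<close> admits
  just an occupied \<open>H\<close> with an empty \<open>D\<close>, the boundary condition of the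
  reduced model. A dummy line \<open>D n\<close>, always empty, completes the last pair. The row
  parameter is a vector and not a slope, since the reflection sends the slope 1 to infinity. The
  function \<open>q\<close> is the denominator of \<open>g_20V\<close>; its zeros in
  \<open>u\<close> for \<open>v = s^2\<close> are, up to the sign of \<open>s\<close>, the values
  where the corner freezes and their mirror images. The real numbers enter through
  \<open>sqrt 2\<close> and the limits; the powers of \<open>sqrt 2\<close> cancel against the
  factor 2 that the factorization gains at every vertex, and integer coefficients remain.\<close>

type_synonym weight = "bool \<Rightarrow> bool \<Rightarrow> bool \<Rightarrow> bool \<Rightarrow> real"
type_synonym 'l state = "('l \<Rightarrow> bool) \<Rightarrow> real"

text \<open>A state weighs the occupations of the frontier edges of all lines; \<open>vop i j w\<close> advances the
  frontier through a vertex where the lines \<open>i\<close> and \<open>j\<close> meet. In \<open>w p q r s\<close>, the incoming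
  occupations are \<open>p, q\<close> and the outgoing ones \<open>r, s\<close>.\<close>

definition vop :: "'l \<Rightarrow> 'l \<Rightarrow> weight \<Rightarrow> 'l state \<Rightarrow> 'l state" where
  "vop i j w \<psi> \<sigma> = (\<Sum>a\<in>UNIV. \<Sum>b\<in>UNIV. w a b (\<sigma> i) (\<sigma> j) * \<psi> (\<sigma>(i := a, j := b)))"

lemma vop_commute:
  assumes "i \<noteq> k" "i \<noteq> l" "j \<noteq> k" "j \<noteq> l"
  shows "vop i j w (vop k l w' \<psi>) = vop k l w' (vop i j w \<psi>)"
proof
  fix \<sigma> :: "'a \<Rightarrow> bool"
  have upd: "\<sigma>(i := a, j := b, k := c, l := d) = \<sigma>(k := c, l := d, i := a, j := b)" for a b c d
    using assms by (auto simp: fun_eq_iff)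
  show "vop i j w (vop k l w' \<psi>) \<sigma> = vop k l w' (vop i j w \<psi>) \<sigma>"
    using assms by (simp add: vop_def UNIV_bool upd algebra_simps)
qed

text \<open>Three lines with incoming occupations \<open>p, q, r\<close> and outgoing ones
  \<open>i, j, k\<close> cross pairwise, with \<open>w1\<close>, \<open>w2\<close>,
  \<open>w3\<close> at the crossings 12, 13, 23. The left side meets the crossings in the order 23,
  13, 12, the right side in the reverse order.\<close>

definition yang_baxter :: "weight \<Rightarrow> weight \<Rightarrow> weight \<Rightarrow> bool" where
  "yang_baxter w1 w2 w3 \<longleftrightarrow> (\<forall>p q r i j k.
     (\<Sum>a\<in>UNIV. \<Sum>b\<in>UNIV. \<Sum>c\<in>UNIV. w1 a b i j * w2 p c a k * w3 q r b c) =
     (\<Sum>a\<in>UNIV. \<Sum>b\<in>UNIV. \<Sum>c\<in>UNIV. w3 b c j k * w2 a r i c * w1 p q a b))"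

text \<open>Separates the local kernel of three crossings from the state, so that the Yang-Baxter
  equation becomes a finite check on occupations.\<close>

lemma vop_triple:
  assumes "i \<noteq> j" "i \<noteq> k" "j \<noteq> k"
  shows "vop i j w1 (vop i k w2 (vop j k w3 \<psi>)) \<sigma> =
     (\<Sum>p\<in>UNIV. \<Sum>q\<in>UNIV. \<Sum>r\<in>UNIV.
       (\<Sum>a\<in>UNIV. \<Sum>b\<in>UNIV. \<Sum>c\<in>UNIV. w1 a b (\<sigma> i) (\<sigma> j) * w2 p c a (\<sigma> k) * w3 q r b c)
       * \<psi> (\<sigma>(i := p, j := q, k := r)))"
proof -
  have upd: "\<sigma>(i := a, j := b, i := p, k := c, j := q, k := r) = \<sigma>(i := p, j := q, k := r)"
    for a b p c q r using assms by (auto simp: fun_eq_iff)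
  show ?thesis
    using assms unfolding vop_def upd
    by (simp add: UNIV_bool algebra_simps)
qed

lemma vop_triple':
  assumes "i \<noteq> j" "i \<noteq> k" "j \<noteq> k"
  shows "vop j k w3 (vop i k w2 (vop i j w1 \<psi>)) \<sigma> =
     (\<Sum>p\<in>UNIV. \<Sum>q\<in>UNIV. \<Sum>r\<in>UNIV.
       (\<Sum>a\<in>UNIV. \<Sum>b\<in>UNIV. \<Sum>c\<in>UNIV. w3 b c (\<sigma> j) (\<sigma> k) * w2 a r (\<sigma> i) c * w1 p q a b)
       * \<psi> (\<sigma>(i := p, j := q, k := r)))"
proof -
  have upd: "\<sigma>(j := b, k := c, i := a, k := r, i := p, j := q) = \<sigma>(i := p, j := q, k := r)"
    for a b p c q r using assms by (auto simp: fun_eq_iff)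
  show ?thesis
    using assms unfolding vop_def upd
    by (simp add: UNIV_bool algebra_simps)
qed

lemma vop_yang_baxter:
  assumes "yang_baxter w1 w2 w3" "i \<noteq> j" "i \<noteq> k" "j \<noteq> k"
  shows "vop i j w1 (vop i k w2 (vop j k w3 \<psi>)) = vop j k w3 (vop i k w2 (vop i j w1 \<psi>))"
proof
  fix \<sigma>
  show "vop i j w1 (vop i k w2 (vop j k w3 \<psi>)) \<sigma> = vop j k w3 (vop i k w2 (vop i j w1 \<psi>)) \<sigma>"
    unfolding vop_triple[OF assms(2-4)] vop_triple'[OF assms(2-4)]
    using assms(1) unfolding yang_baxter_def by simp
qed

text \<open>The Yang-Baxter equation with the first crossing composed with a transposition: on both
  sides the third line meets the first line before the second, and it is \<open>w2\<close> and
  \<open>w3\<close> that trade places.\<close>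

definition braid :: "weight \<Rightarrow> weight \<Rightarrow> weight \<Rightarrow> bool" where
  "braid w1 w2 w3 \<longleftrightarrow> (\<forall>p q r i j k.
     (\<Sum>a\<in>UNIV. \<Sum>b\<in>UNIV. \<Sum>c\<in>UNIV. w1 a b i j * w3 q c b k * w2 p r a c) =
     (\<Sum>a\<in>UNIV. \<Sum>b\<in>UNIV. \<Sum>c\<in>UNIV. w2 b c j k * w3 a r i c * w1 p q a b))"

lemma vop_braid:
  assumes "braid w1 w2 w3" "i \<noteq> j" "i \<noteq> k" "j \<noteq> k"
  shows "vop i j w1 (vop j k w3 (vop i k w2 \<psi>)) = vop j k w2 (vop i k w3 (vop i j w1 \<psi>))"
proof
  fix \<sigma> :: "'a \<Rightarrow> bool"
  have upd: "\<sigma>(i := a, j := b, j := q, k := c, i := p, k := r) = \<sigma>(i := p, j := q, k := r)"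
    for a b p c q r using assms by (auto simp: fun_eq_iff)
  have "vop i j w1 (vop j k w3 (vop i k w2 \<psi>)) \<sigma> =
     (\<Sum>p\<in>UNIV. \<Sum>q\<in>UNIV. \<Sum>r\<in>UNIV.
       (\<Sum>a\<in>UNIV. \<Sum>b\<in>UNIV. \<Sum>c\<in>UNIV. w1 a b (\<sigma> i) (\<sigma> j) * w3 q c b (\<sigma> k) * w2 p r a c)
       * \<psi> (\<sigma>(i := p, j := q, k := r)))"
    using assms(2-4) unfolding vop_def upd by (simp add: UNIV_bool algebra_simps)
  also have "\<dots> = vop j k w2 (vop i k w3 (vop i j w1 \<psi>)) \<sigma>"
    unfolding vop_triple'[OF assms(2-4)] using assms(1) unfolding braid_def by simp
  finally show "vop i j w1 (vop j k w3 (vop i k w2 \<psi>)) \<sigma> = vop j k w2 (vop i k w3 (vop i j w1 \<psi>)) \<sigma>" .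
qed

lemma vop_scale: "vop i j w (\<lambda>\<sigma>. c * \<psi> \<sigma>) = (\<lambda>\<sigma>. c * vop i j w \<psi> \<sigma>)"
  by (rule ext) (simp add: vop_def sum_distrib_left mult.left_commute)

definition column :: "'l \<Rightarrow> ('l \<times> weight) list \<Rightarrow> 'l state \<Rightarrow> 'l state" where
  "column v rs = fold (\<lambda>(r, w). vop r v w) rs"

lemma column_Nil [simp]: "column v [] \<psi> = \<psi>"
  and column_Cons [simp]: "column v ((r, w) # rs) \<psi> = column v rs (vop r v w \<psi>)"
  and column_append [simp]: "column v (rs @ rs') \<psi> = column v rs' (column v rs \<psi>)"
  by (simp_all add: column_def)

lemma column_scale: "column v rs (\<lambda>\<sigma>. c * \<psi> \<sigma>) = (\<lambda>\<sigma>. c * column v rs \<psi> \<sigma>)"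
  by (induction rs arbitrary: \<psi>) (auto simp: vop_scale)

lemma vop_column_commute:
  assumes "v \<notin> {i, j}" "fst ` set rs \<inter> {i, j} = {}"
  shows "vop i j w (column v rs \<psi>) = column v rs (vop i j w \<psi>)"
  using assms(2)
proof (induction rs arbitrary: \<psi>)
  case (Cons rw rs)
  obtain r w' where rw: "rw = (r, w')" by force
  have "vop i j w (vop r v w' \<psi>) = vop r v w' (vop i j w \<psi>)"
    using Cons.prems assms(1) rw by (intro vop_commute) auto
  with Cons show ?case by (auto simp: rw)
qed simp

text \<open>The vertical lines \<open>x\<close> and \<open>x'\<close> are interchanged by pulling their crossing \<open>w3\<close> through all
  rows.\<close>

lemma column_exchange:
  assumes "x \<noteq> x'" "distinct rs" "x \<notin> set rs" "x' \<notin> set rs"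
    and "\<And>r. r \<in> set rs \<Longrightarrow> yang_baxter (w r) (w' r) w3"
  shows "vop x x' w3 (column x' (map (\<lambda>r. (r, w' r)) rs) (column x (map (\<lambda>r. (r, w r)) rs) \<psi>)) =
     column x (map (\<lambda>r. (r, w r)) rs) (column x' (map (\<lambda>r. (r, w' r)) rs) (vop x x' w3 \<psi>))"
  using assms(2-5)
proof (induction rs arbitrary: \<psi>)
  case (Cons r rs)
  let ?C = "column x (map (\<lambda>r. (r, w r)) rs)" and ?C' = "column x' (map (\<lambda>r. (r, w' r)) rs)"
  have 1: "vop r x' (w' r) (?C \<phi>) = ?C (vop r x' (w' r) \<phi>)"
    and 2: "vop r x (w r) (?C' \<phi>) = ?C' (vop r x (w r) \<phi>)" for \<phi>
    using Cons.prems assms(1) by (auto intro!: vop_column_commute simp: image_image)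
  have yb: "vop r x (w r) (vop r x' (w' r) (vop x x' w3 \<psi>)) =
      vop x x' w3 (vop r x' (w' r) (vop r x (w r) \<psi>))"
    using Cons.prems assms(1) by (intro vop_yang_baxter) auto
  show ?case using Cons.prems by (simp add: 1 2 Cons.IH yb)
qed simp

lemma column_braid:
  assumes "braid w1 w2 w3" "h \<noteq> d" "v \<notin> {h, d}"
    "fst ` set rs1 \<inter> {h, d} = {}" "fst ` set rs2 \<inter> {h, d} = {}"
  shows "vop h d w1 (column v (rs1 @ [(h, w2), (d, w3)] @ rs2) \<psi>) =
     column v (rs1 @ [(h, w3), (d, w2)] @ rs2) (vop h d w1 \<psi>)"
proof -
  have c: "vop h d w1 (column v rs1 \<phi>) = column v rs1 (vop h d w1 \<phi>)"
    "vop h d w1 (column v rs2 \<phi>) = column v rs2 (vop h d w1 \<phi>)" for \<phi>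
    using assms by (auto intro!: vop_column_commute)
  have "vop h d w1 (vop d v w3 (vop h v w2 \<phi>)) = vop d v w2 (vop h v w3 (vop h d w1 \<phi>))" for \<phi>
    using assms by (intro vop_braid) auto
  then show ?thesis by (simp add: c)
qed

section \<open>Six-vertex weights on one integrable curve\<close>

definition sixv :: "real \<Rightarrow> real \<Rightarrow> real \<Rightarrow> real \<Rightarrow> weight" where
  "sixv a b c d p q r s =
     (if p = q then (if r = p \<and> s = q then a else 0)
      else if r = p \<and> s = q then b
      else if r = q \<and> s = p then (if p then c else d) else 0)"

text \<open>In polar coordinates \<open>p = (cos \<alpha>, sin \<alpha>)\<close> and \<open>s = tan \<beta>\<close>, and up to a factor and a gauge of
  the turns, the weights are \<open>a = sqrt 2 cos (\<alpha> + \<beta>)\<close>, \<open>b = sqrt 2 cos (\<alpha> + \<beta> + \<pi> / 4)\<close> and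
  \<open>c = 1\<close>: the curve \<open>a\<^sup>2 + b\<^sup>2 - c\<^sup>2 = sqrt 2 a b\<close>. The reflection of \<open>p\<close> below is
  \<open>\<alpha> \<mapsto> - \<alpha> - \<pi> / 4\<close>.\<close>

definition line_weight :: "real \<times> real \<Rightarrow> real \<Rightarrow> weight" where
  "line_weight p s = (case p of (x, y) \<Rightarrow>
     sixv (sqrt 2 * (x - y * s)) (x - y * s - x * s - y) (1 + s\<^sup>2) (x\<^sup>2 + y\<^sup>2))"

definition reflect :: "real \<times> real \<Rightarrow> real \<times> real" where
  "reflect p = (case p of (x, y) \<Rightarrow> ((x - y) / sqrt 2, - (x + y) / sqrt 2))"

text \<open>Equal occupation and straight passage exchange their roles: at \<open>(1, 0)\<close> and
  \<open>s = 0\<close> the weights \<open>sqrt 2, 1\<close> become \<open>1, sqrt 2\<close>. The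
  turns keep their weights because \<open>reflect\<close> is an isometry; splitting the product of
  the two turn weights into \<open>1 + s\<^sup>2\<close> and \<open>x\<^sup>2 + y\<^sup>2\<close>
  avoids a square root.\<close>

lemma line_weight_reflect:
  "line_weight (reflect (x, y)) s =
     sixv (x - y + (x + y) * s) (sqrt 2 * (x + y * s)) (1 + s\<^sup>2) (x\<^sup>2 + y\<^sup>2)"
proof -
  have "((x - y) / sqrt 2)\<^sup>2 + (- (x + y) / sqrt 2)\<^sup>2 = x\<^sup>2 + y\<^sup>2"
    by (simp add: power_divide power2_eq_square field_simps)
  moreover have "sqrt 2 * ((x - y) / sqrt 2 - (- (x + y) / sqrt 2) * s) = x - y + (x + y) * s"
    by (simp add: field_simps)
  moreover have "(x - y) / sqrt 2 - (- (x + y) / sqrt 2) * s - (x - y) / sqrt 2 * s - - (x + y) / sqrt 2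
      = sqrt 2 * (x + y * s)"
    by (simp add: field_simps)
  ultimately show ?thesis
    unfolding line_weight_def reflect_def prod.case by (simp only:)
qed

text \<open>With s = tan \<beta>, s' = tan \<beta>' and after division by the geometric mean of the
  turn weights, a = sqrt 2 cos (\<beta> - \<beta>' - \<pi>/4), b = sqrt 2 sin (\<beta> - \<beta>')
  and c = 1: a point of the same curve that depends only on the difference of the angles.\<close>

definition column_crossing :: "real \<Rightarrow> real \<Rightarrow> weight" where
  "column_crossing s s' = sixv (s - s' + (1 + s * s')) (sqrt 2 * (s - s')) (1 + s'\<^sup>2) (1 + s\<^sup>2)"

lemma yang_baxter_column_crossing:
  "yang_baxter (line_weight p s) (line_weight p s') (column_crossing s s')"
proof -
  obtain x y where p: "p = (x, y)" by force
  \<comment> \<open>Hiding \<open>sqrt 2\<close> behind a letter leaves polynomial arithmetic. The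
    second rule catches a square at the head of a longer product.\<close>
  define r where "r = sqrt 2"
  have r: "r * r = 2" "r * (r * z) = 2 * z" for z
    by (simp_all add: r_def flip: mult.assoc)
  show ?thesis
    unfolding yang_baxter_def all_bool_eq UNIV_bool p line_weight_def column_crossing_def r_def[symmetric]
    by (simp add: sixv_def) (simp add: r algebra_simps power2_eq_square)
qed

text \<open>The incoming occupations are swapped, so that the braiding exchanges the parameters of two rows
  and not the rows.\<close>

definition row_braiding :: "real \<times> real \<Rightarrow> weight" where
  "row_braiding p = (case p of (x, y) \<Rightarrow> (\<lambda>i j.
     sixv (sqrt 2 * (x\<^sup>2 - y\<^sup>2)) (x\<^sup>2 - y\<^sup>2 + 2 * x * y) (x\<^sup>2 + y\<^sup>2) (x\<^sup>2 + y\<^sup>2) j i))"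

text \<open>The two rows have the angles \<alpha> and - \<alpha> - \<pi>/4, so their crossing
  depends on 2 \<alpha> only: its weights are sqrt 2 cos 2\<alpha>, cos 2\<alpha> + sin 2\<alpha>
  and 1, times \<open>x\<^sup>2 + y\<^sup>2\<close>.\<close>

lemma braid_row_braiding:
  "braid (row_braiding p) (line_weight p s) (line_weight (reflect p) s)"
proof -
  obtain x y where p: "p = (x, y)" by force
  define r where "r = sqrt 2"
  have r: "r * r = 2" "r * (r * z) = 2 * z" for z
    by (simp_all add: r_def flip: mult.assoc)
  show ?thesis
    unfolding braid_def all_bool_eq UNIV_bool p line_weight_reflect
    unfolding line_weight_def row_braiding_def r_def[symmetric]
    by (simp add: sixv_def) (simp add: r algebra_simps power2_eq_square)
qed

section \<open>The six-vertex model with U-turns\<close>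

text \<open>In the 20-vertex model \<open>D c\<close> is the antidiagonal of the points with
  coordinate sum \<open>c\<close>. In the U-turn model \<open>H y\<close> and \<open>D y\<close> are
  the two rows of a pair. The readings agree once a vertical line is pulled to column 0, where the
  antidiagonal \<open>y\<close> has height \<open>y\<close>.\<close>

datatype line = H nat | D nat | V nat

definition row_lines :: "nat list \<Rightarrow> line list" where
  "row_lines ys = concat (map (\<lambda>y. [H y, D y]) ys)"

definition row_weight :: "(nat \<Rightarrow> real \<times> real) \<Rightarrow> real \<Rightarrow> line \<Rightarrow> weight" where
  "row_weight P s r = (case r of H y \<Rightarrow> line_weight (reflect (P y)) s | D y \<Rightarrow> line_weight (P y) s
     | V x \<Rightarrow> sixv 0 0 0 0)"

definition pair_rows :: "(nat \<Rightarrow> real \<times> real) \<Rightarrow> nat list \<Rightarrow> real \<Rightarrow> (line \<times> weight) list" where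
  "pair_rows P ys s = map (\<lambda>r. (r, row_weight P s r)) (row_lines ys)"

text \<open>Exactly one path leaves each U-turn. The two weights are those for which the crossing of the two
  rows can be absorbed into the U-turn, see \<open>uturn_Z_reflect\<close>.\<close>

definition uturn :: "real \<times> real \<Rightarrow> bool \<Rightarrow> bool \<Rightarrow> real" where
  "uturn p h d = (if h \<and> \<not> d then fst p else if d \<and> \<not> h then snd p else 0)"

definition initial :: "(nat \<Rightarrow> real \<times> real) \<Rightarrow> nat list \<Rightarrow> nat list \<Rightarrow> line state" where
  "initial P ys xs \<sigma> = (\<Prod>y\<leftarrow>ys. uturn (P y) (\<sigma> (H y)) (\<sigma> (D y))) * (\<Prod>x\<leftarrow>xs. of_bool (\<not> \<sigma> (V x)))"

definition grid :: "(nat \<Rightarrow> real \<times> real) \<Rightarrow> (nat \<Rightarrow> real) \<Rightarrow> nat list \<Rightarrow> nat list \<Rightarrow> line state \<Rightarrow> line state" where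
  "grid P S ys xs = fold (\<lambda>x. column (V x) (pair_rows P ys (S x))) xs"

definition final :: "line \<Rightarrow> bool" where
  "final l = (case l of V x \<Rightarrow> True | _ \<Rightarrow> False)"

definition uturn_Z :: "(nat \<Rightarrow> real \<times> real) \<Rightarrow> (nat \<Rightarrow> real) \<Rightarrow> nat list \<Rightarrow> nat list \<Rightarrow> real" where
  "uturn_Z P S ys xs = grid P S ys xs (initial P ys xs) final"

lemma final_simps [simp]: "final (V x)" "\<not> final (H y)" "\<not> final (D y)"
  by (simp_all add: final_def)

lemma row_lines_Nil [simp]: "row_lines [] = []"
  and row_lines_Cons [simp]: "row_lines (y # ys) = H y # D y # row_lines ys"
  and row_lines_append [simp]: "row_lines (ys @ ys') = row_lines ys @ row_lines ys'"
  and set_row_lines: "set (row_lines ys) = H ` set ys \<union> D ` set ys"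
  by (auto simp: row_lines_def)

lemma distinct_row_lines: "distinct ys \<Longrightarrow> distinct (row_lines ys)"
  by (induction ys) (auto simp: set_row_lines)

lemma rows_Nil [simp]: "pair_rows P [] s = []"
  and rows_Cons [simp]: "pair_rows P (y # ys) s =
    (H y, line_weight (reflect (P y)) s) # (D y, line_weight (P y) s) # pair_rows P ys s"
  and rows_append [simp]: "pair_rows P (ys @ ys') s = pair_rows P ys s @ pair_rows P ys' s"
  by (auto simp: pair_rows_def row_weight_def)

lemma fst_rows: "fst ` set (pair_rows P ys s) = H ` set ys \<union> D ` set ys"
  by (force simp: pair_rows_def set_row_lines)

lemma grid_Nil [simp]: "grid P S ys [] \<psi> = \<psi>"
  and grid_Cons [simp]: "grid P S ys (x # xs) \<psi> = grid P S ys xs (column (V x) (pair_rows P ys (S x)) \<psi>)"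
  and grid_append [simp]: "grid P S ys (xs @ xs') \<psi> = grid P S ys xs' (grid P S ys xs \<psi>)"
  by (simp_all add: grid_def)

lemma grid_scale: "grid P S ys xs (\<lambda>\<sigma>. c * \<psi> \<sigma>) = (\<lambda>\<sigma>. c * grid P S ys xs \<psi> \<sigma>)"
  by (induction xs arbitrary: \<psi>) (auto simp: column_scale)

lemma initial_Cons_row: "initial P (y # ys) xs \<sigma> = uturn (P y) (\<sigma> (H y)) (\<sigma> (D y)) * initial P ys xs \<sigma>"
  by (simp add: initial_def)

lemma initial_snoc_column: "initial P ys (xs @ [x]) \<sigma> = of_bool (\<not> \<sigma> (V x)) * initial P ys xs \<sigma>"
  by (simp add: initial_def)

lemma initial_nonzero_column: "x \<in> set xs \<Longrightarrow> \<sigma> (V x) \<Longrightarrow> initial P ys xs \<sigma> = 0"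
  by (auto simp: initial_def prod_list_zero_iff)

lemma initial_eqI:
  assumes "\<And>y. y \<in> set ys \<Longrightarrow> \<sigma> (H y) = \<sigma>' (H y) \<and> \<sigma> (D y) = \<sigma>' (D y)"
    and "\<And>x. x \<in> set xs \<Longrightarrow> \<sigma> (V x) = \<sigma>' (V x)" and "\<And>y. y \<in> set ys \<Longrightarrow> P y = P' y"
  shows "initial P ys xs \<sigma> = initial P' ys xs \<sigma>'"
proof -
  have "map (\<lambda>y. uturn (P y) (\<sigma> (H y)) (\<sigma> (D y))) ys = map (\<lambda>y. uturn (P' y) (\<sigma>' (H y)) (\<sigma>' (D y))) ys"
    "map (\<lambda>x. of_bool (\<not> \<sigma> (V x)) :: real) xs = map (\<lambda>x. of_bool (\<not> \<sigma>' (V x))) xs"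
    using assms by auto
  then show ?thesis by (simp only: initial_def)
qed

lemma vop_grid_commute_columns:
  assumes "x \<notin> set xs" "x' \<notin> set xs"
  shows "vop (V x) (V x') w (grid P S ys xs \<psi>) = grid P S ys xs (vop (V x) (V x') w \<psi>)"
  using assms
proof (induction xs arbitrary: \<psi>)
  case (Cons z zs)
  have "vop (V x) (V x') w (column (V z) (pair_rows P ys (S z)) \<psi>) =
      column (V z) (pair_rows P ys (S z)) (vop (V x) (V x') w \<psi>)"
    using Cons.prems by (intro vop_column_commute) (auto simp: fst_rows)
  with Cons show ?case by auto
qed simp

text \<open>The crossing of the two columns sees two empty lines where they enter and two occupied
  lines where they leave. Both configurations have the weight
  \<open>S x - S x' + (1 + S x * S x')\<close>, which cancels.\<close>

lemma uturn_Z_swap_columns: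
  assumes "distinct ys" "distinct (xs1 @ [x, x'] @ xs2)" "S x - S x' + (1 + S x * S x') \<noteq> 0"
  shows "uturn_Z P S ys (xs1 @ [x, x'] @ xs2) = uturn_Z P S ys (xs1 @ [x', x] @ xs2)"
proof -
  define w where "w = column_crossing (S x) (S x')"
  define a where "a = S x - S x' + (1 + S x * S x')"
  define I where "I = initial P ys (xs1 @ [x, x'] @ xs2)"
  have I': "I = initial P ys (xs1 @ [x', x] @ xs2)" by (rule ext) (simp add: I_def initial_def)
  have I0: "I \<tau> = 0" if "\<tau> (V x) \<or> \<tau> (V x')" for \<tau>
    using that unfolding I_def by (auto intro: initial_nonzero_column)
  have xx: "x \<noteq> x'" using assms(2) by auto
  have ini: "vop (V x) (V x') w I = (\<lambda>\<sigma>. a * I \<sigma>)"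
  proof
    fix \<sigma>
    have z: "I (\<sigma>(V x := p, V x' := q)) = 0" if "p \<or> q" for p q
      using that by (intro I0) (auto simp: xx)
    have "\<sigma>(V x := False, V x' := False) = \<sigma>" if "\<not> \<sigma> (V x)" "\<not> \<sigma> (V x')"
      using that by (auto simp: fun_eq_iff)
    then show "vop (V x) (V x') w I \<sigma> = a * I \<sigma>"
      by (cases "\<sigma> (V x)"; cases "\<sigma> (V x')")
        (simp_all add: vop_def UNIV_bool z I0 w_def column_crossing_def sixv_def a_def)
  qed
  have fin: "vop (V x) (V x') w \<phi> final = a * \<phi> final" for \<phi>
  proof -
    have "final(V x := True, V x' := True) = final" by (auto simp: fun_eq_iff)
    then show ?thesis by (simp add: vop_def UNIV_bool w_def column_crossing_def sixv_def a_def)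
  qed
  have ex: "vop (V x) (V x') w (column (V x') (pair_rows P ys (S x')) (column (V x) (pair_rows P ys (S x)) \<phi>)) =
      column (V x) (pair_rows P ys (S x)) (column (V x') (pair_rows P ys (S x')) (vop (V x) (V x') w \<phi>))" for \<phi>
    unfolding pair_rows_def w_def
  proof (rule column_exchange)
    show "yang_baxter (row_weight P (S x) r) (row_weight P (S x') r) (column_crossing (S x) (S x'))"
      if "r \<in> set (row_lines ys)" for r
      using that by (auto simp: set_row_lines row_weight_def intro!: yang_baxter_column_crossing)
  qed (auto simp: xx set_row_lines distinct_row_lines assms(1))
  have c1: "vop (V x) (V x') w (grid P S ys xs2 \<phi>) = grid P S ys xs2 (vop (V x) (V x') w \<phi>)"
    and c2: "vop (V x) (V x') w (grid P S ys xs1 \<phi>) = grid P S ys xs1 (vop (V x) (V x') w \<phi>)" for \<phi>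
    using assms(2) by (intro vop_grid_commute_columns; auto)+
  have "a * uturn_Z P S ys (xs1 @ [x, x'] @ xs2)
      = vop (V x) (V x') w (grid P S ys (xs1 @ [x, x'] @ xs2) I) final"
    by (simp add: fin uturn_Z_def I_def)
  also have "\<dots> = grid P S ys (xs1 @ [x', x] @ xs2) (vop (V x) (V x') w I) final"
    by (simp add: c1 ex c2)
  also have "\<dots> = a * uturn_Z P S ys (xs1 @ [x', x] @ xs2)"
    unfolding ini uturn_Z_def I'[symmetric] by (simp add: grid_scale)
  finally show ?thesis using assms(3) by (simp add: a_def)
qed

lemma uturn_Z_column_last:
  assumes "distinct ys" "distinct (xs1 @ x # xs2)"
    "\<And>x'. x' \<in> set xs2 \<Longrightarrow> S x - S x' + (1 + S x * S x') \<noteq> 0"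
  shows "uturn_Z P S ys (xs1 @ x # xs2) = uturn_Z P S ys (xs1 @ xs2 @ [x])"
  using assms(2,3)
proof (induction xs2 arbitrary: xs1)
  case (Cons x' xs2)
  have "uturn_Z P S ys (xs1 @ x # x' # xs2) = uturn_Z P S ys (xs1 @ x' # x # xs2)"
    using uturn_Z_swap_columns[OF assms(1), of xs1 x x' xs2 S P] Cons.prems by auto
  also have "\<dots> = uturn_Z P S ys ((xs1 @ [x']) @ xs2 @ [x])"
    using Cons.IH[of "xs1 @ [x']"] Cons.prems by auto
  finally show ?case by simp
qed simp

lemma reflect_reflect: "reflect (reflect p) = p"
  by (cases p) (simp add: reflect_def field_simps)

text \<open>On the right the braiding of the two rows meets empty lines and yields
  \<open>sqrt 2 * (a\<^sup>2 - b\<^sup>2)\<close>. On the left it is absorbed: it maps the U-turn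
  with the reflected parameter to \<open>- 2 * sqrt 2 * a * b\<close> times the U-turn with the
  original one.\<close>

lemma uturn_Z_reflect:
  assumes "distinct (ys1 @ y # ys2)" "P y = (a, b)"
  shows "(a\<^sup>2 - b\<^sup>2) * uturn_Z (P(y := reflect (a, b))) S (ys1 @ y # ys2) xs =
    - 2 * a * b * uturn_Z P S (ys1 @ y # ys2) xs"
proof -
  define w where "w = row_braiding (a, b)"
  let ?ys = "ys1 @ y # ys2" and ?P = "P(y := reflect (a, b))"
  have r: "pair_rows ?P ys1 s = pair_rows P ys1 s" "pair_rows ?P ys2 s = pair_rows P ys2 s" for s
    using assms(1) by (auto simp: pair_rows_def row_weight_def set_row_lines)
  have col: "vop (H y) (D y) w (column (V x) (pair_rows ?P ?ys s) \<phi>) =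
      column (V x) (pair_rows P ?ys s) (vop (H y) (D y) w \<phi>)" for x s \<phi>
    using column_braid[OF braid_row_braiding[of "(a, b)" s], of "H y" "D y" "V x" "pair_rows P ys1 s" "pair_rows P ys2 s"]
      assms by (auto simp: fst_rows r reflect_reflect w_def)
  have gr: "vop (H y) (D y) w (grid ?P S ?ys xs \<phi>) = grid P S ?ys xs (vop (H y) (D y) w \<phi>)" for \<phi>
    by (induction xs arbitrary: \<phi>) (simp_all only: grid_Nil grid_Cons col)
  have fin: "vop (H y) (D y) w \<phi> final = sqrt 2 * (a\<^sup>2 - b\<^sup>2) * \<phi> final" for \<phi>
  proof -
    have "final(H y := False, D y := False) = final" by (auto simp: fun_eq_iff)
    then show ?thesis by (simp add: vop_def UNIV_bool w_def row_braiding_def sixv_def)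
  qed
  have ini: "vop (H y) (D y) w (initial ?P ?ys xs) = (\<lambda>\<sigma>. - 2 * sqrt 2 * a * b * initial P ?ys xs \<sigma>)"
  proof
    fix \<sigma>
    define R where "R = initial P (ys1 @ ys2) xs"
    have eq: "initial ?P (ys1 @ ys2) xs \<tau> = R \<tau>" for \<tau>
      unfolding R_def using assms(1) by (intro initial_eqI) auto
    have gen: "initial Q ?ys xs \<tau> = uturn (Q y) (\<tau> (H y)) (\<tau> (D y)) * initial Q (ys1 @ ys2) xs \<tau>"
      for Q \<tau> by (simp add: initial_def)
    have 1: "initial ?P ?ys xs \<tau> = uturn (reflect (a, b)) (\<tau> (H y)) (\<tau> (D y)) * R \<tau>"
      "initial P ?ys xs \<tau> = uturn (a, b) (\<tau> (H y)) (\<tau> (D y)) * R \<tau>" for \<tau>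
      using assms(2) unfolding gen eq by (simp_all add: R_def)
    have 2: "R (\<sigma>(H y := p, D y := q)) = R \<sigma>" for p q
      unfolding R_def using assms(1) by (intro initial_eqI) auto
    show "vop (H y) (D y) w (initial ?P ?ys xs) \<sigma> = - 2 * sqrt 2 * a * b * initial P ?ys xs \<sigma>"
      unfolding vop_def 1 2
      by (cases "\<sigma> (H y)"; cases "\<sigma> (D y)")
        (simp_all add: UNIV_bool uturn_def w_def row_braiding_def sixv_def reflect_def field_simps
          power2_eq_square)
  qed
  have "sqrt 2 * ((a\<^sup>2 - b\<^sup>2) * uturn_Z ?P S ?ys xs) =
      vop (H y) (D y) w (grid ?P S ?ys xs (initial ?P ?ys xs)) final"
    by (simp add: fin uturn_Z_def)
  also have "\<dots> = sqrt 2 * (- 2 * a * b * uturn_Z P S ?ys xs)"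
    unfolding gr ini grid_scale uturn_Z_def by simp
  finally show ?thesis unfolding mult_cancel_left by simp
qed

section \<open>Frozen lines\<close>

definition ice :: "weight \<Rightarrow> bool" where
  "ice w \<longleftrightarrow> (\<forall>p q r s. w p q r s \<noteq> 0 \<longrightarrow> of_bool p + of_bool q = (of_bool r + of_bool s :: nat))"

lemma ice_sixv: "ice (sixv a b c d)"
  unfolding ice_def all_bool_eq by (simp add: sixv_def)

lemma ice_line_weight: "ice (line_weight p s)"
  by (cases p) (simp add: line_weight_def ice_sixv)

lemma iceD:
  assumes "ice w"
  shows "w True True False False = 0" "w True False False False = 0" "w False True False False = 0"
    "w False False True False = 0" "w False False False True = 0" "w False False True True = 0"
    "w True True True False = 0" "w True True False True = 0" "w True False True True = 0"
    "w False True True True = 0"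
proof -
  have "w p q r s = 0" if "of_bool p + of_bool q \<noteq> (of_bool r + of_bool s :: nat)" for p q r s
    using assms that unfolding ice_def by blast
  then show "w True True False False = 0" "w True False False False = 0" "w False True False False = 0"
    "w False False True False = 0" "w False False False True = 0" "w False False True True = 0"
    "w True True True False = 0" "w True True False True = 0" "w True False True True = 0"
    "w False True True True = 0"
    by simp_all
qed

lemma ice_rows: "\<forall>(r, w)\<in>set (pair_rows P ys s). ice w"
  by (induction ys) (simp_all add: ice_line_weight)

text \<open>If \<open>v\<close>, \<open>h\<close> and all rows of \<open>rs\<close> are empty
  afterwards, conservation leaves no path before, where \<open>\<Phi>\<close> vanishes. The second
  claim uses the first to exclude that the path turned into \<open>v\<close> from the last row,
  since \<open>v\<close> would have been empty before that turn; hence one induction for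
  both.\<close>

lemma column_frozen:
  assumes "\<And>\<sigma>. \<not> \<sigma> v \<Longrightarrow> \<not> \<sigma> h \<Longrightarrow> \<Phi> \<sigma> = 0"
    and "\<forall>(r, w)\<in>set rs. ice w" "distinct (map fst rs)" "v \<notin> fst ` set rs" "h \<notin> fst ` set rs" "v \<noteq> h"
  shows "\<not> \<sigma> v \<Longrightarrow> \<not> \<sigma> h \<Longrightarrow> \<forall>r\<in>fst ` set rs. \<not> \<sigma> r \<Longrightarrow> column v rs \<Phi> \<sigma> = 0"
    and "\<sigma> v \<Longrightarrow> \<not> \<sigma> h \<Longrightarrow> \<forall>r\<in>fst ` set rs. \<not> \<sigma> r \<Longrightarrow>
      column v rs \<Phi> \<sigma> = (\<Prod>(r, w)\<leftarrow>rs. w False True False True) * \<Phi> \<sigma>"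
  using assms(2-5)
proof (induction rs arbitrary: \<sigma> rule: rev_induct)
  case Nil
  {
    case 1
    then show ?case using assms(1) by simp
  next
    case 2
    then show ?case by simp
  }
next
  case (snoc rw rs)
  obtain r w where rw: "rw = (r, w)" by force
  have rv: "r \<noteq> v" "r \<noteq> h" "r \<notin> fst ` set rs" "ice w" if "distinct (map fst (rs @ [rw]))"
    "v \<notin> fst ` set (rs @ [rw])" "h \<notin> fst ` set (rs @ [rw])" "\<forall>(r, w)\<in>set (rs @ [rw]). ice w"
    using that by (auto simp: rw)
  {
    case 1
    note rv = rv[OF 1(5,6,7,4)]
    have "column v rs \<Phi> (\<sigma>(r := False, v := False)) = 0"
      using 1 rv assms(6) by (intro snoc.IH(1)) (auto simp: rw)
    then show ?case using 1 rv iceD[OF rv(4)] by (simp add: rw vop_def UNIV_bool)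
  next
    case 2
    note rv = rv[OF 2(5,6,7,4)]
    have "column v rs \<Phi> (\<sigma>(r := True, v := False)) = 0"
      using 2 rv assms(6) by (intro snoc.IH(1)) (auto simp: rw)
    moreover have "\<sigma>(r := False, v := True) = \<sigma>" using 2 rv by (auto simp: rw fun_eq_iff)
    moreover have "column v rs \<Phi> \<sigma> = (\<Prod>(r, w)\<leftarrow>rs. w False True False True) * \<Phi> \<sigma>"
      using 2 by (intro snoc.IH(2)) auto
    ultimately show ?case using 2 rv iceD[OF rv(4)] by (simp add: rw vop_def UNIV_bool)
  }
qed

lemma vop_cong_on:
  assumes "\<And>\<sigma>. \<sigma> \<in> A \<Longrightarrow> \<psi> \<sigma> = \<psi>' \<sigma>" "\<And>\<sigma> a b. \<sigma> \<in> A \<Longrightarrow> \<sigma>(i := a, j := b) \<in> A" "\<sigma> \<in> A"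
  shows "vop i j w \<psi> \<sigma> = vop i j w \<psi>' \<sigma>"
  using assms by (simp add: vop_def)

text \<open>A set \<open>A\<close> that is stable under the updates made by the operator acts as a
  boundary condition: the state is only read at points reached from the given one by such
  updates.\<close>

lemma column_cong_on:
  assumes "\<And>\<sigma>. \<sigma> \<in> A \<Longrightarrow> \<psi> \<sigma> = \<psi>' \<sigma>"
    and "\<And>\<sigma> a b r. r \<in> fst ` set rs \<Longrightarrow> \<sigma> \<in> A \<Longrightarrow> \<sigma>(r := a, v := b) \<in> A" "\<sigma> \<in> A"
  shows "column v rs \<psi> \<sigma> = column v rs \<psi>' \<sigma>"
  using assms
proof (induction rs arbitrary: \<psi> \<psi>' \<sigma>)
  case (Cons rw rs)
  obtain r w where rw: "rw = (r, w)" by force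
  have "vop r v w \<psi> \<tau> = vop r v w \<psi>' \<tau>" if "\<tau> \<in> A" for \<tau>
  proof (rule vop_cong_on[of A])
    show "\<tau>'(r := a, v := b) \<in> A" if "\<tau>' \<in> A" for \<tau>' a b
      by (rule Cons.prems(2)) (simp_all add: rw that)
  qed (use Cons.prems that in auto)
  then have "column v rs (vop r v w \<psi>) \<sigma> = column v rs (vop r v w \<psi>') \<sigma>"
  proof (rule Cons.IH)
    show "\<tau>'(r' := a, v := b) \<in> A" if "r' \<in> fst ` set rs" "\<tau>' \<in> A" for \<tau>' a b r'
      by (rule Cons.prems(2)) (use that in simp_all)
  qed (use Cons.prems in auto)
  then show ?case by (simp add: rw)
qed simp

lemma column_zero_on:
  assumes "\<And>\<sigma>. \<sigma> \<in> A \<Longrightarrow> \<psi> \<sigma> = 0"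
    and "\<And>\<sigma> a b r. r \<in> fst ` set rs \<Longrightarrow> \<sigma> \<in> A \<Longrightarrow> \<sigma>(r := a, v := b) \<in> A" "\<sigma> \<in> A"
  shows "column v rs \<psi> \<sigma> = 0"
proof -
  have "column v rs \<psi> \<sigma> = column v rs (\<lambda>\<tau>. 0 * \<psi> \<tau>) \<sigma>"
    using assms by (intro column_cong_on[of A]) auto
  then show ?thesis unfolding column_scale by simp
qed

lemma grid_cong_on:
  assumes "\<And>\<sigma>. \<sigma> \<in> A \<Longrightarrow> \<psi> \<sigma> = \<psi>' \<sigma>"
    and "\<And>\<sigma> a b r x. r \<in> set (row_lines ys) \<Longrightarrow> x \<in> set xs \<Longrightarrow> \<sigma> \<in> A \<Longrightarrow> \<sigma>(r := a, V x := b) \<in> A"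
    and "\<sigma> \<in> A"
  shows "grid P S ys xs \<psi> \<sigma> = grid P S ys xs \<psi>' \<sigma>"
  using assms
proof (induction xs arbitrary: \<psi> \<psi>')
  case (Cons x xs)
  have "column (V x) (pair_rows P ys (S x)) \<psi> \<tau> = column (V x) (pair_rows P ys (S x)) \<psi>' \<tau>" if "\<tau> \<in> A" for \<tau>
  proof (rule column_cong_on[of A])
    show "\<tau>'(r := a, V x := b) \<in> A" if "r \<in> fst ` set (pair_rows P ys (S x))" "\<tau>' \<in> A" for \<tau>' a b r
      by (rule Cons.prems(2)) (use that in \<open>simp_all add: fst_rows set_row_lines\<close>)
  qed (use Cons.prems that in auto)
  then have "grid P S ys xs (column (V x) (pair_rows P ys (S x)) \<psi>) \<sigma> =
      grid P S ys xs (column (V x) (pair_rows P ys (S x)) \<psi>') \<sigma>"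
  proof (rule Cons.IH)
    show "\<tau>'(r := a, V x' := b) \<in> A" if "r \<in> set (row_lines ys)" "x' \<in> set xs" "\<tau>' \<in> A" for \<tau>' a b r x'
      by (rule Cons.prems(2)) (use that in simp_all)
  qed (use Cons.prems in auto)
  then show ?case by simp
qed simp

definition pass_h :: "real \<times> real \<Rightarrow> real \<Rightarrow> real" where
  "pass_h p s = line_weight (reflect p) s True False True False * line_weight p s False False False False"

definition pass_v :: "real \<times> real \<Rightarrow> real \<Rightarrow> real" where
  "pass_v p s = line_weight (reflect p) s False True False True * line_weight p s False True False True"

text \<open>A path leaving the upper row of the top pair on the right must have come from the U-turn
  and gone straight, because all vertical lines enter empty.\<close>

lemma column_top_pair:
  assumes "y \<notin> set ys"
    and H: "\<And>\<sigma>. \<sigma> (H y) \<Longrightarrow> \<sigma> (D y) \<Longrightarrow> \<Omega> \<sigma> = 0" and X: "\<And>\<sigma>. \<sigma> (V x) \<Longrightarrow> \<Omega> \<sigma> = 0"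
  shows "\<sigma> (H y) \<Longrightarrow> \<sigma> (D y) \<Longrightarrow> column (V x) (pair_rows P (y # ys) s) \<Omega> \<sigma> = 0"
    and "\<sigma> (H y) \<Longrightarrow> \<not> \<sigma> (D y) \<Longrightarrow> column (V x) (pair_rows P (y # ys) s) \<Omega> \<sigma> =
      pass_h (P y) s * column (V x) (pair_rows P ys s) \<Omega> \<sigma>"
proof -
  define w1 w2 where "w1 = line_weight (reflect (P y)) s" and "w2 = line_weight (P y) s"
  define \<Theta> where "\<Theta> = vop (D y) (V x) w2 (vop (H y) (V x) w1 \<Omega>)"
  have ice: "ice w1" "ice w2" by (simp_all add: w1_def w2_def ice_line_weight)
  have 1: "vop (H y) (V x) w1 \<Omega> \<tau> = (if \<tau> (V x) then 0 else w1 True False True False * \<Omega> \<tau>)"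
    if "\<tau> (H y)" for \<tau>
  proof -
    have "\<tau>(H y := True, V x := False) = \<tau>" if "\<not> \<tau> (V x)"
      using that \<open>\<tau> (H y)\<close> by (auto simp: fun_eq_iff)
    then show ?thesis using that by (auto simp: vop_def UNIV_bool X iceD[OF ice(1)])
  qed
  have 2: "\<Theta> \<tau> = 0" if "\<tau> (H y)" "\<tau> (D y)" for \<tau>
    using that by (cases "\<tau> (V x)") (simp_all add: \<Theta>_def vop_def[of "D y"] UNIV_bool 1 H iceD[OF ice(2)])
  have 3: "\<Theta> \<tau> = w1 True False True False * w2 False False False False * \<Omega> \<tau>"
    if "\<tau> (H y)" "\<not> \<tau> (D y)" for \<tau>
  proof -
    have "\<tau>(D y := False, V x := False) = \<tau>" if "\<not> \<tau> (V x)"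
      using that \<open>\<not> \<tau> (D y)\<close> by (auto simp: fun_eq_iff)
    then show ?thesis using that
      by (cases "\<tau> (V x)") (simp_all add: \<Theta>_def vop_def[of "D y"] UNIV_bool 1 H X iceD[OF ice(2)])
  qed
  have col: "column (V x) (pair_rows P (y # ys) s) \<Omega> = column (V x) (pair_rows P ys s) \<Theta>"
    by (simp add: \<Theta>_def w1_def w2_def)
  have upd: "(\<tau>(r := a, V x := b)) (H y) = \<tau> (H y)" "(\<tau>(r := a, V x := b)) (D y) = \<tau> (D y)"
    if "r \<in> fst ` set (pair_rows P ys s)" for \<tau> r a b
    using that assms(1) by (auto simp: fst_rows)
  show "column (V x) (pair_rows P (y # ys) s) \<Omega> \<sigma> = 0" if "\<sigma> (H y)" "\<sigma> (D y)"
    unfolding col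
    by (rule column_zero_on[of "{\<tau>. \<tau> (H y) \<and> \<tau> (D y)}"]) (simp_all add: 2 that upd del: fun_upd_apply)
  show "column (V x) (pair_rows P (y # ys) s) \<Omega> \<sigma> =
      pass_h (P y) s * column (V x) (pair_rows P ys s) \<Omega> \<sigma>" if "\<sigma> (H y)" "\<not> \<sigma> (D y)"
  proof -
    define k where "k = w1 True False True False * w2 False False False False"
    have "column (V x) (pair_rows P ys s) \<Theta> \<sigma> = column (V x) (pair_rows P ys s) (\<lambda>\<tau>. k * \<Omega> \<tau>) \<sigma>"
      by (rule column_cong_on[of "{\<tau>. \<tau> (H y) \<and> \<not> \<tau> (D y)}"])
        (simp_all add: 3 that k_def upd del: fun_upd_apply)
    then show ?thesis unfolding col column_scale by (simp add: k_def w1_def w2_def pass_h_def)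
  qed
qed

text \<open>Both vanishing conditions on \<open>\<Omega>\<close> persist through every column: the
  rows of the pair are never both occupied, and columns not yet reached stay empty. So each column
  splits off the factor of a straight passage and the pair decouples.\<close>

lemma grid_top_pair:
  assumes "y \<notin> set ys" "distinct xs"
    and "\<And>\<sigma>. \<sigma> (H y) \<Longrightarrow> \<sigma> (D y) \<Longrightarrow> \<Omega> \<sigma> = 0" "\<And>\<sigma> x. x \<in> set xs \<Longrightarrow> \<sigma> (V x) \<Longrightarrow> \<Omega> \<sigma> = 0"
    and "\<sigma> (H y)" "\<not> \<sigma> (D y)"
  shows "grid P S (y # ys) xs \<Omega> \<sigma> =
    (\<Prod>x\<leftarrow>xs. pass_h (P y) (S x)) * grid P S ys xs \<Omega> \<sigma>"
  using assms(2-4)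
proof (induction xs arbitrary: \<Omega>)
  case (Cons x xs)
  define k where "k = pass_h (P y) (S x)"
  let ?\<Omega> = "column (V x) (pair_rows P (y # ys) (S x)) \<Omega>"
  have X: "\<tau> (V x) \<Longrightarrow> \<Omega> \<tau> = 0" for \<tau> by (rule Cons.prems(3)[of x]) simp_all
  have "grid P S (y # ys) xs ?\<Omega> \<sigma> =
    (\<Prod>x\<leftarrow>xs. pass_h (P y) (S x)) * grid P S ys xs ?\<Omega> \<sigma>"
  proof (rule Cons.IH)
    show "?\<Omega> \<tau> = 0" if "\<tau> (H y)" "\<tau> (D y)" for \<tau>
      using column_top_pair(1)[OF assms(1), of \<Omega> x] Cons.prems X that by blast
    show "?\<Omega> \<tau> = 0" if "x' \<in> set xs" "\<tau> (V x')" for \<tau> x'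
      using Cons.prems that by (intro column_zero_on[of "{\<tau>. \<tau> (V x')}"]) (auto simp: fst_rows)
  qed (use Cons.prems in auto)
  moreover have "grid P S ys xs ?\<Omega> \<sigma> = grid P S ys xs (\<lambda>\<tau>. k * column (V x) (pair_rows P ys (S x)) \<Omega> \<tau>) \<sigma>"
  proof (rule grid_cong_on[of "{\<tau>. \<tau> (H y) \<and> \<not> \<tau> (D y)}"])
    show "?\<Omega> \<tau> = k * column (V x) (pair_rows P ys (S x)) \<Omega> \<tau>" if "\<tau> \<in> {\<tau>. \<tau> (H y) \<and> \<not> \<tau> (D y)}" for \<tau>
      using column_top_pair(2)[OF assms(1), of \<Omega> x \<tau> P "S x"] Cons.prems X that unfolding k_def by blast
  qed (use assms in \<open>auto simp: set_row_lines\<close>)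
  ultimately show ?case by (simp add: grid_scale k_def)
qed simp

definition insensitive :: "'l \<Rightarrow> 'l state \<Rightarrow> bool" where
  "insensitive l \<psi> \<longleftrightarrow> (\<forall>\<sigma> b. \<psi> (\<sigma>(l := b)) = \<psi> \<sigma>)"

lemma insensitive_vop: "insensitive l \<psi> \<Longrightarrow> l \<noteq> i \<Longrightarrow> l \<noteq> j \<Longrightarrow> insensitive l (vop i j w \<psi>)"
  unfolding insensitive_def vop_def by (simp add: fun_upd_twist[of l i] fun_upd_twist[of l j])

lemma insensitive_column: "insensitive l \<psi> \<Longrightarrow> l \<noteq> v \<Longrightarrow> l \<notin> fst ` set rs \<Longrightarrow> insensitive l (column v rs \<psi>)"
  by (induction rs arbitrary: \<psi>) (auto simp: insensitive_vop)

lemma insensitive_grid: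
  "insensitive l \<psi> \<Longrightarrow> l \<notin> V ` set xs \<Longrightarrow> l \<notin> set (row_lines ys) \<Longrightarrow> insensitive l (grid P S ys xs \<psi>)"
proof (induction xs arbitrary: \<psi>)
  case (Cons x xs)
  then have "insensitive l (column (V x) (pair_rows P ys (S x)) \<psi>)"
    by (intro insensitive_column) (auto simp: fst_rows set_row_lines)
  with Cons show ?case by auto
qed simp

lemma insensitive_initial:
  assumes "l \<notin> V ` set xs" "l \<notin> set (row_lines ys)"
  shows "insensitive l (initial P ys xs)"
  unfolding insensitive_def using assms
  by (auto simp: set_row_lines intro!: initial_eqI split: if_splits)

text \<open>The equation for \<open>t\<close> says that two empty lines have weight 0 at the vertex
  of the top row and the last column. There the column enters and the row leaves empty, so a path
  must arrive along the row and turn; it then runs straight down, and the top row is occupied in all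
  other columns. The factors come from the turn, the second row of the pair, the other rows and the
  other columns.\<close>

lemma uturn_Z_frozen:
  assumes "distinct (y # ys)" "distinct (xs @ [x])"
    and P: "P y = (1, t)" and t: "1 - t + (1 + t) * S x = 0"
  shows "uturn_Z P S (y # ys) (xs @ [x]) =
    (1 + (S x)\<^sup>2) * (1 - t * S x - S x - t)
    * (\<Prod>y\<leftarrow>ys. pass_v (P y) (S x))
    * (\<Prod>x\<leftarrow>xs. 2 * (1 + t * S x) * (1 - t * S x)) * uturn_Z P S ys xs"
proof -
  define I where "I = initial P (y # ys) (xs @ [x])"
  define \<Psi> where "\<Psi> = grid P S (y # ys) xs I"
  define w where "w = line_weight (reflect (P y)) (S x)"
  define w' where "w' = line_weight (P y) (S x)"
  define \<Phi> where "\<Phi> = vop (H y) (V x) w \<Psi>"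
  define \<sigma> where "\<sigma> = final(H y := True, V x := False)"
  have x: "x \<notin> set xs" and y: "y \<notin> set ys" using assms by auto
  have ice: "ice w" "ice w'" by (simp_all add: w_def w'_def ice_line_weight)
  have I0: "I \<tau> = 0" if "\<tau> (V x')" "x' \<in> set (xs @ [x])" for \<tau> x'
    using that unfolding I_def by (intro initial_nonzero_column)
  have \<Psi>0: "\<Psi> \<tau> = 0" if "\<tau> (V x)" for \<tau>
  proof -
    have "grid P S (y # ys) xs I \<tau> = grid P S (y # ys) xs (\<lambda>\<tau>. 0 * I \<tau>) \<tau>"
      using x that I0[of _ x] by (intro grid_cong_on[of "{\<tau>. \<tau> (V x)}"]) (auto simp: set_row_lines)
    then show ?thesis unfolding \<Psi>_def grid_scale by simp
  qed
  have wt: "w False False False False = 0" "w True False False True = 1 + (S x)\<^sup>2"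
    using t by (simp_all add: w_def P line_weight_reflect sixv_def)
  have wt': "w' False True False True = 1 - t * S x - S x - t"
    by (simp add: w'_def P line_weight_def sixv_def)
  have \<Phi>0: "\<Phi> \<tau> = 0" if "\<not> \<tau> (V x)" "\<not> \<tau> (H y)" for \<tau>
    using that by (simp add: \<Phi>_def vop_def UNIV_bool iceD[OF ice(1)] wt)
  have \<Phi>1: "\<Phi> final = (1 + (S x)\<^sup>2) * \<Psi> \<sigma>"
    by (simp add: \<Phi>_def vop_def UNIV_bool iceD[OF ice(1)] wt \<Psi>0 \<sigma>_def)
  have "uturn_Z P S (y # ys) (xs @ [x]) = column (V x) ((D y, w') # pair_rows P ys (S x)) \<Phi> final"
    by (simp add: uturn_Z_def I_def \<Psi>_def \<Phi>_def w_def w'_def)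
  also have "\<dots> = (\<Prod>(r, w)\<leftarrow>(D y, w') # pair_rows P ys (S x). w False True False True) * \<Phi> final"
  proof (rule column_frozen(2)[of "V x" "H y"])
    show "distinct (map fst ((D y, w') # pair_rows P ys (S x)))"
      using assms(1) distinct_row_lines[of ys]
      by (auto simp: pair_rows_def o_def set_row_lines)
    show "\<forall>(r, w)\<in>set ((D y, w') # pair_rows P ys (S x)). ice w"
      using ice_rows ice by auto
  qed (use \<Phi>0 y in \<open>auto simp: fst_rows\<close>)
  finally have Z: "uturn_Z P S (y # ys) (xs @ [x]) =
      (\<Prod>(r, w)\<leftarrow>(D y, w') # pair_rows P ys (S x). w False True False True) * \<Phi> final" .
  have prod: "(\<Prod>(r, w)\<leftarrow>(D y, w') # pair_rows P ys (S x). w False True False True) =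
      (1 - t * S x - S x - t) * (\<Prod>y\<leftarrow>ys. pass_v (P y) (S x))"
  proof -
    have "(\<Prod>(r, w)\<leftarrow>pair_rows P zs (S x). w False True False True) = (\<Prod>y\<leftarrow>zs. pass_v (P y) (S x))" for zs
      by (induction zs) (auto simp: pass_v_def)
    then show ?thesis by (simp add: wt')
  qed
  have "\<Psi> \<sigma> = (\<Prod>x\<leftarrow>xs. pass_h (P y) (S x)) * grid P S ys xs I \<sigma>"
    unfolding \<Psi>_def
  proof (rule grid_top_pair)
    show "I \<tau> = 0" if "\<tau> (H y)" "\<tau> (D y)" for \<tau>
      using that by (simp add: I_def initial_Cons_row uturn_def)
    show "I \<tau> = 0" if "x' \<in> set xs" "\<tau> (V x')" for \<tau> x'
      using that I0 by auto
  qed (use assms in \<open>auto simp: \<sigma>_def\<close>)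
  also have "(\<Prod>x\<leftarrow>xs. pass_h (P y) (S x)) = (\<Prod>x\<leftarrow>xs. 2 * (1 + t * S x) * (1 - t * S x))"
  proof -
    have "line_weight (reflect (P y)) s True False True False = sqrt 2 * (1 + t * s)"
      "line_weight (P y) s False False False False = sqrt 2 * (1 - t * s)" for s
      by (simp_all add: P line_weight_reflect sixv_def) (simp add: line_weight_def sixv_def)
    moreover have "sqrt 2 * a * (sqrt 2 * b) = 2 * a * b" for a b
      by (metis mult.assoc mult.commute real_sqrt_mult_self abs_numeral)
    ultimately show ?thesis by (simp only: pass_h_def)
  qed
  \<comment> \<open>The U-turn of the removed pair contributes
    \<open>fst (1, t) = 1\<close>.\<close>
  also have "grid P S ys xs I \<sigma> = grid P S ys xs (initial P ys xs) \<sigma>"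
    using x y by (intro grid_cong_on[of "{\<tau>. \<tau> (H y) \<and> \<not> \<tau> (D y) \<and> \<not> \<tau> (V x)}"])
      (auto simp: \<sigma>_def I_def initial_Cons_row initial_snoc_column uturn_def P set_row_lines)
  \<comment> \<open>\<open>\<sigma>\<close> differs from \<open>final\<close> only on
    \<open>H y\<close> and \<open>V x\<close>, which the smaller model does not touch.\<close>
  also have "\<dots> = uturn_Z P S ys xs"
  proof -
    have "insensitive l (grid P S ys xs (initial P ys xs))" if "l = H y \<or> l = V x" for l
      using that x y by (intro insensitive_grid insensitive_initial) (auto simp: set_row_lines)
    then show ?thesis by (simp add: uturn_Z_def \<sigma>_def insensitive_def)
  qed
  finally have \<Psi>: "\<Psi> \<sigma> = (\<Prod>x\<leftarrow>xs. 2 * (1 + t * S x) * (1 - t * S x)) * uturn_Z P S ys xs" .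
  show ?thesis unfolding Z prod \<Phi>1 \<Psi> by (simp only: mult_ac)
qed

section \<open>Polynomial dependence on a row parameter\<close>

text \<open>Polynomiality is recorded only at vectors \<open>(1, t)\<close>. A reflected vector has
  another first entry, and the scaling law brings it back to this chart.\<close>

definition binary_form :: "nat \<Rightarrow> (real \<times> real \<Rightarrow> real) \<Rightarrow> bool" where
  "binary_form d f \<longleftrightarrow> (\<exists>p. degree p \<le> d \<and> (\<forall>t. f (1, t) = poly p t)) \<and>
     (\<forall>c x y. f (c * x, c * y) = c ^ d * f (x, y))"

lemma form_zero: "binary_form d (\<lambda>_. 0)"
  unfolding binary_form_def by (auto intro: exI[of _ 0])

lemma form_const: "binary_form 0 (\<lambda>_. c)"
  unfolding binary_form_def by (auto intro: exI[of _ "[:c:]"])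

lemma form_linear: "binary_form 1 (\<lambda>p. a * fst p + b * snd p)"
  unfolding binary_form_def by (auto intro!: exI[of _ "[:a, b:]"] simp: algebra_simps)

lemma form_norm: "binary_form 2 (\<lambda>p. (fst p)\<^sup>2 + (snd p)\<^sup>2)"
  unfolding binary_form_def
  by (auto intro!: exI[of _ "[:1, 0, 1:]"] simp: algebra_simps power2_eq_square)

lemma form_add: "binary_form d f \<Longrightarrow> binary_form d g \<Longrightarrow> binary_form d (\<lambda>p. f p + g p)"
  unfolding binary_form_def
proof (elim conjE exE, intro conjI)
  fix p q assume "degree p \<le> d" "\<forall>t. f (1, t) = poly p t" "degree q \<le> d" "\<forall>t. g (1, t) = poly q t"
  then show "\<exists>p. degree p \<le> d \<and> (\<forall>t. f (1, t) + g (1, t) = poly p t)"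
    by (intro exI[of _ "p + q"]) (simp add: degree_add_le)
qed (auto simp: algebra_simps)

lemma form_mult: "binary_form d f \<Longrightarrow> binary_form e g \<Longrightarrow> binary_form (d + e) (\<lambda>p. f p * g p)"
  unfolding binary_form_def
proof (elim conjE exE, intro conjI)
  fix p q assume "degree p \<le> d" "\<forall>t. f (1, t) = poly p t" "degree q \<le> e" "\<forall>t. g (1, t) = poly q t"
  then show "\<exists>p. degree p \<le> d + e \<and> (\<forall>t. f (1, t) * g (1, t) = poly p t)"
    by (intro exI[of _ "p * q"]) (auto intro: order.trans[OF degree_mult_le])
qed (auto simp: algebra_simps power_add)

lemma form_cmult: "binary_form d f \<Longrightarrow> binary_form d (\<lambda>p. c * f p)"
  using form_mult[OF form_const[of c], of d f] by simp

text \<open>The degree of an entry exceeds 1 by the gain in occupation of the row, so the degrees of a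
  product of entries along the row telescope.\<close>

lemma form_sixv:
  assumes "binary_form 1 a" "binary_form 1 b" "binary_form 0 c" "binary_form 2 d"
  shows "binary_form (1 + of_bool r - of_bool p) (\<lambda>z. sixv (a z) (b z) (c z) (d z) p q r s)"
  using assms by (cases p; cases q; cases r; cases s) (simp_all add: sixv_def form_zero numeral_2_eq_2)

lemma form_line_weight:
  "binary_form (1 + of_bool r - of_bool p) (\<lambda>z. line_weight z s p q r v)"
  "binary_form (1 + of_bool r - of_bool p) (\<lambda>z. line_weight (reflect z) s p q r v)"
proof -
  have 1: "line_weight z s = sixv (sqrt 2 * fst z + - (sqrt 2 * s) * snd z)
      ((1 - s) * fst z + (- s - 1) * snd z) (1 + s\<^sup>2) ((fst z)\<^sup>2 + (snd z)\<^sup>2)" for z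
    by (cases z) (simp add: line_weight_def algebra_simps)
  have 2: "line_weight (reflect z) s = sixv ((1 + s) * fst z + (s - 1) * snd z)
      (sqrt 2 * fst z + (sqrt 2 * s) * snd z) (1 + s\<^sup>2) ((fst z)\<^sup>2 + (snd z)\<^sup>2)" for z
    by (cases z) (simp add: line_weight_reflect algebra_simps)
  show "binary_form (1 + of_bool r - of_bool p) (\<lambda>z. line_weight z s p q r v)"
    unfolding 1 by (intro form_sixv form_linear form_norm form_const)
  show "binary_form (1 + of_bool r - of_bool p) (\<lambda>z. line_weight (reflect z) s p q r v)"
    unfolding 2 by (intro form_sixv form_linear form_norm form_const)
qed

text \<open>\<open>k\<close> counts the vertices already passed by the pair, and \<open>f\<close>
  carries the occupation of its other row.\<close>

lemma form_vop_own:
  assumes "\<And>p q r v. binary_form (1 + of_bool r - of_bool p) (\<lambda>z. w z p q r v)"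
    and "\<And>\<sigma>. binary_form (k + of_bool (\<sigma> i) + f \<sigma>) (\<lambda>z. \<Psi> z \<sigma>)"
    and "i \<noteq> j" "\<And>\<sigma> a b. f (\<sigma>(i := a, j := b)) = f \<sigma>"
  shows "binary_form (Suc k + of_bool (\<sigma> i) + f \<sigma>) (\<lambda>z. vop i j (w z) (\<Psi> z) \<sigma>)"
proof -
  have "binary_form (Suc k + of_bool (\<sigma> i) + f \<sigma>) (\<lambda>z. w z a b (\<sigma> i) (\<sigma> j) * \<Psi> z (\<sigma>(i := a, j := b)))" for a b
  proof -
    have "binary_form ((1 + of_bool (\<sigma> i) - of_bool a) + (k + of_bool a + f \<sigma>))
      (\<lambda>z. w z a b (\<sigma> i) (\<sigma> j) * \<Psi> z (\<sigma>(i := a, j := b)))"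
      using form_mult[OF assms(1)[of "\<sigma> i" a b "\<sigma> j"] assms(2)[of "\<sigma>(i := a, j := b)"]] assms(3,4)
      by simp
    moreover have "(1 + of_bool (\<sigma> i) - of_bool a) + (k + of_bool a + f \<sigma>) = Suc k + of_bool (\<sigma> i) + f \<sigma>"
      by (cases a; cases "\<sigma> i") simp_all
    ultimately show ?thesis by (simp only:)
  qed
  then show ?thesis unfolding vop_def UNIV_bool by (simp add: form_add)
qed

lemma form_vop_other:
  assumes "\<And>\<sigma>. binary_form (k + f \<sigma>) (\<lambda>z. \<Psi> z \<sigma>)" "\<And>\<sigma> a b. f (\<sigma>(i := a, j := b)) = f \<sigma>"
  shows "binary_form (k + f \<sigma>) (\<lambda>z. vop i j w (\<Psi> z) \<sigma>)"
proof -
  have "binary_form (k + f \<sigma>) (\<lambda>z. \<Psi> z (\<sigma>(i := a, j := b)))" for a b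
    using assms(1)[of "\<sigma>(i := a, j := b)"] assms(2) by simp
  then show ?thesis unfolding vop_def UNIV_bool by (simp add: form_add form_cmult)
qed

lemma form_column_other:
  assumes "\<And>\<sigma>. binary_form (k + f \<sigma>) (\<lambda>z. \<Psi> z \<sigma>)"
    "\<And>\<sigma> r a b. r \<in> fst ` set rs \<Longrightarrow> f (\<sigma>(r := a, v := b)) = f \<sigma>"
  shows "binary_form (k + f \<sigma>) (\<lambda>z. column v rs (\<Psi> z) \<sigma>)"
  using assms
proof (induction rs arbitrary: \<Psi>)
  case (Cons rw rs)
  obtain r w where rw: "rw = (r, w)" by force
  have "binary_form (k + f \<tau>) (\<lambda>z. vop r v w (\<Psi> z) \<tau>)" for \<tau>
  proof (rule form_vop_other[OF Cons.prems(1)])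
    show "f (\<tau>'(r := a, v := b)) = f \<tau>'" for \<tau>' a b
      by (rule Cons.prems(2)) (simp add: rw)
  qed
  then have "binary_form (k + f \<sigma>) (\<lambda>z. column v rs (vop r v w (\<Psi> z)) \<sigma>)"
  proof (rule Cons.IH)
    show "f (\<tau>'(r' := a, v := b)) = f \<tau>'" if "r' \<in> fst ` set rs" for \<tau>' r' a b
      by (rule Cons.prems(2)) (use that in simp)
  qed
  then show ?case by (simp add: rw)
qed simp

text \<open>The degree of the U-turn is the occupation of its pair, every column adds 2, and at the
  exit both rows are empty, so that no occupation term is left. Counting the turns into a row with
  their degree 2 would give a bound too large for the number of available nodes.\<close>

lemma uturn_Z_form:
  assumes "y \<notin> set ys"
  shows "binary_form (2 * length xs) (\<lambda>p. uturn_Z (P(y := p)) S (y # ys) xs)"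
proof -
  define f where "f \<sigma> = (of_bool (\<sigma> (H y)) + of_bool (\<sigma> (D y)) :: nat)" for \<sigma>
  have r: "pair_rows (P(y := p)) ys s = pair_rows P ys s" for p s
    using assms by (auto simp: pair_rows_def row_weight_def set_row_lines)
  have col: "binary_form (Suc (Suc k) + f \<sigma>) (\<lambda>p. column (V x) (pair_rows (P(y := p)) (y # ys) s) (\<Psi> p) \<sigma>)"
    if "\<And>\<sigma>. binary_form (k + f \<sigma>) (\<lambda>p. \<Psi> p \<sigma>)" for k x s \<Psi> \<sigma>
  proof -
    have "binary_form (Suc k + of_bool (\<sigma> (H y)) + of_bool (\<sigma> (D y)))
        (\<lambda>p. vop (H y) (V x) (line_weight (reflect p) s) (\<Psi> p) \<sigma>)" for \<sigma>
      using that by (intro form_vop_own form_line_weight) (auto simp: f_def add.assoc)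
    then have "binary_form (Suc k + of_bool (\<sigma> (D y)) + of_bool (\<sigma> (H y)))
        (\<lambda>p. vop (H y) (V x) (line_weight (reflect p) s) (\<Psi> p) \<sigma>)" for \<sigma>
      by (simp add: ac_simps)
    then have "binary_form (Suc (Suc k) + of_bool (\<sigma> (D y)) + of_bool (\<sigma> (H y)))
        (\<lambda>p. vop (D y) (V x) (line_weight p s) (vop (H y) (V x) (line_weight (reflect p) s) (\<Psi> p)) \<sigma>)" for \<sigma>
      by (intro form_vop_own form_line_weight) auto
    then have "binary_form (Suc (Suc k) + f \<sigma>)
        (\<lambda>p. vop (D y) (V x) (line_weight p s) (vop (H y) (V x) (line_weight (reflect p) s) (\<Psi> p)) \<sigma>)" for \<sigma>
      by (simp add: f_def ac_simps)
    then have "binary_form (Suc (Suc k) + f \<sigma>) (\<lambda>p. column (V x) (pair_rows P ys s)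
        (vop (D y) (V x) (line_weight p s) (vop (H y) (V x) (line_weight (reflect p) s) (\<Psi> p))) \<sigma>)"
      using assms by (intro form_column_other) (auto simp: f_def fst_rows)
    then show ?thesis by (simp add: r)
  qed
  have gr: "binary_form (k + 2 * length xs + f \<sigma>) (\<lambda>p. grid (P(y := p)) S (y # ys) xs (\<Psi> p) \<sigma>)"
    if "\<And>\<sigma>. binary_form (k + f \<sigma>) (\<lambda>p. \<Psi> p \<sigma>)" for k \<Psi> \<sigma>
    using that
  proof (induction xs arbitrary: k \<Psi>)
    case (Cons x xs)
    have "binary_form (Suc (Suc k) + 2 * length xs + f \<sigma>) (\<lambda>p. grid (P(y := p)) S (y # ys) xs
        (column (V x) (pair_rows (P(y := p)) (y # ys) (S x)) (\<Psi> p)) \<sigma>)"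
      using Cons.prems by (intro Cons.IH col)
    then show ?case by (simp del: fun_upd_apply rows_Cons)
  qed simp
  have "binary_form (0 + f \<sigma>) (\<lambda>p. initial (P(y := p)) (y # ys) xs \<sigma>)" for \<sigma>
  proof -
    have eq: "initial (P(y := p)) ys xs \<sigma> = initial P ys xs \<sigma>" for p
      using assms by (intro initial_eqI) auto
    have "binary_form (f \<sigma>) (\<lambda>p. uturn p (\<sigma> (H y)) (\<sigma> (D y)))"
      using form_linear[of 1 0] form_linear[of 0 1]
      by (auto simp: f_def uturn_def form_zero)
    then show ?thesis
      using form_cmult[of "f \<sigma>" "\<lambda>p. uturn p (\<sigma> (H y)) (\<sigma> (D y))" "initial P ys xs \<sigma>"]
      by (simp add: initial_Cons_row eq mult.commute)
  qed
  from gr[OF this, of final] show ?thesis by (simp add: uturn_Z_def f_def)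
qed

section \<open>Polynomial functions of one variable and interpolation\<close>

definition pdeg :: "nat \<Rightarrow> (real \<Rightarrow> real) \<Rightarrow> bool" where
  "pdeg d f \<longleftrightarrow> (\<exists>p. degree p \<le> d \<and> (\<forall>t. f t = poly p t))"

lemma pdeg_form: "binary_form d f \<Longrightarrow> pdeg d (\<lambda>t. f (1, t))"
  by (simp add: binary_form_def pdeg_def)

lemma pdeg_mult: "pdeg d f \<Longrightarrow> pdeg e g \<Longrightarrow> pdeg (d + e) (\<lambda>t. f t * g t)"
  unfolding pdeg_def
proof (elim exE conjE)
  fix p q assume "degree p \<le> d" "\<forall>t. f t = poly p t" "degree q \<le> e" "\<forall>t. g t = poly q t"
  then show "\<exists>p. degree p \<le> d + e \<and> (\<forall>t. f t * g t = poly p t)"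
    by (intro exI[of _ "p * q"]) (auto intro: order.trans[OF degree_mult_le])
qed

lemma pdeg_const: "pdeg d (\<lambda>_. c)"
  unfolding pdeg_def by (auto intro: exI[of _ "[:c:]"])

lemma pdeg_cmult: "pdeg d f \<Longrightarrow> pdeg d (\<lambda>t. c * f t)"
  using pdeg_mult[OF pdeg_const[of 0 c], of d f] by simp

lemma pdeg_sum: "(\<And>i. i \<in> A \<Longrightarrow> pdeg d (f i)) \<Longrightarrow> pdeg d (\<lambda>t. \<Sum>i\<in>A. f i t)"
proof (induction A rule: infinite_finite_induct)
  case (insert i A)
  then obtain p q where "degree p \<le> d" "\<forall>t. f i t = poly p t" "degree q \<le> d" "\<forall>t. (\<Sum>i\<in>A. f i t) = poly q t"
    unfolding pdeg_def by (metis insertI1 insertI2)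
  with insert show ?case unfolding pdeg_def
    by (intro exI[of _ "p + q"]) (simp add: degree_add_le)
qed (simp_all add: pdeg_const)

lemma pdeg_prod_list: "(\<And>i. i \<in> set is \<Longrightarrow> pdeg d (f i)) \<Longrightarrow> pdeg (d * length is) (\<lambda>t. \<Prod>i\<leftarrow>is. f i t)"
proof (induction "is")
  case (Cons i "is")
  then show ?case using pdeg_mult[of d "f i" "d * length is" "\<lambda>t. \<Prod>i\<leftarrow>is. f i t"] by simp
qed (simp add: pdeg_const)

lemma pdeg_eqI:
  assumes "pdeg d f" "pdeg d g" "finite A" "card A > d" "\<And>t. t \<in> A \<Longrightarrow> f t = g t"
  shows "f t = g t"
proof -
  obtain p q where pq: "degree p \<le> d" "\<forall>t. f t = poly p t" "degree q \<le> d" "\<forall>t. g t = poly q t"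
    using assms unfolding pdeg_def by blast
  have "p - q = 0"
  proof (rule ccontr)
    assume nz: "p - q \<noteq> 0"
    have "A \<subseteq> {x. poly (p - q) x = 0}" using assms(5) pq by auto
    then have "card A \<le> card {x. poly (p - q) x = 0}"
      using poly_roots_finite[OF nz] by (rule card_mono[rotated])
    also have "\<dots> \<le> degree (p - q)" by (rule card_poly_roots_bound[OF nz])
    also have "\<dots> \<le> d" using pq by (intro degree_diff_le)
    finally show False using assms(4) by simp
  qed
  then show ?thesis using pq by simp
qed

section \<open>The inhomogeneous determinant\<close>

text \<open>The denominator of \<open>g_20V\<close>. For \<open>v = s\<^sup>2\<close> with
  \<open>0 < s < 1\<close> its zeros in \<open>u\<close> are \<open>(1 + s) / (1 - s)\<close>,
  \<open>1 / s\<close>, and the same expressions with \<open>- s\<close> in place of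
  \<open>s\<close>.\<close>

definition qpole :: "real \<Rightarrow> real \<Rightarrow> real" where
  "qpole u v = (1 - u\<^sup>2 * v) * ((1 - u)\<^sup>2 - v * (1 + u)\<^sup>2)"

text \<open>The second factor vanishes when \<open>a\<close> is the mirror image
  \<open>(1 + b) / (b - 1)\<close> of \<open>b\<close>: pairs with mirrored parameters count as
  coinciding.\<close>

definition row_diff :: "real \<Rightarrow> real \<Rightarrow> real" where
  "row_diff a b = (a - b) * (a * b - a - b - 1)"

fun pair_prod :: "('a \<Rightarrow> 'a \<Rightarrow> real) \<Rightarrow> 'a list \<Rightarrow> real" where
  "pair_prod f [] = 1"
| "pair_prod f (x # xs) = (\<Prod>z\<leftarrow>xs. f x z) * pair_prod f xs"

abbreviation row_disc :: "(nat \<Rightarrow> real) \<Rightarrow> nat list \<Rightarrow> real" where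
  "row_disc u \<equiv> pair_prod (\<lambda>y z. row_diff (u y) (u z))"

abbreviation col_disc :: "(nat \<Rightarrow> real) \<Rightarrow> nat list \<Rightarrow> real" where
  "col_disc S \<equiv> pair_prod (\<lambda>x z. (S x)\<^sup>2 - (S z)\<^sup>2)"

definition drop_nth :: "nat \<Rightarrow> 'a list \<Rightarrow> 'a list" where
  "drop_nth j xs = take j xs @ drop (Suc j) xs"

definition pole_mat :: "(nat \<Rightarrow> real) \<Rightarrow> (nat \<Rightarrow> real) \<Rightarrow> nat list \<Rightarrow> nat list \<Rightarrow> real mat" where
  "pole_mat u S ys xs = mat (length ys) (length xs) (\<lambda>(i, j). 1 / qpole (u (ys ! i)) ((S (xs ! j))\<^sup>2))"

text \<open>Genericity that survives shrinking all parameters to 0. It makes \<open>qpole\<close>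
  positive and keeps the interpolation nodes apart; the bound is merely convenient, since only the
  limit at 0 is taken later.\<close>

definition small :: "(nat \<Rightarrow> real) \<Rightarrow> nat list \<Rightarrow> bool" where
  "small f zs \<longleftrightarrow> distinct zs \<and> inj_on f (set zs) \<and> (\<forall>z\<in>set zs. 0 < f z \<and> f z < 1 / 10)"

lemma small_Cons: "small f (z # zs) \<Longrightarrow> small f zs"
  by (auto simp: small_def inj_on_def)

lemma set_del_subset: "set (drop_nth j xs) \<subseteq> set xs"
  unfolding drop_nth_def using set_take_subset[of j xs] set_drop_subset[of "Suc j" xs] by auto

lemma distinct_del: "distinct xs \<Longrightarrow> distinct (drop_nth j xs)"
  unfolding drop_nth_def using set_take_disj_set_drop_if_distinct[of xs j "Suc j"] by auto

lemma small_del: "small f xs \<Longrightarrow> small f (drop_nth j xs)"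
  unfolding small_def using set_del_subset[of j xs] distinct_del[of xs j]
  by (auto intro: inj_on_subset)

lemma length_del: "j < length xs \<Longrightarrow> length (drop_nth j xs) = length xs - 1"
  by (simp add: drop_nth_def)

lemma del_split: "j < length xs \<Longrightarrow> xs = take j xs @ xs ! j # drop (Suc j) xs"
  by (rule id_take_nth_drop)

lemma prod_list_del:
  fixes f :: "'b \<Rightarrow> 'a :: comm_monoid_mult"
  assumes "j < length xs"
  shows "prod_list (map f xs) = f (xs ! j) * prod_list (map f (drop_nth j xs))"
  by (subst del_split[OF assms]) (simp add: drop_nth_def mult.left_commute)

lemma nth_mem_del: "distinct xs \<Longrightarrow> j < length xs \<Longrightarrow> k < length xs \<Longrightarrow> j \<noteq> k \<Longrightarrow> xs ! j \<in> set (drop_nth k xs)"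
proof -
  assume *: "distinct xs" "j < length xs" "k < length xs" "j \<noteq> k"
  have "set xs = insert (xs ! k) (set (drop_nth k xs))"
    using arg_cong[OF del_split[OF *(3)], of set] by (simp add: drop_nth_def)
  moreover have "xs ! j \<noteq> xs ! k" using * by (simp add: nth_eq_iff_index_eq)
  ultimately show ?thesis using nth_mem[OF *(2)] by auto
qed

lemma prod_list_mult_map:
  fixes f g :: "'b \<Rightarrow> 'a :: comm_monoid_mult"
  shows "prod_list (map (\<lambda>x. f x * g x) xs) = prod_list (map f xs) * prod_list (map g xs)"
  by (induction xs) (auto simp: algebra_simps)

lemma prod_list_const_mult:
  fixes f :: "'b \<Rightarrow> 'a :: comm_monoid_mult"
  shows "prod_list (map (\<lambda>x. c * f x) xs) = c ^ length xs * prod_list (map f xs)"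
  by (induction xs) (auto simp: algebra_simps)

text \<open>The sign is that of the cofactor of the column \<open>x\<close> in an expansion along
  the first row, and the two signs meet in \<open>uz_det\<close>.\<close>

lemma col_disc_move:
  "col_disc S (xs1 @ x # xs2) =
    (- 1) ^ length xs1 * (\<Prod>z\<leftarrow>xs1 @ xs2. (S x)\<^sup>2 - (S z)\<^sup>2) * col_disc S (xs1 @ xs2)"
  by (induction xs1) (simp_all add: algebra_simps)

lemma qpole_pos:
  assumes "0 < u" "u < 1 / 10" "0 < s" "s < 1 / 10"
  shows "qpole u (s\<^sup>2) > 0"
proof -
  have "u * s < 1 * 1" using assms by (intro mult_strict_mono) auto
  then have "(u * s)\<^sup>2 < 1" using assms by (simp add: power_less_one_iff abs_square_less_1)
  moreover have "s * (1 + u) < 1 - u"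
  proof -
    have "s * (1 + u) \<le> 1 / 10 * 2" using assms by (intro mult_mono) auto
    then show ?thesis using assms by simp
  qed
  then have "(s * (1 + u))\<^sup>2 < (1 - u)\<^sup>2"
    using assms by (intro power_strict_mono) auto
  ultimately show ?thesis unfolding qpole_def by (simp add: power_mult_distrib)
qed

section \<open>Expansion of the determinant along the row of one pair\<close>

lemma mat_delete_pole_mat:
  assumes "length xs = Suc (length ys)" "j < length xs"
  shows "mat_delete (pole_mat u S (y # ys) xs) 0 j = pole_mat u S ys (drop_nth j xs)"
  using assms
  by (intro eq_matI) (auto simp: mat_delete_def pole_mat_def length_del drop_nth_def nth_append min_def)

lemma det_pole_mat_Cons:
  assumes "length xs = Suc (length ys)"
  shows "det (pole_mat u S (y # ys) xs) =
    (\<Sum>j<length xs. 1 / qpole (u y) ((S (xs ! j))\<^sup>2) * ((- 1) ^ j * det (pole_mat u S ys (drop_nth j xs))))"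
proof -
  have "pole_mat u S (y # ys) xs \<in> carrier_mat (length xs) (length xs)"
    using assms by (simp add: pole_mat_def)
  from laplace_expansion_row[OF this, of 0] have "det (pole_mat u S (y # ys) xs) =
      (\<Sum>j<length xs. pole_mat u S (y # ys) xs $$ (0, j) * cofactor (pole_mat u S (y # ys) xs) 0 j)"
    using assms by simp
  also have "\<dots> = (\<Sum>j<length xs. 1 / qpole (u y) ((S (xs ! j))\<^sup>2) * ((- 1) ^ j * det (pole_mat u S ys (drop_nth j xs))))"
    using assms by (intro sum.cong) (auto simp: cofactor_def mat_delete_pole_mat, simp add: pole_mat_def)
  finally show ?thesis .
qed

text \<open>The determinant with a first row of parameter \<open>t\<close>, cleared of the
  denominators of that row. Unlike the determinant it also makes sense at the poles, which are among
  the interpolation nodes.\<close>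

definition minor_sum :: "(nat \<Rightarrow> real) \<Rightarrow> (nat \<Rightarrow> real) \<Rightarrow> nat list \<Rightarrow> nat list \<Rightarrow> real \<Rightarrow> real" where
  "minor_sum u S ys xs t = (\<Sum>j<length xs. (\<Prod>x\<leftarrow>drop_nth j xs. qpole t ((S x)\<^sup>2)) *
      ((- 1) ^ j * det (pole_mat u S ys (drop_nth j xs))))"

lemma pole_mat_cong: "(\<And>y. y \<in> set ys \<Longrightarrow> u y = u' y) \<Longrightarrow> pole_mat u S ys xs = pole_mat u' S ys xs"
  by (auto simp: pole_mat_def intro!: cong_mat)

lemma minor_sum_det:
  assumes "length xs = Suc (length ys)" "y \<notin> set ys" "\<And>x. x \<in> set xs \<Longrightarrow> qpole t ((S x)\<^sup>2) \<noteq> 0"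
  shows "minor_sum u S ys xs t = (\<Prod>x\<leftarrow>xs. qpole t ((S x)\<^sup>2)) * det (pole_mat (u(y := t)) S (y # ys) xs)"
proof -
  have c: "pole_mat (u(y := t)) S ys zs = pole_mat u S ys zs" for zs
    using assms(2) by (intro pole_mat_cong) auto
  show ?thesis
    unfolding det_pole_mat_Cons[OF assms(1)] minor_sum_def c sum_distrib_left
  proof (intro sum.cong refl)
    fix j assume j: "j \<in> {..<length xs}"
    then show "(\<Prod>x\<leftarrow>drop_nth j xs. qpole t ((S x)\<^sup>2)) * ((- 1) ^ j * det (pole_mat u S ys (drop_nth j xs))) =
      (\<Prod>x\<leftarrow>xs. qpole t ((S x)\<^sup>2)) * (1 / qpole ((u(y := t)) y) ((S (xs ! j))\<^sup>2) *
        ((- 1) ^ j * det (pole_mat u S ys (drop_nth j xs))))"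
      using assms(3)[of "xs ! j"] by (simp add: prod_list_del[of j xs])
  qed
qed

lemma minor_sum_row_zero:
  assumes "length xs = Suc (length ys)" "z \<in> set ys" "\<And>x. x \<in> set xs \<Longrightarrow> qpole (u z) ((S x)\<^sup>2) \<noteq> 0"
  shows "minor_sum u S ys xs (u z) = 0"
proof -
  \<comment> \<open>A fresh name for the first row: \<open>minor_sum_det\<close> sets the parameter
    of a pair outside \<open>ys\<close>, and with the parameter of \<open>z\<close> two rows
    agree.\<close>
  obtain y where y: "y \<notin> set ys" using ex_new_if_finite[of "set ys"] by auto
  define A where "A = pole_mat (u(y := u z)) S (y # ys) xs"
  obtain i where i: "i < length ys" "ys ! i = z" using assms(2) by (auto simp: in_set_conv_nth)
  have A: "A \<in> carrier_mat (length xs) (length xs)" using assms(1) by (simp add: A_def pole_mat_def)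
  have "z \<noteq> y" using assms(2) y by auto
  then have "row A 0 = row A (Suc i)"
    using i assms(1) by (intro eq_vecI) (auto simp: A_def pole_mat_def)
  then have "det A = 0"
    using i assms(1) by (intro det_identical_rows[OF A, of 0 "Suc i"]) auto
  then show ?thesis using minor_sum_det[OF assms(1) y assms(3)] by (simp add: A_def)
qed

text \<open>Every term that does not omit column \<open>j\<close> still contains the vanishing
  factor.\<close>

lemma minor_sum_node:
  assumes "distinct xs" "j < length xs" "qpole t ((S (xs ! j))\<^sup>2) = 0"
  shows "minor_sum u S ys xs t = (\<Prod>x\<leftarrow>drop_nth j xs. qpole t ((S x)\<^sup>2)) * ((- 1) ^ j * det (pole_mat u S ys (drop_nth j xs)))"
proof -
  have "(\<Prod>x\<leftarrow>drop_nth k xs. qpole t ((S x)\<^sup>2)) = 0" if "k < length xs" "k \<noteq> j" for k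
    using nth_mem_del[OF assms(1,2) that(1)] that assms(3) by (force simp: prod_list_zero_iff)
  then have "minor_sum u S ys xs t = (\<Sum>k<length xs. if k = j then
      (\<Prod>x\<leftarrow>drop_nth j xs. qpole t ((S x)\<^sup>2)) * ((- 1) ^ j * det (pole_mat u S ys (drop_nth j xs))) else 0)"
    unfolding minor_sum_def by (intro sum.cong) auto
  then show ?thesis using assms(2) by simp
qed

text \<open>The involution \<open>t \<mapsto> (1 + t) / (t - 1)\<close> is the reflection of the direction \<open>(1, t)\<close>;
  \<open>c\<close> is the scaling factor of the reflected vector.\<close>

context
  fixes t c t' :: real
  assumes t: "t \<noteq> 1" and c: "c = (1 - t) / sqrt 2" and t': "t' = (1 + t) / (t - 1)"
begin

lemma reflect_direction: "reflect (1, t) = (c * 1, c * t')" "c \<noteq> 0" "c\<^sup>2 = (1 - t)\<^sup>2 / 2"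
  using t unfolding reflect_def c t' by (auto simp: field_simps power_divide)

lemma row_diff_reflect: "c\<^sup>2 * row_diff t' b = row_diff t b"
  using t unfolding reflect_direction(3) t' row_diff_def
  by (simp add: divide_simps power2_eq_square) (simp add: algebra_simps)

lemma qpole_reflect: "c ^ 4 * qpole t' v = qpole t v"
proof -
  have "c ^ 4 = (c\<^sup>2)\<^sup>2" by simp
  also have "\<dots> = (1 - t) * (1 - t) * ((1 - t) * (1 - t)) / 4"
    unfolding reflect_direction(3) by (simp add: power2_eq_square)
  finally have c4: "c ^ 4 = (1 - t) * (1 - t) * ((1 - t) * (1 - t)) / 4" .
  show ?thesis using t unfolding c4 t' qpole_def
    by (simp add: divide_simps power2_eq_square) (simp add: algebra_simps)
qed

text \<open>This explains the factor \<open>1 - u\<^sup>2\<close> of the determinant formula: under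
  the reflection it picks up the same ratio \<open>- 2 * t\<close> to \<open>1 - t\<^sup>2\<close>
  as the U-turn, while \<open>qpole\<close> and \<open>row_diff\<close> only pick up powers of
  \<open>c\<close>.\<close>

lemma factor_reflect: "c\<^sup>2 * (1 - t'\<^sup>2) = - 2 * t"
  using t unfolding reflect_direction(3) t'
  by (simp add: divide_simps power2_eq_square) (simp add: algebra_simps)

lemma minor_sum_reflect:
  "c ^ (4 * (length xs - 1)) * minor_sum u S ys xs t' = minor_sum u S ys xs t"
  unfolding minor_sum_def sum_distrib_left
proof (intro sum.cong refl)
  fix j assume j: "j \<in> {..<length xs}"
  have "(\<Prod>x\<leftarrow>drop_nth j xs. qpole t ((S x)\<^sup>2)) = (c ^ 4) ^ length (drop_nth j xs) * (\<Prod>x\<leftarrow>drop_nth j xs. qpole t' ((S x)\<^sup>2))"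
    unfolding qpole_reflect[symmetric] by (rule prod_list_const_mult)
  also have "(c ^ 4) ^ length (drop_nth j xs) = c ^ (4 * (length xs - 1))"
    using j by (simp add: length_del power_mult)
  finally show "c ^ (4 * (length xs - 1)) * ((\<Prod>x\<leftarrow>drop_nth j xs. qpole t' ((S x)\<^sup>2)) *
       ((- 1) ^ j * det (pole_mat u S ys (drop_nth j xs)))) =
       (\<Prod>x\<leftarrow>drop_nth j xs. qpole t ((S x)\<^sup>2)) * ((- 1) ^ j * det (pole_mat u S ys (drop_nth j xs)))"
    by simp
qed

end

section \<open>The partition function as a function of one slope\<close>

definition uz :: "(nat \<Rightarrow> real) \<Rightarrow> (nat \<Rightarrow> real) \<Rightarrow> nat list \<Rightarrow> nat list \<Rightarrow> real" where
  "uz u S ys xs = uturn_Z (\<lambda>y. (1, u y)) S ys xs"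

lemma uturn_Z_cong:
  assumes "\<And>y. y \<in> set ys \<Longrightarrow> P y = P' y"
  shows "uturn_Z P S ys xs = uturn_Z P' S ys xs"
proof -
  have "pair_rows P ys s = pair_rows P' ys s" for s
    using assms by (auto simp: pair_rows_def row_weight_def set_row_lines)
  then have "grid P S ys xs = grid P' S ys xs" by (simp add: grid_def)
  moreover have "initial P ys xs = initial P' ys xs"
    using assms by (auto simp: fun_eq_iff intro!: initial_eqI)
  ultimately show ?thesis by (simp add: uturn_Z_def)
qed

lemma uz_upd: "uz (u(y := t)) S ys xs = uturn_Z ((\<lambda>y. (1, u y))(y := (1, t))) S ys xs"
  unfolding uz_def by (rule uturn_Z_cong) auto

text \<open>The symmetry in the columns moves column \<open>j\<close> to the end, where its vertex
  with the top row can freeze.\<close>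

lemma uz_node:
  assumes "y \<notin> set ys" "distinct ys" "small S xs" "j < length xs" "s = S (xs ! j)"
    and t: "t = (1 + s) / (1 - s)"
  shows "uz (u(y := t)) S (y # ys) xs = (1 + s\<^sup>2) * (1 - t * s - s - t)
    * (\<Prod>z\<leftarrow>ys. sqrt 2 * (1 + u z * s) * (1 - u z * s - s - u z))
    * (\<Prod>x\<leftarrow>drop_nth j xs. 2 * (1 + t * S x) * (1 - t * S x)) * uz u S ys (drop_nth j xs)"
proof -
  define P where "P = (\<lambda>y. (1 :: real, u y))(y := (1, t))"
  have s: "0 < s" "s < 1 / 10" using assms(3-5) by (auto simp: small_def)
  have d: "distinct xs" using assms(3) by (simp add: small_def)
  have nz: "S x - S x' + (1 + S x * S x') \<noteq> 0" if "x \<in> set xs" "x' \<in> set xs" for x x'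
  proof -
    have "0 < S x" "0 < S x'" "S x' < 1 / 10" using that assms(3) by (auto simp: small_def)
    moreover from this have "0 < S x * S x'" by simp
    ultimately show ?thesis by linarith
  qed
  have "uz (u(y := t)) S (y # ys) xs = uturn_Z P S (y # ys) (take j xs @ xs ! j # drop (Suc j) xs)"
    unfolding uz_upd P_def del_split[OF assms(4), symmetric] ..
  also have "\<dots> = uturn_Z P S (y # ys) (take j xs @ drop (Suc j) xs @ [xs ! j])"
    using assms d del_split[OF assms(4)] nz
    by (intro uturn_Z_column_last) (auto dest: in_set_dropD)
  also have "\<dots> = uturn_Z P S (y # ys) (drop_nth j xs @ [xs ! j])" by (simp add: drop_nth_def)
  also have "\<dots> = (1 + s\<^sup>2) * (1 - t * s - s - t)
    * (\<Prod>z\<leftarrow>ys. pass_v (P z) s)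
    * (\<Prod>x\<leftarrow>drop_nth j xs. 2 * (1 + t * S x) * (1 - t * S x)) * uturn_Z P S ys (drop_nth j xs)"
    unfolding assms(5)
  proof (rule uturn_Z_frozen)
    have "distinct (take j xs @ xs ! j # drop (Suc j) xs)"
      using d unfolding del_split[OF assms(4), symmetric] .
    then show "distinct (drop_nth j xs @ [xs ! j])" unfolding drop_nth_def by auto
    show "1 - t + (1 + t) * S (xs ! j) = 0"
      unfolding assms(5)[symmetric] t using s by (simp add: field_simps)
  qed (use assms(1,2) in \<open>auto simp: P_def\<close>)
  also have "map (\<lambda>z. pass_v (P z) s) ys
      = map (\<lambda>z. sqrt 2 * (1 + u z * s) * (1 - u z * s - s - u z)) ys"
    using assms(1) by (intro map_cong) (auto simp: P_def pass_v_def line_weight_reflect line_weight_def[of "(1, _)"] sixv_def)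
  also have "uturn_Z P S ys (drop_nth j xs) = uz u S ys (drop_nth j xs)"
    unfolding uz_def P_def using assms(1) by (intro uturn_Z_cong) auto
  finally show ?thesis .
qed

text \<open>Since \<open>reflect (1, t)\<close> is \<open>c\<close> times \<open>(1, t')\<close>,
  homogeneity turns the reflection of vectors into the involution of slopes at the price of a power
  of \<open>c\<close>.\<close>

lemma uz_reflect:
  assumes "y \<notin> set ys" "distinct ys" "t \<noteq> 1" "c = (1 - t) / sqrt 2" "t' = (1 + t) / (t - 1)"
  shows "(1 - t\<^sup>2) * (c ^ (2 * length xs) * uz (u(y := t')) S (y # ys) xs) =
    - 2 * t * uz (u(y := t)) S (y # ys) xs"
proof -
  define P where "P = (\<lambda>y. (1 :: real, u y))"
  have "binary_form (2 * length xs) (\<lambda>p. uturn_Z (P(y := p)) S (y # ys) xs)"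
    by (rule uturn_Z_form[OF assms(1)])
  then have "uturn_Z (P(y := (c * 1, c * t'))) S (y # ys) xs =
      c ^ (2 * length xs) * uturn_Z (P(y := (1, t'))) S (y # ys) xs"
    unfolding binary_form_def by blast
  moreover have "((1::real)\<^sup>2 - t\<^sup>2) * uturn_Z ((P(y := (1, t)))(y := reflect (1, t))) S ([] @ y # ys) xs =
      - 2 * 1 * t * uturn_Z (P(y := (1, t))) S ([] @ y # ys) xs"
    using assms by (intro uturn_Z_reflect) auto
  ultimately show ?thesis
    unfolding reflect_direction(1)[OF assms(3-5)] uz_upd P_def by simp
qed

text \<open>At \<open>(1, 1)\<close> the left coefficient in \<open>uturn_Z_reflect\<close> is 0 and
  the right one is -2. This node is the one whose mirror image lies at infinity.\<close>

lemma uz_at_1: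
  assumes "y \<notin> set ys" "distinct ys"
  shows "uz (u(y := 1)) S (y # ys) xs = 0"
proof -
  define P where "P = (\<lambda>y. (1 :: real, u y))(y := (1, 1))"
  have "((1::real)\<^sup>2 - 1\<^sup>2) * uturn_Z (P(y := reflect (1, 1))) S ([] @ y # ys) xs =
      - 2 * 1 * 1 * uturn_Z P S ([] @ y # ys) xs"
    using assms by (intro uturn_Z_reflect) (auto simp: P_def)
  then show ?thesis by (simp add: uz_upd P_def)
qed

text \<open>Together with \<open>node_column_factor\<close> this compares a frozen corner with the
  determinant. As many rows as columns remain, so the powers of \<open>1 - s\<close> cancel and each
  remaining row contributes \<open>- sqrt 2\<close>, the origin of the power of
  \<open>- sqrt 2\<close> in \<open>uz_det\<close>.\<close>

lemma node_row_factor: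
  assumes "0 < s" "s < 1 / 10" "t = (1 + s) / (1 - s)"
  shows "sqrt 2 * (1 + u * s) * (1 - u * s - s - u) * row_diff t u =
    - (2 * sqrt 2) / (1 - s)\<^sup>2 * qpole u (s\<^sup>2)"
  using assms(1,2) unfolding assms(3) row_diff_def qpole_def
  by (simp add: divide_simps power2_eq_square) (simp add: algebra_simps)

lemma node_column_factor:
  assumes "0 < s" "s < 1 / 10" "t = (1 + s) / (1 - s)"
  shows "2 * (1 + t * s') * (1 - t * s') * (s\<^sup>2 - s'\<^sup>2) = (1 - s)\<^sup>2 / 2 * qpole t (s'\<^sup>2)"
  using assms(1,2) unfolding assms(3) qpole_def
  by (simp add: divide_simps power2_eq_square) (simp add: algebra_simps)

lemma node_single_factor:
  assumes "0 < s" "s < 1 / 10" "t = (1 + s) / (1 - s)"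
  shows "1 - t * s - s - t = (1 - s) * (1 - t\<^sup>2)" "qpole t (s\<^sup>2) = 0"
  using assms(1,2) unfolding assms(3) qpole_def
  by (simp_all add: divide_simps power2_eq_square) (simp_all add: algebra_simps)

lemma card_nodes:
  assumes u: "small u ys" and S: "small S xs"
  defines "A \<equiv> insert 1 (u ` set ys \<union> (\<lambda>y. (1 + u y) / (u y - 1)) ` set ys
    \<union> (\<lambda>x. (1 + S x) / (1 - S x)) ` set xs \<union> (\<lambda>x. 1 / S x) ` set xs)"
  shows "finite A" "card A = 1 + 2 * length ys + 2 * length xs"
proof -
  define f1 f2 g1 g2 where fg: "f1 = (\<lambda>y. (1 + u y) / (u y - 1))" "f2 = u" "g1 = (\<lambda>x. (1 + S x) / (1 - S x))" "g2 = (\<lambda>x. 1 / S x)"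
  have b1: "f1 y < 0" "0 < f2 y" "f2 y < 1 / 10" if "y \<in> set ys" for y
    using that u by (auto simp: small_def fg field_simps)
  have b2: "1 < g1 x" "g1 x < 5" "10 < g2 x" if "x \<in> set xs" for x
    using that S by (auto simp: small_def fg field_simps)
  have "inj_on f1 (set ys)"
  proof (rule inj_onI)
    fix y z assume yz: "y \<in> set ys" "z \<in> set ys" "f1 y = f1 z"
    then have "u y \<noteq> 1" "u z \<noteq> 1" using u by (auto simp: small_def)
    then have "u y = u z" using yz(3) by (simp add: fg divide_simps) (simp add: algebra_simps)
    then show "y = z" using u yz by (auto simp: small_def inj_on_def)
  qed
  moreover have "inj_on g1 (set xs)"
  proof (rule inj_onI)
    fix y z assume yz: "y \<in> set xs" "z \<in> set xs" "g1 y = g1 z"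
    then have "S y \<noteq> 1" "S z \<noteq> 1" using S by (auto simp: small_def)
    then have "S y = S z" using yz(3) by (simp add: fg divide_simps) (simp add: algebra_simps)
    then show "y = z" using S yz by (auto simp: small_def inj_on_def)
  qed
  moreover have "inj_on g2 (set xs)" "inj_on f2 (set ys)"
    using S u by (auto simp: small_def inj_on_def fg)
  ultimately have c: "card (f1 ` set ys) = length ys" "card (f2 ` set ys) = length ys"
     "card (g1 ` set xs) = length xs" "card (g2 ` set xs) = length xs"
    using u S by (simp_all add: card_image small_def distinct_card)
  have d: "f2 ` set ys \<inter> f1 ` set ys = {}" "(f2 ` set ys \<union> f1 ` set ys) \<inter> g1 ` set xs = {}"
    "(f2 ` set ys \<union> f1 ` set ys \<union> g1 ` set xs) \<inter> g2 ` set xs = {}"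
    "1 \<notin> f2 ` set ys \<union> f1 ` set ys \<union> g1 ` set xs \<union> g2 ` set xs"
    using b1 b2 by force+
  have A: "A = insert 1 (f2 ` set ys \<union> f1 ` set ys \<union> g1 ` set xs \<union> g2 ` set xs)"
    by (simp add: A_def fg)
  show "finite A" by (simp add: A)
  show "card A = 1 + 2 * length ys + 2 * length xs"
    unfolding A using d c by (simp add: card_Un_disjoint)
qed

theorem uz_det:
  assumes "length ys = length xs" "small u ys" "small S xs"
  shows "uz u S ys xs * row_disc u ys * col_disc S xs = (- sqrt 2) ^ (\<Sum>i<length xs. i)
    * (\<Prod>y\<leftarrow>ys. 1 - (u y)\<^sup>2) * (\<Prod>x\<leftarrow>xs. (1 + (S x)\<^sup>2) * (1 - S x))
    * (\<Prod>y\<leftarrow>ys. \<Prod>x\<leftarrow>xs. qpole (u y) ((S x)\<^sup>2)) * det (pole_mat u S ys xs)"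
  using assms
proof (induction ys arbitrary: xs)
  case Nil
  then show ?case by (simp add: uz_def uturn_Z_def initial_def pole_mat_def)
next
  case (Cons y ys)
  define n where "n = length ys"
  have lx: "length xs = Suc n" using Cons.prems by (simp add: n_def)
  have lx': "length xs = Suc (length ys)" using Cons.prems by simp
  have y: "y \<notin> set ys" "distinct ys" "distinct xs" using Cons.prems by (auto simp: small_def)
  have sy: "small u ys" by (rule small_Cons[OF Cons.prems(2)])
  have S: "0 < S x" "S x < 1 / 10" if "x \<in> set xs" for x using that Cons.prems(3) by (auto simp: small_def)
  have U: "0 < u z" "u z < 1 / 10" if "z \<in> set (y # ys)" for z using that Cons.prems(2) by (auto simp: small_def)
  have qn: "qpole (u z) ((S x)\<^sup>2) \<noteq> 0" if "z \<in> set (y # ys)" "x \<in> set xs" for z x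
    using qpole_pos[of "u z" "S x"] U[OF that(1)] S[OF that(2)] by simp
  define K0 where "K0 = row_disc u ys * col_disc S xs"
  define K1 where "K1 = (- sqrt 2) ^ (\<Sum>i<length xs. i) * (\<Prod>y\<leftarrow>ys. 1 - (u y)\<^sup>2)
     * (\<Prod>x\<leftarrow>xs. (1 + (S x)\<^sup>2) * (1 - S x)) * (\<Prod>y\<leftarrow>ys. \<Prod>x\<leftarrow>xs. qpole (u y) ((S x)\<^sup>2))"
  \<comment> \<open>The factors \<open>row_diff\<close> lift the degree from
    \<open>2 * (n + 1)\<close> to \<open>4 * n + 2\<close>, the degree of the determinant
    side.\<close>
  define L where "L t = K0 * (uz (u(y := t)) S (y # ys) xs * (\<Prod>z\<leftarrow>ys. row_diff t (u z)))" for t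
  define R where "R t = K1 * ((1 - t\<^sup>2) * minor_sum u S ys xs t)" for t
  have "pdeg (2 * length xs + 2 * length ys) L"
    unfolding L_def uz_upd
  proof (intro pdeg_cmult pdeg_mult pdeg_form[where f = "\<lambda>p. uturn_Z (_(y := p)) S (y # ys) xs"] uturn_Z_form y pdeg_prod_list)
    show "pdeg 2 (\<lambda>t. row_diff t b)" for b
      unfolding pdeg_def row_diff_def
      by (intro exI[of _ "[:- b, 1:] * [:- b - 1, b - 1:]"]) (auto simp: algebra_simps)
  qed
  then have degL: "pdeg (4 * n + 2) L" using lx by (simp add: n_def)
  have "pdeg (2 + 4 * n) R"
    unfolding R_def minor_sum_def
  proof (intro pdeg_cmult pdeg_mult pdeg_sum)
    show "pdeg 2 (\<lambda>t. 1 - t\<^sup>2)"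
      unfolding pdeg_def by (intro exI[of _ "[:1, 0, - 1:]"]) (auto simp: power2_eq_square)
    fix j assume j: "j \<in> {..<length xs}"
    have "pdeg 4 (\<lambda>t. qpole t v)" for v
      unfolding pdeg_def qpole_def
      by (intro exI[of _ "[:1, 0, - v:] * [:1 - v, - 2 - 2 * v, 1 - v:]"])
        (auto simp: power2_eq_square algebra_simps)
    then have "pdeg (4 * length (drop_nth j xs)) (\<lambda>t. \<Prod>x\<leftarrow>drop_nth j xs. qpole t ((S x)\<^sup>2))"
      by (intro pdeg_prod_list)
    then have "pdeg (4 * n) (\<lambda>t. (((- 1) ^ j * det (pole_mat u S ys (drop_nth j xs)))) * (\<Prod>x\<leftarrow>drop_nth j xs. qpole t ((S x)\<^sup>2)))"
      using j lx by (intro pdeg_cmult) (simp add: length_del)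
    then show "pdeg (4 * n) (\<lambda>t. (\<Prod>x\<leftarrow>drop_nth j xs. qpole t ((S x)\<^sup>2)) * ((- 1) ^ j * det (pole_mat u S ys (drop_nth j xs))))"
      by (simp only: mult.commute)
  qed
  then have degR: "pdeg (4 * n + 2) R" by (simp add: add.commute)
  \<comment> \<open>Both sides are quasi-invariant with the same factor, as
    \<open>2 * (n + 1) + 2 * n = 2 + 4 * n\<close> balances the powers of \<open>c\<close>; so every
    node yields its mirror image as another node.\<close>
  have mirror: "L t' = R t'" if "L t = R t" "t \<noteq> 1" "t \<noteq> - 1" "t' = (1 + t) / (t - 1)" for t t'
  proof -
    define c where "c = (1 - t) / sqrt 2"
    note rd = reflect_direction[OF that(2) c_def that(4)]
    have nz: "1 - t\<^sup>2 \<noteq> 0" using that(2,3) by (simp add: power2_eq_1_iff)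
    have r: "(\<Prod>z\<leftarrow>ys. row_diff t (u z)) = (c\<^sup>2) ^ n * (\<Prod>z\<leftarrow>ys. row_diff t' (u z))"
      unfolding row_diff_reflect[OF that(2) c_def that(4), symmetric] n_def by (rule prod_list_const_mult)
    have "(1 - t\<^sup>2) * (c ^ (2 * length xs) * (c\<^sup>2) ^ n) * L t' =
      K0 * ((1 - t\<^sup>2) * (c ^ (2 * length xs) * uz (u(y := t')) S (y # ys) xs)) * ((c\<^sup>2) ^ n * (\<Prod>z\<leftarrow>ys. row_diff t' (u z)))"
      by (simp add: L_def)
    also have "\<dots> = - 2 * t * L t"
      unfolding uz_reflect[OF y(1,2) that(2) c_def that(4)] r[symmetric] by (simp add: L_def)
    also have "\<dots> = - 2 * t * R t" using that(1) by simp
    also have "\<dots> = (1 - t\<^sup>2) * (c ^ (2 * length xs) * (c\<^sup>2) ^ n) * R t'"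
    proof -
      have m: "minor_sum u S ys xs t = c ^ (4 * n) * minor_sum u S ys xs t'"
        using minor_sum_reflect[OF that(2) c_def that(4), of xs u S ys] lx by simp
      have p: "c ^ (2 * length xs) * (c\<^sup>2) ^ n = c\<^sup>2 * c ^ (4 * n)"
        by (simp add: lx power_mult[symmetric] power_add[symmetric])
      show ?thesis
        unfolding p R_def m factor_reflect[OF that(2) c_def that(4), symmetric] by (simp only: mult_ac)
    qed
    finally show ?thesis using nz rd(2) by simp
  qed
  \<comment> \<open>Both sides vanish: one through \<open>row_diff\<close>, the other through two
    equal rows.\<close>
  have root: "L (u z) = R (u z)" if "z \<in> set ys" for z
  proof -
    have "(\<Prod>z'\<leftarrow>ys. row_diff (u z) (u z')) = 0"
      using that by (auto simp: prod_list_zero_iff row_diff_def)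
    moreover have "minor_sum u S ys xs (u z) = 0"
      using lx' that qn by (intro minor_sum_row_zero) auto
    ultimately show ?thesis by (simp add: L_def R_def)
  qed
  have node: "L ((1 + S x) / (1 - S x)) = R ((1 + S x) / (1 - S x))" if x: "x \<in> set xs" for x
  proof -
    obtain j where j: "j < length xs" "xs ! j = x" using x by (auto simp: in_set_conv_nth)
    define s where "s = S (xs ! j)"
    define t where "t = (1 + s) / (1 - s)"
    have s: "0 < s" "s < 1 / 10" using S[OF x] j by (simp_all add: s_def)
    let ?xs = "drop_nth j xs"
    have IH: "uz u S ys ?xs * row_disc u ys * col_disc S ?xs = (- sqrt 2) ^ (\<Sum>i<n. i)
      * (\<Prod>y\<leftarrow>ys. 1 - (u y)\<^sup>2) * (\<Prod>x\<leftarrow>?xs. (1 + (S x)\<^sup>2) * (1 - S x))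
      * (\<Prod>y\<leftarrow>ys. \<Prod>x\<leftarrow>?xs. qpole (u y) ((S x)\<^sup>2)) * det (pole_mat u S ys ?xs)"
      using Cons.IH[of ?xs] sy small_del[OF Cons.prems(3)] j lx by (simp add: length_del n_def)
    have cd: "col_disc S xs = (- 1) ^ j * (\<Prod>z\<leftarrow>?xs. s\<^sup>2 - (S z)\<^sup>2) * col_disc S ?xs"
      using col_disc_move[of S "take j xs" "xs ! j" "drop (Suc j) xs"] j(1)
      unfolding del_split[OF j(1), symmetric] drop_nth_def s_def by (simp add: min_def)
    have Z: "uz (u(y := t)) S (y # ys) xs = (1 + s\<^sup>2) * (1 - t * s - s - t)
      * (\<Prod>z\<leftarrow>ys. sqrt 2 * (1 + u z * s) * (1 - u z * s - s - u z))
      * (\<Prod>x\<leftarrow>?xs. 2 * (1 + t * S x) * (1 - t * S x)) * uz u S ys ?xs"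
      using y Cons.prems(3) j by (intro uz_node) (auto simp: s_def t_def)
    have e1: "(\<Prod>z\<leftarrow>ys. sqrt 2 * (1 + u z * s) * (1 - u z * s - s - u z)) * (\<Prod>z\<leftarrow>ys. row_diff t (u z)) =
        (- (2 * sqrt 2) / (1 - s)\<^sup>2) ^ n * (\<Prod>z\<leftarrow>ys. qpole (u z) (s\<^sup>2))"
      unfolding prod_list_mult_map[symmetric] node_row_factor[OF s t_def] prod_list_const_mult n_def ..
    have e2: "(\<Prod>x\<leftarrow>?xs. 2 * (1 + t * S x) * (1 - t * S x)) * (\<Prod>z\<leftarrow>?xs. s\<^sup>2 - (S z)\<^sup>2) =
        ((1 - s)\<^sup>2 / 2) ^ n * (\<Prod>x\<leftarrow>?xs. qpole t ((S x)\<^sup>2))"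
      unfolding prod_list_mult_map[symmetric] node_column_factor[OF s t_def] prod_list_const_mult
      using j lx by (simp add: length_del)
    have e3: "(- (2 * sqrt 2) / (1 - s)\<^sup>2) ^ n * ((1 - s)\<^sup>2 / 2) ^ n = (- sqrt 2) ^ n"
      using s by (simp add: power_mult_distrib[symmetric])
    have e4: "(- sqrt 2) ^ (\<Sum>i<length xs. i) = (- sqrt 2) ^ (\<Sum>i<n. i) * (- sqrt 2) ^ n"
      by (simp add: lx power_add)
    have e5: "(\<Prod>x\<leftarrow>xs. (1 + (S x)\<^sup>2) * (1 - S x)) = (1 + s\<^sup>2) * (1 - s) * (\<Prod>x\<leftarrow>?xs. (1 + (S x)\<^sup>2) * (1 - S x))"
      unfolding s_def by (rule prod_list_del[OF j(1)])
    have e6: "(\<Prod>y\<leftarrow>ys. \<Prod>x\<leftarrow>xs. qpole (u y) ((S x)\<^sup>2)) =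
        (\<Prod>z\<leftarrow>ys. qpole (u z) (s\<^sup>2)) * (\<Prod>y\<leftarrow>ys. \<Prod>x\<leftarrow>?xs. qpole (u y) ((S x)\<^sup>2))"
      unfolding s_def prod_list_mult_map[symmetric] prod_list_del[OF j(1)] ..
    have ms: "minor_sum u S ys xs t = (\<Prod>x\<leftarrow>?xs. qpole t ((S x)\<^sup>2)) * ((- 1) ^ j * det (pole_mat u S ys ?xs))"
      using node_single_factor(2)[OF s t_def] by (intro minor_sum_node y j) (simp add: s_def)
    have "L t = (1 + s\<^sup>2) * (1 - t * s - s - t) * (- 1) ^ j
      * ((\<Prod>z\<leftarrow>ys. sqrt 2 * (1 + u z * s) * (1 - u z * s - s - u z)) * (\<Prod>z\<leftarrow>ys. row_diff t (u z)))
      * ((\<Prod>x\<leftarrow>?xs. 2 * (1 + t * S x) * (1 - t * S x)) * (\<Prod>z\<leftarrow>?xs. s\<^sup>2 - (S z)\<^sup>2))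
      * (uz u S ys ?xs * row_disc u ys * col_disc S ?xs)"
      unfolding L_def K0_def Z cd by (simp only: mult_ac)
    also have "\<dots> = (1 + s\<^sup>2) * ((1 - s) * (1 - t\<^sup>2)) * (- 1) ^ j
      * ((- (2 * sqrt 2) / (1 - s)\<^sup>2) ^ n * ((1 - s)\<^sup>2 / 2) ^ n)
      * (\<Prod>z\<leftarrow>ys. qpole (u z) (s\<^sup>2)) * (\<Prod>x\<leftarrow>?xs. qpole t ((S x)\<^sup>2))
      * (uz u S ys ?xs * row_disc u ys * col_disc S ?xs)"
      unfolding e1 e2 node_single_factor(1)[OF s t_def] by (simp only: mult_ac)
    also have "\<dots> = R t"
      unfolding e3 IH R_def K1_def e4 e5 e6 ms by (simp only: mult_ac)
    finally show ?thesis using j by (simp add: t_def s_def)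
  qed
  define A where "A = insert 1 (u ` set ys \<union> (\<lambda>y. (1 + u y) / (u y - 1)) ` set ys
    \<union> (\<lambda>x. (1 + S x) / (1 - S x)) ` set xs \<union> (\<lambda>x. 1 / S x) ` set xs)"
  have "L t = R t" if "t \<in> A" for t
  proof -
    consider "t = 1" | z where "z \<in> set ys" "t = u z" | z where "z \<in> set ys" "t = (1 + u z) / (u z - 1)"
      | x where "x \<in> set xs" "t = (1 + S x) / (1 - S x)" | x where "x \<in> set xs" "t = 1 / S x"
      using \<open>t \<in> A\<close> unfolding A_def by blast
    then show ?thesis
    proof cases
      case 1
      then show ?thesis using uz_at_1[OF y(1,2)] by (simp add: L_def R_def)
    next
      case 2
      then show ?thesis using root by simp
    next
      case 3
      then show ?thesis using mirror[OF root] U[of z] by auto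
    next
      case 4
      then show ?thesis using node by simp
    next
      case 5
      then have s: "0 < S x" "S x < 1 / 10" using S by auto
      have "(1 + S x) / (1 - S x) \<noteq> 1" "(1 + S x) / (1 - S x) \<noteq> - 1"
        using s by (auto simp: divide_simps)
      moreover have "1 / S x = (1 + (1 + S x) / (1 - S x)) / ((1 + S x) / (1 - S x) - 1)"
        using s by (simp add: field_simps)
      ultimately show ?thesis using mirror[OF node] 5 by metis
    qed
  qed
  moreover have "finite A" "card A > 4 * n + 2"
    using card_nodes[OF sy Cons.prems(3)] lx unfolding A_def n_def by simp_all
  ultimately have LR: "L (u y) = R (u y)" using pdeg_eqI[OF degL degR] by blast
  have "uz u S (y # ys) xs * row_disc u (y # ys) * col_disc S xs = L (u y)"
    by (simp add: L_def K0_def)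
  also have "\<dots> = R (u y)" by (rule LR)
  also have "\<dots> = K1 * ((1 - (u y)\<^sup>2) * ((\<Prod>x\<leftarrow>xs. qpole (u y) ((S x)\<^sup>2)) * det (pole_mat u S (y # ys) xs)))"
    using minor_sum_det[OF lx' y(1), of "u y" S u] qn by (simp add: R_def)
  also have "\<dots> = (- sqrt 2) ^ (\<Sum>i<length xs. i)
    * (\<Prod>y\<leftarrow>y # ys. 1 - (u y)\<^sup>2) * (\<Prod>x\<leftarrow>xs. (1 + (S x)\<^sup>2) * (1 - S x))
    * (\<Prod>y\<leftarrow>y # ys. \<Prod>x\<leftarrow>xs. qpole (u y) ((S x)\<^sup>2)) * det (pole_mat u S (y # ys) xs)"
    unfolding K1_def by (simp only: list.map prod_list.Cons mult_ac)
  finally show ?case .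
qed

section \<open>The homogeneous limit\<close>

lemma tendsto_vop:
  assumes "\<And>p q r s. ((\<lambda>e. w e p q r s) \<longlongrightarrow> w' p q r s) F" "\<And>\<sigma>. ((\<lambda>e. \<psi> e \<sigma>) \<longlongrightarrow> \<psi>' \<sigma>) F"
  shows "((\<lambda>e. vop i j (w e) (\<psi> e) \<sigma>) \<longlongrightarrow> vop i j w' \<psi>' \<sigma>) F"
  unfolding vop_def by (intro tendsto_sum tendsto_mult assms)

lemma tendsto_column:
  assumes "\<And>r p q r' s. r \<in> set rs \<Longrightarrow> ((\<lambda>e. w e r p q r' s) \<longlongrightarrow> w' r p q r' s) F"
    and "\<And>\<sigma>. ((\<lambda>e. \<psi> e \<sigma>) \<longlongrightarrow> \<psi>' \<sigma>) F"
  shows "((\<lambda>e. column v (map (\<lambda>r. (r, w e r)) rs) (\<psi> e) \<sigma>) \<longlongrightarrow> column v (map (\<lambda>r. (r, w' r)) rs) \<psi>' \<sigma>) F"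
  using assms
proof (induction rs arbitrary: \<psi> \<psi>')
  case (Cons r rs)
  have "((\<lambda>e. vop r v (w e r) (\<psi> e) \<tau>) \<longlongrightarrow> vop r v (w' r) \<psi>' \<tau>) F" for \<tau>
    using Cons.prems by (intro tendsto_vop) auto
  with Cons show ?case by simp
qed simp

lemma tendsto_prod_list:
  fixes f :: "'a \<Rightarrow> 'b \<Rightarrow> real"
  assumes "\<And>y. y \<in> set zs \<Longrightarrow> ((\<lambda>e. f e y) \<longlongrightarrow> f' y) F"
  shows "((\<lambda>e. \<Prod>y\<leftarrow>zs. f e y) \<longlongrightarrow> (\<Prod>y\<leftarrow>zs. f' y)) F"
  using assms by (induction zs) (auto intro: tendsto_mult)

lemma tendsto_uz:
  assumes u: "\<And>y. y \<in> set ys \<Longrightarrow> ((\<lambda>e. u e y) \<longlongrightarrow> u' y) F"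
    and S: "\<And>x. x \<in> set xs \<Longrightarrow> ((\<lambda>e. S e x) \<longlongrightarrow> S' x) F"
  shows "((\<lambda>e. uz (u e) (S e) ys xs) \<longlongrightarrow> uz u' S' ys xs) F"
proof -
  let ?P = "\<lambda>e y. (1 :: real, u e y)" and ?P' = "\<lambda>y. (1 :: real, u' y)"
  have six: "((\<lambda>e. sixv (a e) (b e) (c e) (d e) p q r s) \<longlongrightarrow> sixv a' b' c' d' p q r s) F"
    if "(a \<longlongrightarrow> a') F" "(b \<longlongrightarrow> b') F" "(c \<longlongrightarrow> c') F" "(d \<longlongrightarrow> d') F" for a b c d a' b' c' d' p q r s
    using that by (simp add: sixv_def)
  have w: "((\<lambda>e. row_weight (?P e) (S e x) r p q r' s) \<longlongrightarrow> row_weight ?P' (S' x) r p q r' s) F"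
    if "x \<in> set xs" "r \<in> set (row_lines ys)" for x r p q r' s
  proof (cases r)
    case (H y)
    with that have "y \<in> set ys" by (auto simp: set_row_lines)
    with H show ?thesis
      by (simp add: row_weight_def line_weight_reflect) (intro six tendsto_intros u S that)
  next
    case (D y)
    with that have "y \<in> set ys" by (auto simp: set_row_lines)
    with D show ?thesis
      by (simp add: row_weight_def line_weight_def) (intro six tendsto_intros u S that)
  qed (use that in \<open>auto simp: set_row_lines\<close>)
  have gr: "((\<lambda>e. grid (?P e) (S e) ys zs (\<psi> e) \<sigma>) \<longlongrightarrow> grid ?P' S' ys zs \<psi>' \<sigma>) F"
    if "set zs \<subseteq> set xs" "\<And>\<sigma>. ((\<lambda>e. \<psi> e \<sigma>) \<longlongrightarrow> \<psi>' \<sigma>) F" for zs \<psi> \<psi>' \<sigma>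
    using that
  proof (induction zs arbitrary: \<psi> \<psi>')
    case (Cons x zs)
    have "((\<lambda>e. column (V x) (pair_rows (?P e) ys (S e x)) (\<psi> e) \<tau>) \<longlongrightarrow>
        column (V x) (pair_rows ?P' ys (S' x)) \<psi>' \<tau>) F" for \<tau>
      unfolding pair_rows_def using Cons.prems by (intro tendsto_column w) auto
    with Cons show ?case by simp
  qed simp
  show ?thesis
    unfolding uz_def uturn_Z_def
  proof (rule gr[OF subset_refl])
    show "((\<lambda>e. initial (?P e) ys xs \<sigma>) \<longlongrightarrow> initial ?P' ys xs \<sigma>) F" for \<sigma>
      unfolding initial_def
      by (intro tendsto_mult tendsto_prod_list tendsto_const) (auto simp: uturn_def intro: u)
  qed
qed

lemma tendsto_det:
  fixes f :: "'a \<Rightarrow> nat \<times> nat \<Rightarrow> real"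
  assumes "\<And>i j. i < n \<Longrightarrow> j < n \<Longrightarrow> ((\<lambda>e. f e (i, j)) \<longlongrightarrow> g (i, j)) F"
  shows "((\<lambda>e. det (mat n n (f e))) \<longlongrightarrow> det (mat n n g)) F"
proof -
  have eq: "det (mat n n h) = (\<Sum>p\<in>{p. p permutes {0..<n}}. signof p * (\<Prod>i = 0..<n. h (i, p i)))"
    for h :: "nat \<times> nat \<Rightarrow> real"
    unfolding det_def by (auto intro!: sum.cong prod.cong arg_cong2[where f = times])
  show ?thesis unfolding eq
    by (intro tendsto_sum tendsto_mult tendsto_const tendsto_prod assms) auto
qed

section \<open>Confluent limits of determinants\<close>

definition vandermonde :: "nat \<Rightarrow> (nat \<Rightarrow> real) \<Rightarrow> real mat" where
  "vandermonde n x = mat n n (\<lambda>(i, k). x i ^ k)"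

text \<open>In the Newton basis the Vandermonde matrix becomes triangular.\<close>

lemma det_vandermonde: "det (vandermonde n x) = (\<Prod>k<n. \<Prod>i<k. x k - x i)"
proof -
  define N where "N k = (\<Prod>i<k. [:- x i, 1:])" for k
  have deg: "degree (N k) = k" and lead: "coeff (N k) k = 1" for k
  proof -
    have "N k \<noteq> 0" by (auto simp: N_def)
    show d: "degree (N k) = k"
      unfolding N_def by (subst degree_prod_eq_sum_degree) auto
    have "lead_coeff (N k) = 1"
      by (simp add: N_def lead_coeff_prod)
    then show "coeff (N k) k = 1" by (simp add: d)
  qed
  define T where "T = mat n n (\<lambda>(l, k). coeff (N k) l)"
  have T: "T \<in> carrier_mat n n" and X: "vandermonde n x \<in> carrier_mat n n"
    by (simp_all add: T_def vandermonde_def)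
  have XT: "vandermonde n x * T = mat n n (\<lambda>(i, k). \<Prod>l<k. x i - x l)"
  proof (rule eq_matI)
    fix i k assume "i < dim_row (mat n n (\<lambda>(i, k). \<Prod>l<k. x i - x l))"
      "k < dim_col (mat n n (\<lambda>(i, k). \<Prod>l<k. x i - x l))"
    then have ik: "i < n" "k < n" by auto
    have "(vandermonde n x * T) $$ (i, k) = (\<Sum>l = 0..<n. x i ^ l * coeff (N k) l)"
      using ik by (auto simp: vandermonde_def T_def scalar_prod_def intro!: sum.cong)
    also have "\<dots> = (\<Sum>l\<le>k. coeff (N k) l * x i ^ l)"
      using ik deg[of k] by (intro sum.mono_neutral_cong_right) (auto simp: coeff_eq_0)
    also have "\<dots> = poly (N k) (x i)" by (simp add: poly_altdef deg)
    also have "\<dots> = (\<Prod>l<k. x i - x l)" by (simp add: N_def poly_prod)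
    finally show "(vandermonde n x * T) $$ (i, k) = mat n n (\<lambda>(i, k). \<Prod>l<k. x i - x l) $$ (i, k)"
      using ik by simp
  qed (auto simp: vandermonde_def T_def)
  have "upper_triangular T"
    by (auto simp: upper_triangular_def T_def deg intro!: coeff_eq_0)
  then have "det T = prod_list (diag_mat T)" using T by (rule det_upper_triangular)
  also have "diag_mat T = map (\<lambda>_. 1) [0..<n]" by (auto simp: diag_mat_def T_def lead)
  also have "prod_list \<dots> = 1" by (induction n) auto
  finally have "det (vandermonde n x) = det (vandermonde n x * T)"
    using det_mult[OF X T] by simp
  also have "\<dots> = prod_list (diag_mat (mat n n (\<lambda>(i, k). \<Prod>l<k. x i - x l)))"
    unfolding XT by (rule det_lower_triangular[of n]) (auto intro!: prod_zero)
  also have "\<dots> = (\<Prod>k<n. \<Prod>i<k. x k - x i)"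
    by (simp add: diag_mat_def prod.list_conv_set_nth atLeast0LessThan)
  finally show ?thesis .
qed

lemma pair_prod_snoc: "pair_prod f (xs @ [x]) = pair_prod f xs * (\<Prod>z\<leftarrow>xs. f z x)"
  by (induction xs) auto

lemma pair_prod_mult: "pair_prod (\<lambda>x y. f x y * g x y) xs = pair_prod f xs * pair_prod g xs"
  by (induction xs) (auto simp: prod_list_mult_map)

lemma pair_prod_const_mult: "pair_prod (\<lambda>x y. c * f x y) xs = c ^ (\<Sum>i<length xs. i) * pair_prod f xs"
  by (induction xs) (auto simp: prod_list_const_mult power_add)

lemma tendsto_pair_prod:
  assumes "\<And>x y. x \<in> set xs \<Longrightarrow> y \<in> set xs \<Longrightarrow> ((\<lambda>e. f e x y) \<longlongrightarrow> f' x y) F"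
  shows "((\<lambda>e. pair_prod (f e) xs) \<longlongrightarrow> pair_prod f' xs) F"
  using assms by (induction xs) (auto intro!: tendsto_mult tendsto_prod_list)

text \<open>The sign appears because \<open>pair_prod\<close> takes earlier minus later entries and
  the Vandermonde determinant later minus earlier ones.\<close>

lemma pair_prod_vandermonde:
  "pair_prod (\<lambda>x y. f x - f y) xs = (- 1) ^ (\<Sum>i<length xs. i) * det (vandermonde (length xs) (\<lambda>i. f (xs ! i)))"
proof (induction xs rule: rev_induct)
  case Nil
  then show ?case by (simp add: det_vandermonde)
next
  case (snoc x xs)
  have "(\<Prod>z\<leftarrow>xs. f z - f x) = (- 1) ^ length xs * (\<Prod>z\<leftarrow>xs. f x - f z)"
    by (induction xs) (auto simp: algebra_simps)
  also have "(\<Prod>z\<leftarrow>xs. f x - f z) = (\<Prod>i<length xs. f x - f (xs ! i))"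
    by (simp add: prod.list_conv_set_nth atLeast0LessThan)
  moreover have "(\<Prod>k<length xs. \<Prod>i<k. f ((xs @ [x]) ! k) - f ((xs @ [x]) ! i)) = (\<Prod>k<length xs. \<Prod>i<k. f (xs ! k) - f (xs ! i))"
    "(\<Prod>i<length xs. f x - f ((xs @ [x]) ! i)) = (\<Prod>i<length xs. f x - f (xs ! i))"
    by (auto intro!: prod.cong simp: nth_append)
  ultimately show ?case
    using snoc.IH by (simp add: pair_prod_snoc det_vandermonde power_add nth_append)
qed

lemma det_row_scale:
  "det (mat n n (\<lambda>(i, j). c i * f i j)) = (\<Prod>i<n. c i) * det (mat n n (\<lambda>(i, j). f i j :: real))"
proof -
  define Q where "Q = mat n n (\<lambda>(k, j). if k = j then c k else 0)"
  have "mat n n (\<lambda>(i, j). c i * f i j) = Q * mat n n (\<lambda>(i, j). f i j)"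
    unfolding Q_def
    by (rule eq_matI) (auto simp: scalar_prod_def if_distrib[where f = "\<lambda>a. a * _"] sum.delta cong: if_cong)
  moreover have "det Q = prod_list (diag_mat Q)"
    by (rule det_upper_triangular[of _ n]) (auto simp: upper_triangular_def Q_def)
  moreover have "prod_list (diag_mat Q) = (\<Prod>i<n. c i)"
    by (simp add: diag_mat_def Q_def prod.list_conv_set_nth atLeast0LessThan)
  ultimately show ?thesis by (simp add: det_mult[of _ n] Q_def)
qed

text \<open>The matrix of values is the Vandermonde matrix times a coefficient matrix whose row
  \<open>k\<close> carries \<open>e ^ k\<close>; pulling these powers out gives the denominator. Of
  the remainder only a finite limit matters, since it comes with \<open>e ^ n\<close>.\<close>

lemma det_expansion_limit:
  fixes F :: "nat \<Rightarrow> real \<Rightarrow> real" and A :: "nat \<Rightarrow> nat \<Rightarrow> real" and R :: "nat \<Rightarrow> real \<Rightarrow> real"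
  assumes x: "inj_on x {..<n}"
    and exp: "\<forall>\<^sub>F e in at_right 0. \<forall>i<n. \<forall>j<n. F j (e * x i) = (\<Sum>k<n. A k j * (e * x i) ^ k) + (e * x i) ^ n * R j (e * x i)"
    and R: "\<And>i j. i < n \<Longrightarrow> j < n \<Longrightarrow> ((\<lambda>e. R j (e * x i)) \<longlongrightarrow> r i j) (at_right 0)"
  shows "((\<lambda>e. det (mat n n (\<lambda>(i, j). F j (e * x i))) / e ^ (\<Sum>i<n. i)) \<longlongrightarrow>
    det (vandermonde n x) * det (mat n n (\<lambda>(k, j). A k j))) (at_right 0)"
proof -
  let ?X = "vandermonde n x"
  have X: "?X \<in> carrier_mat n n" by (simp add: vandermonde_def)
  have "det ?X \<noteq> 0"
  proof -
    have "x k - x i \<noteq> 0" if "k < n" "i < k" for k i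
      using inj_onD[OF x, of k i] that by auto
    then show ?thesis unfolding det_vandermonde by (auto simp: prod_zero_iff)
  qed
  \<comment> \<open>The inverse \<open>B\<close> of the Vandermonde matrix moves the remainder
    \<open>E\<close> to its right, as \<open>E = ?X * (B * E)\<close>. The factorization is then
    exact for each \<open>e\<close>, and the error in row \<open>k\<close>, relative to
    \<open>e ^ k\<close>, is of order \<open>e ^ (n - k)\<close> with \<open>k < n\<close>.\<close>
  then obtain B where B: "B \<in> carrier_mat n n" "?X * B = 1\<^sub>m n" "B * ?X = 1\<^sub>m n"
    using det_non_zero_imp_unit[OF X] by (auto simp: Units_def ring_mat_def)
  define G where "G e k j = e ^ (n - k) * (\<Sum>i<n. B $$ (k, i) * x i ^ n * R j (e * x i))" for e k j
  have G0: "((\<lambda>e. G e k j) \<longlongrightarrow> 0) (at_right 0)" if "k < n" "j < n" for k j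
  proof -
    have "((\<lambda>e. G e k j) \<longlongrightarrow> 0 ^ (n - k) * (\<Sum>i<n. B $$ (k, i) * x i ^ n * r i j)) (at_right 0)"
      unfolding G_def using that by (intro tendsto_intros R) auto
    then show ?thesis using that by (simp add: power_0_left)
  qed
  have eq: "det (mat n n (\<lambda>(i, j). F j (e * x i))) / e ^ (\<Sum>i<n. i) =
      det ?X * det (mat n n (\<lambda>(k, j). A k j + G e k j))"
    if "e > 0" and e: "\<forall>i<n. \<forall>j<n. F j (e * x i) = (\<Sum>k<n. A k j * (e * x i) ^ k) + (e * x i) ^ n * R j (e * x i)" for e
  proof -
    define E where "E = mat n n (\<lambda>(i, j). (e * x i) ^ n * R j (e * x i))"
    define C where "C = mat n n (\<lambda>(k, j). e ^ k * (A k j + G e k j))"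
    have C: "C \<in> carrier_mat n n" and E: "E \<in> carrier_mat n n" by (simp_all add: C_def E_def)
    have C_eq: "C = mat n n (\<lambda>(k, j). e ^ k * A k j) + B * E"
    proof (rule eq_matI)
      fix k j assume "k < dim_row (mat n n (\<lambda>(k, j). e ^ k * A k j) + B * E)"
        "j < dim_col (mat n n (\<lambda>(k, j). e ^ k * A k j) + B * E)"
      then have kj: "k < n" "j < n" using B E by auto
      have "(B * E) $$ (k, j) = (\<Sum>i<n. B $$ (k, i) * ((e * x i) ^ n * R j (e * x i)))"
        using kj B E by (auto simp: scalar_prod_def E_def atLeast0LessThan intro!: sum.cong)
      also have "\<dots> = e ^ k * G e k j"
      proof -
        have "e ^ n = e ^ k * e ^ (n - k)" using kj by (simp flip: power_add)
        then show ?thesis unfolding G_def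
          by (simp add: sum_distrib_left power_mult_distrib mult_ac)
      qed
      finally show "C $$ (k, j) = (mat n n (\<lambda>(k, j). e ^ k * A k j) + B * E) $$ (k, j)"
        using kj B E by (simp add: C_def algebra_simps)
    qed (use B E in \<open>auto simp: C_def\<close>)
    have "mat n n (\<lambda>(i, j). F j (e * x i)) = ?X * mat n n (\<lambda>(k, j). e ^ k * A k j) + E"
    proof (rule eq_matI)
      fix i j assume "i < dim_row (?X * mat n n (\<lambda>(k, j). e ^ k * A k j) + E)"
        "j < dim_col (?X * mat n n (\<lambda>(k, j). e ^ k * A k j) + E)"
      then have ij: "i < n" "j < n" by (auto simp: E_def)
      have "(?X * mat n n (\<lambda>(k, j). e ^ k * A k j)) $$ (i, j) = (\<Sum>k<n. A k j * (e * x i) ^ k)"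
        using ij by (auto simp: vandermonde_def scalar_prod_def atLeast0LessThan power_mult_distrib mult_ac intro!: sum.cong)
      then show "mat n n (\<lambda>(i, j). F j (e * x i)) $$ (i, j) = (?X * mat n n (\<lambda>(k, j). e ^ k * A k j) + E) $$ (i, j)"
        using ij e by (simp add: E_def vandermonde_def)
    qed (auto simp: E_def vandermonde_def)
    also have "E = ?X * (B * E)"
      using B E X by (simp flip: assoc_mult_mat[of _ n n _ n _ n])
    also have "?X * mat n n (\<lambda>(k, j). e ^ k * A k j) + ?X * (B * E) = ?X * C"
      unfolding C_eq using X B E by (intro mult_add_distrib_mat[symmetric, of _ n n _ n]) auto
    finally have "mat n n (\<lambda>(i, j). F j (e * x i)) = ?X * C" .
    moreover have "det C = e ^ (\<Sum>i<n. i) * det (mat n n (\<lambda>(k, j). A k j + G e k j))"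
      unfolding C_def by (simp add: det_row_scale[where f = "\<lambda>k j. A k j + G e k j"] power_sum)
    ultimately show ?thesis using that(1) det_mult[OF X C] by simp
  qed
  have "((\<lambda>e. A k j + G e k j) \<longlongrightarrow> A k j) (at_right 0)" if "k < n" "j < n" for k j
    using tendsto_add[OF tendsto_const G0[OF that], of "A k j"] by simp
  then have "((\<lambda>e. det ?X * det (mat n n (\<lambda>(k, j). A k j + G e k j))) \<longlongrightarrow>
      det ?X * det (mat n n (\<lambda>(k, j). A k j))) (at_right 0)"
    by (intro tendsto_mult tendsto_const tendsto_det) auto
  moreover have "\<forall>\<^sub>F e in at_right 0. det (mat n n (\<lambda>(i, j). F j (e * x i))) / e ^ (\<Sum>i<n. i) =
      det ?X * det (mat n n (\<lambda>(k, j). A k j + G e k j))"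
    using exp eventually_at_right_less[of 0] by eventually_elim (rule eq)
  ultimately show ?thesis by (simp add: tendsto_cong)
qed

text \<open>The partial fractions of \<open>g_20V\<close> divided by its numerator, with the two
  geometric series in \<open>v\<close> stopped after \<open>n\<close> terms and their remainders
  kept exactly.\<close>

lemma inverse_qpole_expansion:
  assumes "u \<noteq> 1" "(1 + u\<^sup>2) * (1 + 2 * u - u\<^sup>2) \<noteq> 0"
    and "\<phi> = ((1 + u) / (1 - u))\<^sup>2" "1 - v * \<phi> \<noteq> 0" "1 - v * u\<^sup>2 \<noteq> 0"
  shows "1 / qpole u v = (\<Sum>k<n. (\<phi> ^ Suc k - (u\<^sup>2) ^ Suc k) / ((1 + u\<^sup>2) * (1 + 2 * u - u\<^sup>2)) * v ^ k)
    + v ^ n * ((\<phi> ^ Suc n / (1 - v * \<phi>) - (u\<^sup>2) ^ Suc n / (1 - v * u\<^sup>2)) / ((1 + u\<^sup>2) * (1 + 2 * u - u\<^sup>2)))"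
proof -
  define N where "N = (1 + u\<^sup>2) * (1 + 2 * u - u\<^sup>2)"
  have geo: "z / (1 - v * z) = (\<Sum>k<n. z ^ Suc k * v ^ k) + v ^ n * (z ^ Suc n / (1 - v * z))"
    if "1 - v * z \<noteq> 0" for z
  proof (induction n)
    case (Suc n)
    have step: "z ^ Suc n / (1 - v * z) = z ^ Suc n + v * (z ^ Suc (Suc n) / (1 - v * z))"
      using that by (simp add: field_simps)
    show ?case by (subst Suc.IH, subst step) (simp add: algebra_simps)
  qed simp
  have q: "qpole u v = (1 - v * u\<^sup>2) * ((1 - u)\<^sup>2 * (1 - v * \<phi>))"
    using assms(1) unfolding qpole_def assms(3) by (simp add: power_divide algebra_simps)
  have N: "N = (\<phi> - u\<^sup>2) * (1 - u)\<^sup>2"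
    using assms(1) unfolding N_def assms(3)
    by (simp add: power_divide left_diff_distrib) (simp add: power2_eq_square algebra_simps)
  have "1 / qpole u v = (\<phi> / (1 - v * \<phi>) - u\<^sup>2 / (1 - v * u\<^sup>2)) / N"
  proof -
    have "\<phi> / (1 - v * \<phi>) - u\<^sup>2 / (1 - v * u\<^sup>2) = (\<phi> - u\<^sup>2) / ((1 - v * \<phi>) * (1 - v * u\<^sup>2))"
      using assms(4,5) by (simp add: divide_simps) (simp add: algebra_simps)
    moreover have "\<phi> - u\<^sup>2 \<noteq> 0" "(1 - u)\<^sup>2 \<noteq> 0" using assms(1,2) N unfolding N_def by auto
    ultimately show ?thesis unfolding q N using assms(4,5) by (simp add: divide_simps)
  qed
  also have "\<dots> = (\<Sum>k<n. (\<phi> ^ Suc k - (u\<^sup>2) ^ Suc k) / N * v ^ k)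
    + v ^ n * ((\<phi> ^ Suc n / (1 - v * \<phi>) - (u\<^sup>2) ^ Suc n / (1 - v * u\<^sup>2)) / N)"
  proof -
    have "(\<Sum>k<n. (\<phi> ^ Suc k - (u\<^sup>2) ^ Suc k) / N * v ^ k) =
        ((\<Sum>k<n. \<phi> ^ Suc k * v ^ k) - (\<Sum>k<n. (u\<^sup>2) ^ Suc k * v ^ k)) / N"
      unfolding sum_subtractf[symmetric] sum_divide_distrib
      by (intro sum.cong) (simp_all add: left_diff_distrib diff_divide_distrib)
    then show ?thesis
      unfolding geo[OF assms(4)] geo[OF assms(5)]
      by (simp add: diff_divide_distrib add_divide_distrib algebra_simps)
  qed
  finally show ?thesis unfolding N_def .
qed

lemma eventually_small:
  assumes "distinct zs" "(f \<longlongrightarrow> 0) (at_right 0)" "\<forall>\<^sub>F e in at_right 0. f e > (0 :: real)"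
  shows "\<forall>\<^sub>F e in at_right 0. small (\<lambda>z. f e * (1 + real z)) zs"
proof -
  have "\<forall>\<^sub>F e in at_right 0. \<forall>z\<in>set zs. f e * (1 + real z) < 1 / 10"
  proof (rule eventually_ball_finite, simp, intro ballI)
    fix z
    have "((\<lambda>e. f e * (1 + real z)) \<longlongrightarrow> 0 * (1 + real z)) (at_right 0)"
      by (intro tendsto_intros assms)
    then show "\<forall>\<^sub>F e in at_right 0. f e * (1 + real z) < 1 / 10"
      by (rule order_tendstoD) simp
  qed
  with assms(3) show ?thesis
    by eventually_elim (use assms(1) in \<open>auto simp: small_def inj_on_def\<close>)
qed

text \<open>All columns tend to 0 and \<open>col_disc\<close> cancels the Vandermonde determinant of
  their squares. The powers of \<open>1 - u y\<close> are what remains of the \<open>qpole\<close>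
  products, since \<open>qpole u 0 = (1 - u)\<^sup>2\<close>.\<close>

lemma uz_columns_homogeneous:
  assumes "length ys = n" "length xs = n" "small u ys" "distinct xs"
  shows "uz u (\<lambda>_. 0) ys xs * row_disc u ys = sqrt 2 ^ (\<Sum>i<n. i)
    * (\<Prod>y\<leftarrow>ys. 1 - (u y)\<^sup>2) * (\<Prod>y\<leftarrow>ys. (1 - u y) ^ (2 * n))
    * det (mat n n (\<lambda>(k, i). ((((1 + u (ys ! i)) / (1 - u (ys ! i)))\<^sup>2) ^ Suc k - ((u (ys ! i))\<^sup>2) ^ Suc k)
        / ((1 + (u (ys ! i))\<^sup>2) * (1 + 2 * u (ys ! i) - (u (ys ! i))\<^sup>2))))"
proof -
  define U where "U i = u (ys ! i)" for i
  define a where "a x = (1 + real x)\<^sup>2" for x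
  define S where "S e x = sqrt e * (1 + real x)" for e x
  define m where "m = (\<Sum>i<n. i)"
  define \<phi> where "\<phi> i = ((1 + U i) / (1 - U i))\<^sup>2" for i
  define N where "N i = (1 + (U i)\<^sup>2) * (1 + 2 * U i - (U i)\<^sup>2)" for i
  define Q where "Q j v = (\<phi> j ^ Suc n / (1 - v * \<phi> j) - ((U j)\<^sup>2) ^ Suc n / (1 - v * (U j)\<^sup>2)) / N j" for j v
  let ?V = "vandermonde n (\<lambda>i. a (xs ! i))"
  let ?A = "mat n n (\<lambda>(k, i). (\<phi> i ^ Suc k - ((U i)\<^sup>2) ^ Suc k) / N i)"
  have small: "0 < u y" "u y < 1 / 10" if "y \<in> set ys" for y using assms(3) that by (auto simp: small_def)
  have Ui: "0 < U i" "U i < 1 / 10" if "i < n" for i using small[of "ys ! i"] that assms by (auto simp: U_def)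
  have N0: "N i \<noteq> 0" if "i < n" for i
  proof -
    have "(U i)\<^sup>2 < 1" using Ui[OF that] by (simp add: abs_square_less_1)
    then have "1 + 2 * U i - (U i)\<^sup>2 > 0" using Ui[OF that] by linarith
    moreover have "1 + (U i)\<^sup>2 > 0" by (simp add: add_pos_nonneg)
    ultimately show ?thesis unfolding N_def by simp
  qed
  have sq: "((\<lambda>e. sqrt e) \<longlongrightarrow> 0) (at_right 0)"
    using tendsto_real_sqrt[OF tendsto_ident_at, of "0::real" "{0<..}"] by simp
  have pos: "\<forall>\<^sub>F e in at_right (0::real). 0 < e" by (rule eventually_at_right_less)
  have "\<forall>\<^sub>F e in at_right 0. sqrt e > 0" using pos by eventually_elim simp
  then have sm: "\<forall>\<^sub>F e in at_right 0. small (S e) xs"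
    unfolding S_def by (rule eventually_small[OF assms(4) sq])
  have S0: "((\<lambda>e. S e x) \<longlongrightarrow> 0) (at_right 0)" for x
    unfolding S_def using tendsto_mult[OF sq tendsto_const, of "1 + real x"] by simp
  have inj: "inj_on (\<lambda>i. a (xs ! i)) {..<n}"
    using assms(2,4) by (auto simp: inj_on_def a_def power2_eq_iff nth_eq_iff_index_eq)
  have V0: "det ?V \<noteq> 0"
    unfolding det_vandermonde using inj by (auto simp: prod_zero_iff dest!: inj_onD)
  have lim1: "((\<lambda>e. det (mat n n (\<lambda>(i, j). 1 / qpole (U j) (e * a (xs ! i)))) / e ^ m) \<longlongrightarrow> det ?V * det ?A) (at_right 0)"
    unfolding m_def
  proof (rule det_expansion_limit[OF inj, where F = "\<lambda>j v. 1 / qpole (U j) v" and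
        R = Q
        and r = "\<lambda>i j. (\<phi> j ^ Suc n - ((U j)\<^sup>2) ^ Suc n) / N j"])
    have ev: "\<forall>\<^sub>F e in at_right 0. 1 - e * c * z \<noteq> 0" for c z :: real
    proof -
      have "((\<lambda>e. 1 - e * c * z) \<longlongrightarrow> 1 - 0 * c * z) (at_right 0)" by (intro tendsto_intros)
      then show ?thesis by (rule tendsto_imp_eventually_ne) simp
    qed
    have "\<forall>\<^sub>F e in at_right 0. \<forall>i\<in>{..<n}. \<forall>j\<in>{..<n}. 1 - e * a (xs ! i) * \<phi> j \<noteq> 0 \<and> 1 - e * a (xs ! i) * (U j)\<^sup>2 \<noteq> 0"
      by (intro eventually_ball_finite ballI eventually_conj ev finite_lessThan)
    then show "\<forall>\<^sub>F e in at_right 0. \<forall>i<n. \<forall>j<n. 1 / qpole (U j) (e * a (xs ! i)) =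
        (\<Sum>k<n. (\<phi> j ^ Suc k - ((U j)\<^sup>2) ^ Suc k) / N j * (e * a (xs ! i)) ^ k) +
        (e * a (xs ! i)) ^ n * Q j (e * a (xs ! i))"
    proof eventually_elim
      case (elim e)
      show ?case
      proof (intro allI impI)
        fix i j assume ij: "i < n" "j < n"
        show "1 / qpole (U j) (e * a (xs ! i)) =
          (\<Sum>k<n. (\<phi> j ^ Suc k - ((U j)\<^sup>2) ^ Suc k) / N j * (e * a (xs ! i)) ^ k) +
          (e * a (xs ! i)) ^ n * Q j (e * a (xs ! i))"
          unfolding N_def Q_def
        proof (rule inverse_qpole_expansion)
          show "(1 + (U j)\<^sup>2) * (1 + 2 * U j - (U j)\<^sup>2) \<noteq> 0"
            using N0[OF ij(2)] unfolding N_def .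
        qed (use elim ij Ui[OF ij(2)] in \<open>auto simp: \<phi>_def\<close>)
      qed
    qed
    fix i j assume ij: "i < n" "j < n"
    have "((\<lambda>e. Q j (e * a (xs ! i))) \<longlongrightarrow> Q j (0 * a (xs ! i))) (at_right 0)"
      unfolding Q_def using N0[OF ij(2)] by (intro tendsto_intros) auto
    then show "((\<lambda>e. Q j (e * a (xs ! i))) \<longlongrightarrow> (\<phi> j ^ Suc n - ((U j)\<^sup>2) ^ Suc n) / N j) (at_right 0)"
      by (simp add: Q_def)
  qed
  define L where "L e = uz u (S e) ys xs * row_disc u ys * ((- 1) ^ m * det ?V)" for e
  define R where "R e = (- sqrt 2) ^ m * (\<Prod>y\<leftarrow>ys. 1 - (u y)\<^sup>2)
    * (\<Prod>x\<leftarrow>xs. (1 + (S e x)\<^sup>2) * (1 - S e x)) * (\<Prod>y\<leftarrow>ys. \<Prod>x\<leftarrow>xs. qpole (u y) ((S e x)\<^sup>2))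
    * (det (mat n n (\<lambda>(i, j). 1 / qpole (U j) (e * a (xs ! i)))) / e ^ m)" for e
  have "\<forall>\<^sub>F e in at_right 0. L e = R e"
    using sm pos
  proof eventually_elim
    case (elim e)
    have S2: "(S e x)\<^sup>2 = e * a x" for x using elim(2) by (simp add: S_def a_def power_mult_distrib)
    have cd: "pair_prod (\<lambda>x z. (S e x)\<^sup>2 - (S e z)\<^sup>2) xs = e ^ m * ((- 1) ^ m * det ?V)"
      unfolding S2 right_diff_distrib[symmetric] pair_prod_const_mult pair_prod_vandermonde m_def assms(2) ..
    have dp: "det (pole_mat u (S e) ys xs) = det (mat n n (\<lambda>(i, j). 1 / qpole (U j) (e * a (xs ! i))))"
    proof -
      \<comment> \<open>\<open>det_expansion_limit\<close> wants the shrinking variable in the rows,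
        and here it belongs to the columns.\<close>
      have "mat n n (\<lambda>(i, j). 1 / qpole (U j) (e * a (xs ! i))) = transpose_mat (pole_mat u (S e) ys xs)"
        using assms(1,2) by (intro eq_matI) (auto simp: pole_mat_def S2 U_def)
      then show ?thesis using assms(1,2) by (simp add: det_transpose[of _ n] pole_mat_def)
    qed
    have "e ^ m * L e = uz u (S e) ys xs * row_disc u ys * (e ^ m * ((- 1) ^ m * det ?V))"
      by (simp add: L_def)
    also have "\<dots> = e ^ m * R e"
      unfolding cd[symmetric] using uz_det[of ys xs u "S e"] assms elim
      by (simp add: R_def m_def dp)
    finally have "e ^ m * L e = e ^ m * R e" .
    then show ?case using elim(2) by simp
  qed
  moreover have "(L \<longlongrightarrow> uz u (\<lambda>_. 0) ys xs * row_disc u ys * ((- 1) ^ m * det ?V)) (at_right 0)"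
    unfolding L_def by (intro tendsto_mult tendsto_const tendsto_uz S0)
  ultimately have "(R \<longlongrightarrow> uz u (\<lambda>_. 0) ys xs * row_disc u ys * ((- 1) ^ m * det ?V)) (at_right 0)"
    by (simp add: tendsto_cong)
  moreover have "(R \<longlongrightarrow> (- sqrt 2) ^ m * (\<Prod>y\<leftarrow>ys. 1 - (u y)\<^sup>2)
    * (\<Prod>x\<leftarrow>xs. (1 + 0\<^sup>2) * (1 - 0)) * (\<Prod>y\<leftarrow>ys. \<Prod>x\<leftarrow>xs. qpole (u y) (0\<^sup>2)) * (det ?V * det ?A)) (at_right 0)"
    unfolding R_def qpole_def by (intro tendsto_mult[OF _ lim1[unfolded qpole_def]] tendsto_intros tendsto_prod_list S0)
  ultimately have "uz u (\<lambda>_. 0) ys xs * row_disc u ys * ((- 1) ^ m * det ?V) = (- sqrt 2) ^ m * (\<Prod>y\<leftarrow>ys. 1 - (u y)\<^sup>2)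
    * (\<Prod>x\<leftarrow>xs. (1 + 0\<^sup>2) * (1 - 0)) * (\<Prod>y\<leftarrow>ys. \<Prod>x\<leftarrow>xs. qpole (u y) (0\<^sup>2)) * (det ?V * det ?A)"
    by (rule tendsto_unique[rotated]) simp
  moreover have "(\<Prod>x\<leftarrow>xs. (1 + 0\<^sup>2) * (1 - 0 :: real)) = 1" by (induction xs) auto
  moreover have "(\<Prod>y\<leftarrow>ys. \<Prod>x\<leftarrow>xs. qpole (u y) (0\<^sup>2)) = (\<Prod>y\<leftarrow>ys. (1 - u y) ^ (2 * n))"
  proof -
    have "(\<Prod>x\<leftarrow>xs. qpole (u y) (0\<^sup>2)) = (1 - u y) ^ (2 * n)" for y
      using prod_list_const_mult[of "(1 - u y)\<^sup>2" "\<lambda>_. 1" xs] assms(2)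
      by (simp add: qpole_def power_mult map_replicate_const)
    then show ?thesis by simp
  qed
  moreover have "(- sqrt 2) ^ m = (- 1) ^ m * sqrt 2 ^ m" by (rule power_minus)
  ultimately have "((- 1) ^ m * det ?V) * (uz u (\<lambda>_. 0) ys xs * row_disc u ys) =
    ((- 1) ^ m * det ?V) * (sqrt 2 ^ m * (\<Prod>y\<leftarrow>ys. 1 - (u y)\<^sup>2) * (\<Prod>y\<leftarrow>ys. (1 - u y) ^ (2 * n)) * det ?A)"
    by (simp add: mult_ac)
  then show ?thesis using V0 unfolding \<phi>_def N_def m_def U_def by simp
qed

text \<open>The difference of powers from \<open>inverse_qpole_expansion\<close>, cleared of
  denominators by a power of \<open>1 - u\<close> that does not depend on \<open>k\<close>. The type
  is general because the real limit and the rational series share these polynomials. For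
  \<open>k < n\<close> the subtraction in the exponent is exact.\<close>

definition num_poly :: "nat \<Rightarrow> nat \<Rightarrow> 'a :: idom poly" where
  "num_poly n k = [:1, 1:] ^ (2 * Suc k) * [:1, - 1:] ^ (2 * n - 2 * k - 2) - monom 1 (2 * Suc k) * [:1, - 1:] ^ (2 * n)"

lemma poly_num_poly:
  fixes u :: real
  assumes "k < n" "u \<noteq> 1"
  shows "(1 - u) ^ (2 * n) * ((((1 + u) / (1 - u))\<^sup>2) ^ Suc k - (u\<^sup>2) ^ Suc k) = poly (num_poly n k) u"
proof -
  have "(1 - u) ^ (2 * n) = (1 - u) ^ (2 * n - 2 * k - 2) * (1 - u) ^ (2 * Suc k)"
    unfolding power_add[symmetric] using assms(1) by (intro arg_cong[where f = "power (1 - u)"]) simp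
  moreover have "(1 - u) ^ (2 * Suc k) * ((1 + u) / (1 - u)) ^ (2 * Suc k) = (1 + u) ^ (2 * Suc k)"
    using assms(2) by (simp flip: power_mult_distrib)
  ultimately have "(1 - u) ^ (2 * n) * ((1 + u) / (1 - u)) ^ (2 * Suc k) = (1 - u) ^ (2 * n - 2 * k - 2) * (1 + u) ^ (2 * Suc k)"
    by (metis mult.assoc)
  moreover have "poly [:1, 1:] u = 1 + u" "poly [:1, - 1:] u = 1 - u" by simp_all
  then have "poly (num_poly n k) u =
      (1 - u) ^ (2 * n - 2 * k - 2) * (1 + u) ^ (2 * Suc k) - (1 - u) ^ (2 * n) * u ^ (2 * Suc k)"
    by (simp only: num_poly_def poly_diff poly_mult poly_power poly_monom mult_1_left mult.commute)
  ultimately show ?thesis by (simp only: right_diff_distrib power_mult[symmetric])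
qed

lemma poly_truncate:
  fixes p :: "real poly"
  shows "\<exists>r. \<forall>t. poly p t = (\<Sum>l<n. coeff p l * t ^ l) + t ^ n * poly r t"
proof (induction n arbitrary: p)
  case (Suc n)
  obtain a q where p: "p = pCons a q" by (cases p)
  obtain r where r: "\<And>t. poly q t = (\<Sum>l<n. coeff q l * t ^ l) + t ^ n * poly r t" using Suc by blast
  have "poly p t = (\<Sum>l<Suc n. coeff p l * t ^ l) + t ^ Suc n * poly r t" for t
    unfolding sum.lessThan_Suc_shift
    by (simp add: p r distrib_left sum_distrib_left mult_ac)
  then show ?case by blast
qed auto

text \<open>Now the slopes tend to 0. The first factors of \<open>row_diff\<close> give the
  Vandermonde determinant, while each second factor tends to -1, which removes the remaining sign;
  the numerators \<open>N\<close> depend on the row only and tend to 1.\<close>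

theorem uz_homogeneous:
  assumes "length ys = n" "length xs = n" "distinct ys" "distinct xs"
  shows "uz (\<lambda>_. 0) (\<lambda>_. 0) ys xs = sqrt 2 ^ (\<Sum>i<n. i) * det (mat n n (\<lambda>(l, k). coeff (num_poly n k) l))"
proof -
  define m where "m = (\<Sum>i<n. i)"
  define a where "a y = 1 + real y" for y
  define u where "u e y = e * a y" for e y
  define N where "N t = (1 + t\<^sup>2) * (1 + 2 * t - t\<^sup>2)" for t :: real
  let ?V = "vandermonde n (\<lambda>i. a (ys ! i))"
  let ?A = "mat n n (\<lambda>(l, k). coeff (num_poly n k) l) :: real mat"
  have pos: "\<forall>\<^sub>F e in at_right (0::real). 0 < e" by (rule eventually_at_right_less)
  have sm: "\<forall>\<^sub>F e in at_right 0. small (u e) ys"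
    unfolding u_def a_def by (rule eventually_small[OF assms(3) tendsto_ident_at pos])
  have u0: "((\<lambda>e. u e y) \<longlongrightarrow> 0) (at_right 0)" for y
  proof -
    have "((\<lambda>e. e * a y) \<longlongrightarrow> 0 * a y) (at_right 0)" by (intro tendsto_intros)
    then show ?thesis by (simp add: u_def)
  qed
  have inj: "inj_on (\<lambda>i. a (ys ! i)) {..<n}"
    using assms(1,3) by (auto simp: inj_on_def a_def nth_eq_iff_index_eq)
  have V0: "det ?V \<noteq> 0"
    unfolding det_vandermonde using inj by (auto simp: prod_zero_iff dest!: inj_onD)
  have lim1: "((\<lambda>e. det (mat n n (\<lambda>(i, k). poly (num_poly n k) (e * a (ys ! i)))) / e ^ m) \<longlongrightarrow> det ?V * det ?A) (at_right 0)"
  proof -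
    define r where "r k = (SOME r. \<forall>t::real. poly (num_poly n k) t = (\<Sum>l<n. coeff (num_poly n k) l * t ^ l) + t ^ n * poly r t)" for k
    have r: "poly (num_poly n k) t = (\<Sum>l<n. coeff (num_poly n k) l * t ^ l) + t ^ n * poly (r k) t" for k and t :: real
      unfolding r_def by (rule spec[OF someI_ex[OF poly_truncate]])
    show ?thesis
      unfolding m_def
    proof (rule det_expansion_limit[OF inj, where F = "\<lambda>k. poly (num_poly n k)" and R = "\<lambda>k. poly (r k)"
          and r = "\<lambda>i k. poly (r k) (0 * a (ys ! i))"])
      show "\<forall>\<^sub>F e in at_right 0. \<forall>i<n. \<forall>j<n. poly (num_poly n j) (e * a (ys ! i)) =
        (\<Sum>k<n. coeff (num_poly n j) k * (e * a (ys ! i)) ^ k) + (e * a (ys ! i)) ^ n * poly (r j) (e * a (ys ! i))"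
        using r by (intro always_eventually) blast
      show "((\<lambda>e. poly (r j) (e * a (ys ! i))) \<longlongrightarrow> poly (r j) (0 * a (ys ! i))) (at_right 0)" for i j
        by (intro tendsto_poly tendsto_intros)
    qed
  qed
  define L where "L e = uz (u e) (\<lambda>_. 0) ys xs * ((- 1) ^ m * det ?V)
    * pair_prod (\<lambda>y z. u e y * u e z - u e y - u e z - 1) ys" for e
  define R where "R e = sqrt 2 ^ m * (\<Prod>y\<leftarrow>ys. 1 - (u e y)\<^sup>2) * (\<Prod>y\<leftarrow>ys. 1 / N (u e y))
    * (det (mat n n (\<lambda>(i, k). poly (num_poly n k) (e * a (ys ! i)))) / e ^ m)" for e
  have "\<forall>\<^sub>F e in at_right 0. L e = R e"
    using sm pos
  proof eventually_elim
    case (elim e)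
    define X where "X i k = (((1 + u e (ys ! i)) / (1 - u e (ys ! i)))\<^sup>2) ^ Suc k - ((u e (ys ! i))\<^sup>2) ^ Suc k" for i k
    have rd: "row_disc (u e) ys = e ^ m * ((- 1) ^ m * det ?V)
        * pair_prod (\<lambda>y z. u e y * u e z - u e y - u e z - 1) ys"
    proof -
      have "pair_prod (\<lambda>y z. u e y - u e z) ys = e ^ m * ((- 1) ^ m * det ?V)"
        unfolding u_def right_diff_distrib[symmetric] pair_prod_const_mult pair_prod_vandermonde m_def assms(1) ..
      then show ?thesis unfolding row_diff_def pair_prod_mult by simp
    qed
    have eqX: "det (mat n n (\<lambda>(k, i). X i k / N (u e (ys ! i)))) = (\<Prod>i<n. 1 / N (u e (ys ! i))) * det (mat n n (\<lambda>(i, k). X i k))"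
    proof -
      have "mat n n (\<lambda>(k, i). X i k / N (u e (ys ! i))) = transpose_mat (mat n n (\<lambda>(i, k). 1 / N (u e (ys ! i)) * X i k))"
        by (intro eq_matI) auto
      then show ?thesis by (simp only: det_transpose[of _ n, OF mat_carrier] det_row_scale)
    qed
    have "(\<Prod>i<n. (1 - u e (ys ! i)) ^ (2 * n)) * det (mat n n (\<lambda>(i, k). X i k)) =
        det (mat n n (\<lambda>(i, k). poly (num_poly n k) (e * a (ys ! i))))"
      unfolding det_row_scale[symmetric]
    proof (intro arg_cong[where f = det] eq_matI)
      fix i k assume "i < dim_row (mat n n (\<lambda>(i, k). poly (num_poly n k) (e * a (ys ! i))))"
        "k < dim_col (mat n n (\<lambda>(i, k). poly (num_poly n k) (e * a (ys ! i))))"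
      then have ik: "i < n" "k < n" by auto
      have "ys ! i \<in> set ys" using ik assms(1) by auto
      then have "u e (ys ! i) \<noteq> 1" using elim(1) by (force simp: small_def)
      from poly_num_poly[OF ik(2) this]
      show "mat n n (\<lambda>(i, k). (1 - u e (ys ! i)) ^ (2 * n) * X i k) $$ (i, k) =
          mat n n (\<lambda>(i, k). poly (num_poly n k) (e * a (ys ! i))) $$ (i, k)"
        using ik by (simp add: X_def u_def)
    qed auto
    then have eqP: "(\<Prod>y\<leftarrow>ys. (1 - u e y) ^ (2 * n)) * det (mat n n (\<lambda>(k, i). X i k / N (u e (ys ! i)))) =
        (\<Prod>y\<leftarrow>ys. 1 / N (u e y)) * det (mat n n (\<lambda>(i, k). poly (num_poly n k) (e * a (ys ! i))))"
      unfolding eqX by (simp add: prod.list_conv_set_nth assms(1) atLeast0LessThan mult_ac)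
    have "e ^ m * L e = uz (u e) (\<lambda>_. 0) ys xs * row_disc (u e) ys"
      by (simp add: L_def rd)
    also have "\<dots> = sqrt 2 ^ m * (\<Prod>y\<leftarrow>ys. 1 - (u e y)\<^sup>2) * ((\<Prod>y\<leftarrow>ys. (1 - u e y) ^ (2 * n))
       * det (mat n n (\<lambda>(k, i). X i k / N (u e (ys ! i)))))"
      using uz_columns_homogeneous[OF assms(1,2) elim(1) assms(4)]
      unfolding m_def X_def N_def by (simp only: mult.assoc)
    also have "\<dots> = e ^ m * R e"
      unfolding eqP using elim(2) by (simp add: R_def)
    finally show ?case using elim(2) by simp
  qed
  moreover have "(L \<longlongrightarrow> uz (\<lambda>_. 0) (\<lambda>_. 0) ys xs * ((- 1) ^ m * det ?V) * pair_prod (\<lambda>y z. 0 * 0 - 0 - 0 - 1) ys) (at_right 0)"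
    unfolding L_def by (intro tendsto_mult tendsto_const tendsto_uz u0 tendsto_pair_prod tendsto_diff)
  ultimately have "(R \<longlongrightarrow> uz (\<lambda>_. 0) (\<lambda>_. 0) ys xs * ((- 1) ^ m * det ?V) * pair_prod (\<lambda>y z. 0 * 0 - 0 - 0 - 1) ys) (at_right 0)"
    by (simp add: tendsto_cong)
  moreover have "(R \<longlongrightarrow> sqrt 2 ^ m * (\<Prod>y\<leftarrow>ys. 1 - 0\<^sup>2) * (\<Prod>y\<leftarrow>ys. 1 / N 0) * (det ?V * det ?A)) (at_right 0)"
    unfolding R_def N_def
    by (intro tendsto_mult[OF _ lim1] tendsto_mult tendsto_const tendsto_prod_list tendsto_divide
        tendsto_add tendsto_diff tendsto_power u0) auto
  ultimately have "uz (\<lambda>_. 0) (\<lambda>_. 0) ys xs * ((- 1) ^ m * det ?V) * pair_prod (\<lambda>y z. 0 * 0 - 0 - 0 - 1) ys =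
      sqrt 2 ^ m * (\<Prod>y\<leftarrow>ys. 1 - 0\<^sup>2) * (\<Prod>y\<leftarrow>ys. 1 / N 0) * (det ?V * det ?A)"
    by (rule tendsto_unique[rotated]) simp
  moreover have "pair_prod (\<lambda>y z. 0 * 0 - 0 - 0 - 1) ys = (- 1) ^ m"
  proof -
    have "pair_prod (\<lambda>_ _. 1) zs = 1" for zs :: "nat list" by (induction zs) (auto simp: map_replicate_const)
    then show ?thesis
      using pair_prod_const_mult[of "- 1" "\<lambda>_ _. 1" ys] by (simp add: m_def assms(1))
  qed
  moreover have "(\<Prod>y\<leftarrow>ys. 1 - 0\<^sup>2 :: real) = 1" "(\<Prod>y\<leftarrow>ys. 1 / N 0) = 1"
    by (simp_all add: N_def map_replicate_const)
  moreover have "(- 1) ^ m * ((- 1) ^ m :: real) = 1" by (simp flip: power_mult_distrib)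
  ultimately have "det ?V * uz (\<lambda>_. 0) (\<lambda>_. 0) ys xs = det ?V * (sqrt 2 ^ m * det ?A)"
    by (simp add: mult_ac)
  then show ?thesis using V0 by (simp add: m_def)
qed

section \<open>Reduction of the 20-vertex model to the six-vertex model\<close>

definition tri :: "'l \<Rightarrow> 'l \<Rightarrow> 'l \<Rightarrow> 'l state \<Rightarrow> 'l state" where
  "tri h d v \<psi> \<sigma> = (\<Sum>a\<in>UNIV. \<Sum>b\<in>UNIV. \<Sum>c\<in>UNIV.
     if of_bool a + of_bool b + of_bool c = (of_bool (\<sigma> h) + of_bool (\<sigma> d) + of_bool (\<sigma> v) :: nat)
     then \<psi> (\<sigma>(h := a, d := b, v := c)) else 0)"

abbreviation diag_weight :: weight where
  "diag_weight \<equiv> sixv (sqrt 2) 1 1 1"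

abbreviation hor_weight :: weight where
  "hor_weight \<equiv> sixv 1 (sqrt 2) 1 1"

text \<open>Each of the 20 local configurations allowed by the ice rule gets total weight 2 when the
  vertex is opened into a triangle of three crossings, and every other one gets weight 0.\<close>

lemma tri_factorization:
  assumes "h \<noteq> d" "h \<noteq> v" "d \<noteq> v"
  shows "vop h d diag_weight (vop h v hor_weight (vop d v diag_weight \<psi>)) = (\<lambda>\<sigma>. 2 * tri h d v \<psi> \<sigma>)"
proof
  fix \<sigma>
  show "vop h d diag_weight (vop h v hor_weight (vop d v diag_weight \<psi>)) \<sigma> = 2 * tri h d v \<psi> \<sigma>"
    unfolding vop_triple[OF assms] tri_def UNIV_bool
    by (cases "\<sigma> h"; cases "\<sigma> d"; cases "\<sigma> v") (simp_all add: sixv_def)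
qed

lemma yang_baxter_20V: "yang_baxter diag_weight hor_weight diag_weight"
  unfolding yang_baxter_def all_bool_eq UNIV_bool by (simp add: sixv_def)

section \<open>Pulling the vertical lines to the left\<close>

definition col20 :: "nat \<Rightarrow> nat list \<Rightarrow> line state \<Rightarrow> line state" where
  "col20 x = fold (\<lambda>y. tri (H y) (D (x + y)) (V x))"

definition dh :: "nat \<Rightarrow> nat list \<Rightarrow> (line \<times> weight) list" where
  "dh x ys = concat (map (\<lambda>y. [(D (x + y), diag_weight), (H y, hor_weight)]) ys)"

definition hd_rows :: "nat \<Rightarrow> nat list \<Rightarrow> (line \<times> weight) list" where
  "hd_rows x ys = concat (map (\<lambda>y. [(H y, hor_weight), (D (x + y), diag_weight)]) ys)"

definition crossings :: "nat \<Rightarrow> nat list \<Rightarrow> line state \<Rightarrow> line state" where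
  "crossings x = fold (\<lambda>y. vop (H y) (D (x + y)) diag_weight)"

lemma col20_simps [simp]: "col20 x [] \<psi> = \<psi>" "col20 x (y # ys) \<psi> = col20 x ys (tri (H y) (D (x + y)) (V x) \<psi>)"
  by (simp_all add: col20_def)

lemma dh_simps [simp]: "dh x [] = []" "dh x (y # ys) = (D (x + y), diag_weight) # (H y, hor_weight) # dh x ys"
  by (simp_all add: dh_def)

lemma hd_rows_simps [simp]: "hd_rows x [] = []"
  "hd_rows x (y # ys) = (H y, hor_weight) # (D (x + y), diag_weight) # hd_rows x ys"
  by (simp_all add: hd_rows_def)

lemma crossings_simps [simp]: "crossings x [] \<psi> = \<psi>"
  "crossings x (y # ys) \<psi> = crossings x ys (vop (H y) (D (x + y)) diag_weight \<psi>)"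
  by (simp_all add: crossings_def)

lemma fst_dh: "fst ` set (dh x ys) = (\<lambda>y. D (x + y)) ` set ys \<union> H ` set ys"
  by (induction ys) auto

lemma tri_scale: "tri h d v (\<lambda>\<sigma>. k * \<psi> \<sigma>) = (\<lambda>\<sigma>. k * tri h d v \<psi> \<sigma>)"
  unfolding tri_def by (rule ext) (simp add: sum_distrib_left if_distrib cong: if_cong)

lemma col20_scale: "col20 x ys (\<lambda>\<sigma>. k * \<psi> \<sigma>) = (\<lambda>\<sigma>. k * col20 x ys \<psi> \<sigma>)"
  by (induction ys arbitrary: \<psi>) (simp_all add: tri_scale)

text \<open>The crossing of \<open>H y\<close> with its diagonal shares no line with the later
  vertices of the column, so all these crossings can be postponed to the end of the column.\<close>

lemma col20_eq:
  assumes "distinct ys"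
  shows "(\<lambda>\<sigma>. 2 ^ length ys * col20 x ys \<psi> \<sigma>) = crossings x ys (column (V x) (dh x ys) \<psi>)"
  using assms
proof (induction ys arbitrary: \<psi>)
  case (Cons y ys)
  let ?R = "vop (H y) (D (x + y)) diag_weight"
  have c: "?R (column (V x) (dh x ys) \<phi>) = column (V x) (dh x ys) (?R \<phi>)" for \<phi>
    using Cons.prems by (intro vop_column_commute) (auto simp: fst_dh)
  have "(\<lambda>\<sigma>. 2 ^ length (y # ys) * col20 x (y # ys) \<psi> \<sigma>) =
      (\<lambda>\<sigma>. 2 ^ length ys * col20 x ys (\<lambda>\<sigma>. 2 * tri (H y) (D (x + y)) (V x) \<psi> \<sigma>) \<sigma>)"
    by (simp add: col20_scale mult_ac)
  also have "\<dots> = crossings x (y # ys) (column (V x) (dh x (y # ys)) \<psi>)"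
    using Cons by (simp add: tri_factorization[symmetric] c)
  finally show ?case .
qed simp

lemma column_crossings_commute:
  assumes "fst ` set rs \<inter> (H ` set ys \<union> (\<lambda>y. D (x + y)) ` set ys) = {}"
  shows "column (V v) rs (crossings x ys \<psi>) = crossings x ys (column (V v) rs \<psi>)"
  using assms
proof (induction ys arbitrary: \<psi>)
  case (Cons y ys)
  have "vop (H y) (D (x + y)) diag_weight (column (V v) rs \<psi>) = column (V v) rs (vop (H y) (D (x + y)) diag_weight \<psi>)"
    using Cons.prems by (intro vop_column_commute) auto
  moreover have "fst ` set rs \<inter> (H ` set ys \<union> (\<lambda>y. D (x + y)) ` set ys) = {}" using Cons.prems by auto
  ultimately show ?case using Cons.IH by simp
qed simp

text \<open>One Yang-Baxter move per row. The vertical line meets the horizontal line before its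
  diagonal on the right of the crossing, and after it on the left.\<close>

lemma slide_column:
  assumes "distinct ys"
  shows "column (V v) (hd_rows x ys) (crossings x ys \<psi>) = crossings x ys (column (V v) (dh x ys) \<psi>)"
  using assms
proof (induction ys arbitrary: \<psi>)
  case (Cons y ys)
  let ?R = "vop (H y) (D (x + y)) diag_weight"
  let ?hd = "[(H y, hor_weight), (D (x + y), diag_weight)]"
  have 1: "column (V v) ?hd (crossings x ys \<phi>) = crossings x ys (column (V v) ?hd \<phi>)" for \<phi>
    using Cons.prems by (intro column_crossings_commute) auto
  have 2: "?R (column (V v) (dh x ys) \<phi>) = column (V v) (dh x ys) (?R \<phi>)" for \<phi>
    using Cons.prems by (intro vop_column_commute) (auto simp: fst_dh)
  have 3: "?R (vop (H y) (V v) hor_weight (vop (D (x + y)) (V v) diag_weight \<psi>)) =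
      vop (D (x + y)) (V v) diag_weight (vop (H y) (V v) hor_weight (?R \<psi>))"
    by (rule vop_yang_baxter[OF yang_baxter_20V]) auto
  have "column (V v) (hd_rows x (y # ys)) (crossings x (y # ys) \<psi>) =
      column (V v) (hd_rows x ys) (crossings x ys (column (V v) ?hd (?R \<psi>)))"
    unfolding 1[symmetric] by simp
  also have "\<dots> = crossings x ys (column (V v) (dh x ys) (column (V v) ?hd (?R \<psi>)))"
    using Cons by simp
  also have "\<dots> = crossings x (y # ys) (column (V v) (dh x (y # ys)) \<psi>)"
    by (simp add: 2 3)
  finally show ?case .
qed simp

text \<open>A diagonal drops by one row per column, so \<open>D (Suc x + (y - 1))\<close> is
  \<open>D (x + y)\<close>. The same sequence of lines can thus be grouped with every horizontal
  line before its diagonal, which leaves one diagonal at the top and one horizontal line at the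
  bottom.\<close>

lemma dh_shift:
  assumes "0 < m" "m \<le> k"
  shows "dh (Suc x) (rev [m - 1..<k]) = (D (x + k), diag_weight) # hd_rows x (rev [m..<k]) @ [(H (m - 1), hor_weight)]"
  using assms(2)
proof (induction k rule: dec_induct)
  case base
  have "[m - 1..<m] = [m - 1]" using assms(1) by (cases m) auto
  then show ?case using assms(1) by simp
next
  case (step k)
  then show ?case using assms(1) by simp
qed

text \<open>The rows met by the vertical line \<open>x\<close> after it has been pulled to the left of the crossings
  of the columns \<open>k, \<dots>, x - 1\<close>.\<close>

definition pulled :: "nat \<Rightarrow> nat \<Rightarrow> nat \<Rightarrow> (line \<times> weight) list" where
  "pulled n x k = map (\<lambda>c. (D c, diag_weight)) (rev [2 * n + k..<2 * n + x])
     @ dh k (rev [n + 1 - k..<2 * n]) @ map (\<lambda>y. (H y, hor_weight)) (rev [n + 1 - x..<n + 1 - k])"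

lemma pulled_self: "pulled n x x = dh x (rev [n + 1 - x..<2 * n])"
  by (simp add: pulled_def)

lemma pulled_Suc:
  assumes "1 \<le> k" "k < x" "x \<le> n"
  shows "pulled n x (Suc k) = map (\<lambda>c. (D c, diag_weight)) (rev [2 * n + k..<2 * n + x])
     @ hd_rows k (rev [n + 1 - k..<2 * n]) @ map (\<lambda>y. (H y, hor_weight)) (rev [n + 1 - x..<n + 1 - k])"
proof -
  have "dh (Suc k) (rev [n + 1 - k - 1..<2 * n]) = (D (k + 2 * n), diag_weight) #
      hd_rows k (rev [n + 1 - k..<2 * n]) @ [(H (n + 1 - k - 1), hor_weight)]"
    using assms by (intro dh_shift) auto
  moreover have "[2 * n + k..<2 * n + x] = (2 * n + k) # [2 * n + Suc k..<2 * n + x]"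
    using assms by (simp add: upt_conv_Cons)
  moreover have "[n + 1 - x..<n + 1 - k] = [n + 1 - x..<n - k] @ [n - k]"
  proof -
    have "n + 1 - k = Suc (n - k)" using assms by simp
    moreover have "[n + 1 - x..<Suc (n - k)] = [n + 1 - x..<n - k] @ [n - k]"
      using assms by (intro upt_Suc_append) simp
    ultimately show ?thesis by (simp only:)
  qed
  ultimately show ?thesis by (simp add: pulled_def add.commute)
qed

lemma slide_pulled:
  assumes "1 \<le> k" "k < x" "x \<le> n"
  shows "column (V v) (pulled n x (Suc k)) (crossings k (rev [n + 1 - k..<2 * n]) \<psi>) =
    crossings k (rev [n + 1 - k..<2 * n]) (column (V v) (pulled n x k) \<psi>)"
proof -
  let ?ys = "rev [n + 1 - k..<2 * n]"
  have 1: "column (V v) (map (\<lambda>c. (D c, diag_weight)) (rev [2 * n + k..<2 * n + x])) (crossings k ?ys \<phi>) =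
      crossings k ?ys (column (V v) (map (\<lambda>c. (D c, diag_weight)) (rev [2 * n + k..<2 * n + x])) \<phi>)" for \<phi>
    by (intro column_crossings_commute) auto
  have 2: "column (V v) (map (\<lambda>y. (H y, hor_weight)) (rev [n + 1 - x..<n + 1 - k])) (crossings k ?ys \<phi>) =
      crossings k ?ys (column (V v) (map (\<lambda>y. (H y, hor_weight)) (rev [n + 1 - x..<n + 1 - k])) \<phi>)" for \<phi>
    by (intro column_crossings_commute) auto
  show ?thesis
    unfolding pulled_Suc[OF assms] unfolding pulled_def
    by (simp only: column_append 1 slide_column distinct_rev distinct_upt 2)
qed

fun all_crossings :: "nat \<Rightarrow> nat \<Rightarrow> line state \<Rightarrow> line state" where
  "all_crossings n 0 \<psi> = \<psi>"
| "all_crossings n (Suc k) \<psi> = crossings (Suc k) (rev [n + 1 - Suc k..<2 * n]) (all_crossings n k \<psi>)"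

fun all_pulled :: "nat \<Rightarrow> nat \<Rightarrow> line state \<Rightarrow> line state" where
  "all_pulled n 0 \<psi> = \<psi>"
| "all_pulled n (Suc x) \<psi> = column (V (Suc x)) (pulled n (Suc x) (Suc 0)) (all_pulled n x \<psi>)"

fun all_col20 :: "nat \<Rightarrow> nat \<Rightarrow> line state \<Rightarrow> line state" where
  "all_col20 n 0 \<psi> = \<psi>"
| "all_col20 n (Suc x) \<psi> = col20 (Suc x) (rev [n + 1 - Suc x..<2 * n]) (all_col20 n x \<psi>)"

lemma slide_all_crossings:
  assumes "k < x" "x \<le> n"
  shows "column (V v) (pulled n x (Suc k)) (all_crossings n k \<psi>) = all_crossings n k (column (V v) (pulled n x (Suc 0)) \<psi>)"
  using assms
proof (induction k)
  case (Suc k)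
  have "column (V v) (pulled n x (Suc (Suc k))) (all_crossings n (Suc k) \<psi>) =
      crossings (Suc k) (rev [n + 1 - Suc k..<2 * n]) (column (V v) (pulled n x (Suc k)) (all_crossings n k \<psi>))"
    unfolding all_crossings.simps using Suc.prems by (intro slide_pulled) auto
  then show ?case using Suc by simp
qed simp

lemma all_col20_eq:
  assumes "m \<le> n"
  shows "(\<lambda>\<sigma>. 2 ^ (\<Sum>x<m. n + x) * all_col20 n m \<psi> \<sigma>) = all_crossings n m (all_pulled n m \<psi>)"
  using assms
proof (induction m)
  case (Suc m)
  let ?ys = "rev [n + 1 - Suc m..<2 * n]"
  have len: "length ?ys = n + m" using Suc.prems by simp
  have "(\<lambda>\<sigma>. 2 ^ (\<Sum>x<Suc m. n + x) * all_col20 n (Suc m) \<psi> \<sigma>) =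
      (\<lambda>\<sigma>. 2 ^ length ?ys * col20 (Suc m) ?ys (\<lambda>\<sigma>. 2 ^ (\<Sum>x<m. n + x) * all_col20 n m \<psi> \<sigma>) \<sigma>)"
    unfolding len col20_scale by (simp add: power_add mult_ac)
  also have "\<dots> = crossings (Suc m) ?ys (column (V (Suc m)) (dh (Suc m) ?ys) (all_crossings n m (all_pulled n m \<psi>)))"
  proof -
    have "(\<lambda>\<sigma>. 2 ^ (\<Sum>x<m. n + x) * all_col20 n m \<psi> \<sigma>) = all_crossings n m (all_pulled n m \<psi>)"
      using Suc by simp
    then show ?thesis by (simp only: col20_eq distinct_rev distinct_upt)
  qed
  also have "column (V (Suc m)) (dh (Suc m) ?ys) (all_crossings n m (all_pulled n m \<psi>)) =
      all_crossings n m (column (V (Suc m)) (pulled n (Suc m) (Suc 0)) (all_pulled n m \<psi>))"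
    unfolding pulled_self[symmetric] using Suc.prems by (intro slide_all_crossings) auto
  finally show ?case by simp
qed simp

text \<open>At the right end all horizontal and diagonal lines are empty, so each crossing
  contributes the weight \<open>sqrt 2\<close> of two empty lines.\<close>

lemma crossings_final: "crossings x ys \<psi> final = sqrt 2 ^ length ys * \<psi> final"
proof (induction ys arbitrary: \<psi>)
  case (Cons y ys)
  have "final(H y := False, D (x + y) := False) = final" by (auto simp: fun_eq_iff)
  with Cons show ?case by (simp add: vop_def UNIV_bool sixv_def)
qed simp

lemma all_crossings_final: "m \<le> n \<Longrightarrow> all_crossings n m \<psi> final = sqrt 2 ^ (\<Sum>x<m. n + x) * \<psi> final"
  by (induction m) (simp_all add: crossings_final power_add)

section \<open>Discarding the rows outside the core\<close>

lemma column_frozen_top: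
  assumes "\<And>\<sigma>. \<sigma> v \<Longrightarrow> \<psi> \<sigma> = 0" "\<And>\<sigma> l. l \<in> set ls \<Longrightarrow> \<sigma> l \<Longrightarrow> \<psi> \<sigma> = 0" "v \<notin> set ls"
  shows "column v (map (\<lambda>l. (l, sixv a b c d)) ls) \<psi> = (\<lambda>\<sigma>. a ^ length ls * \<psi> \<sigma>)"
  using assms(2,3)
proof (induction ls)
  case (Cons l ls)
  have "vop l v (sixv a b c d) \<psi> = (\<lambda>\<sigma>. a * \<psi> \<sigma>)"
  proof
    fix \<sigma>
    have z: "\<psi> (\<sigma>(l := p, v := q)) = 0" if "p \<or> q" for p q
    proof (cases q)
      case True
      then show ?thesis by (intro assms(1)) simp
    next
      case False
      then show ?thesis using that Cons.prems by (intro Cons.prems(1)[of l]) auto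
    qed
    show "vop l v (sixv a b c d) \<psi> \<sigma> = a * \<psi> \<sigma>"
    proof (cases "\<sigma> l \<or> \<sigma> v")
      case True
      then have "\<psi> \<sigma> = 0" using assms(1) Cons.prems(1)[of l] by auto
      with True show ?thesis by (auto simp: vop_def UNIV_bool z sixv_def)
    next
      case False
      then have "\<sigma>(l := False, v := False) = \<sigma>" by (auto simp: fun_eq_iff)
      with False show ?thesis by (auto simp: vop_def UNIV_bool z sixv_def)
    qed
  qed
  moreover have "column v (map (\<lambda>l. (l, sixv a b c d)) ls) \<psi> = (\<lambda>\<sigma>. a ^ length ls * \<psi> \<sigma>)"
  proof (rule Cons.IH)
    show "\<psi> \<sigma> = 0" if "l' \<in> set ls" "\<sigma> l'" for \<sigma> l'
      by (rule Cons.prems(1)[of l']) (use that in auto)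
  qed (use Cons.prems in auto)
  ultimately show ?case by (simp add: column_scale mult.assoc)
qed simp

text \<open>With the rows entering empty and \<open>v\<close> leaving occupied, conservation allows
  only straight passages of \<open>v\<close>.\<close>

lemma column_frozen_bottom:
  assumes "\<And>\<sigma> l. l \<in> set ls \<Longrightarrow> \<sigma> l \<Longrightarrow> \<psi> \<sigma> = 0" "v \<notin> set ls" "distinct ls" "\<sigma> v"
  shows "column v (map (\<lambda>l. (l, sixv a b c d)) ls) \<psi> \<sigma> = b ^ length ls * \<psi> \<sigma>"
  using assms
proof (induction ls arbitrary: \<psi>)
  case (Cons l ls)
  let ?\<psi> = "vop l v (sixv a b c d) \<psi>"
  have l0: "\<psi> \<tau> = 0" if "\<tau> l" for \<tau> by (rule Cons.prems(1)[of l]) (simp_all add: that)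
  have "column v (map (\<lambda>l. (l, sixv a b c d)) ls) ?\<psi> \<sigma> = b ^ length ls * ?\<psi> \<sigma>"
  proof (rule Cons.IH)
    fix \<tau> l' assume l': "l' \<in> set ls" "\<tau> l'"
    then have "l' \<noteq> l" "l' \<noteq> v" using Cons.prems by auto
    then have "\<psi> (\<tau>(l := p, v := q)) = 0" for p q
      using l' by (intro Cons.prems(1)[of l']) auto
    then show "?\<psi> \<tau> = 0" by (simp add: vop_def)
  qed (use Cons.prems in auto)
  moreover have "?\<psi> \<sigma> = b * \<psi> \<sigma>"
  proof (cases "\<sigma> l")
    case True
    then show ?thesis using Cons.prems(2,4) by (simp add: vop_def UNIV_bool l0 sixv_def)
  next
    case False
    then have "\<sigma>(l := False, v := True) = \<sigma>" using Cons.prems by (auto simp: fun_eq_iff)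
    moreover have "l \<noteq> v" using Cons.prems(2) by auto
    ultimately show ?thesis using False Cons.prems(4) by (simp add: vop_def UNIV_bool l0 sixv_def)
  qed
  ultimately show ?case by simp
qed simp

definition core :: "nat \<Rightarrow> (line \<times> weight) list" where
  "core n = hd_rows 0 (rev [n + 1..<2 * n]) @ [(H n, hor_weight)]"

lemma hd_rows_append [simp]: "hd_rows x (ys @ ys') = hd_rows x ys @ hd_rows x ys'"
  by (simp add: hd_rows_def)

lemma fst_hd_rows: "fst ` set (hd_rows x ys) = H ` set ys \<union> (\<lambda>y. D (x + y)) ` set ys"
  by (induction ys) auto

lemma fst_core: "1 \<le> n \<Longrightarrow> fst ` set (core n) = H ` {n..<2 * n} \<union> D ` {n + 1..<2 * n}"
  by (auto simp: core_def fst_hd_rows)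

lemma pulled_core:
  assumes "1 \<le> x" "x \<le> n"
  shows "pulled n x (Suc 0) = map (\<lambda>l. (l, diag_weight)) (map D (rev [2 * n..<2 * n + x])) @ core n
    @ map (\<lambda>l. (l, hor_weight)) (map H (rev [n + 1 - x..<n]))"
proof -
  have "dh (Suc 0) (rev [n + 1 - 1..<2 * n]) = (D (0 + 2 * n), diag_weight) # hd_rows 0 (rev [n + 1..<2 * n]) @ [(H (n + 1 - 1), hor_weight)]"
    using assms by (intro dh_shift) auto
  moreover have "[2 * n..<2 * n + x] = 2 * n # [2 * n + Suc 0..<2 * n + x]"
    using assms by (simp add: upt_conv_Cons)
  ultimately show ?thesis by (simp add: pulled_def core_def)
qed

text \<open>The core has \<open>2 * n - 1\<close> rows and lacks the partner of \<open>H n\<close>.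
  The line \<open>D n\<close>, which is not one of the lines of the 20-vertex model, takes this
  place: it enters empty, and the occupied vertical lines pass it with weight 1.\<close>

lemma rows_core:
  assumes "1 \<le> n"
  shows "pair_rows (\<lambda>_. (1, 0)) (rev [n..<2 * n]) 0 = core n @ [(D n, diag_weight)]"
proof -
  have "pair_rows (\<lambda>_. (1, 0)) ys 0 = hd_rows 0 ys" for ys
    by (induction ys) (simp_all add: line_weight_reflect, simp add: line_weight_def)
  moreover have "[n..<2 * n] = n # [n + 1..<2 * n]"
    using assms by (simp add: upt_conv_Cons)
  ultimately show ?thesis by (simp add: core_def)
qed

fun core_grid :: "nat \<Rightarrow> nat \<Rightarrow> line state \<Rightarrow> line state" where
  "core_grid n 0 \<psi> = \<psi>"
| "core_grid n (Suc x) \<psi> = column (V (Suc x)) (core n) (core_grid n x \<psi>)"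

lemma core_grid_cong_on:
  assumes "\<And>\<sigma>. \<sigma> \<in> A \<Longrightarrow> \<psi> \<sigma> = \<psi>' \<sigma>"
    and "\<And>\<sigma> r x a b. \<sigma> \<in> A \<Longrightarrow> r \<in> fst ` set (core n) \<Longrightarrow> 1 \<le> x \<Longrightarrow> x \<le> m \<Longrightarrow> \<sigma>(r := a, V x := b) \<in> A"
    and "\<sigma> \<in> A"
  shows "core_grid n m \<psi> \<sigma> = core_grid n m \<psi>' \<sigma>"
  using assms(2,3)
proof (induction m arbitrary: \<sigma>)
  case (Suc m)
  have "column (V (Suc m)) (core n) (core_grid n m \<psi>) \<sigma> = column (V (Suc m)) (core n) (core_grid n m \<psi>') \<sigma>"
  proof (rule column_cong_on[of A])
    show "core_grid n m \<psi> \<tau> = core_grid n m \<psi>' \<tau>" if "\<tau> \<in> A" for \<tau>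
      by (rule Suc.IH) (use Suc.prems(1) that in auto)
    show "\<tau>(r := a, V (Suc m) := b) \<in> A" if "r \<in> fst ` set (core n)" "\<tau> \<in> A" for \<tau> a b r
      by (rule Suc.prems(1)) (use that in auto)
  qed (rule Suc.prems(2))
  then show ?case by simp
qed (use assms(1) in simp)

lemma core_grid_vanish:
  assumes "\<And>\<sigma>. \<sigma> l \<Longrightarrow> \<psi> \<sigma> = 0" "l \<notin> fst ` set (core n)" "\<And>x. 1 \<le> x \<Longrightarrow> x \<le> m \<Longrightarrow> l \<noteq> V x" "\<sigma> l"
  shows "core_grid n m \<psi> \<sigma> = 0"
  using assms(3,4)
proof (induction m arbitrary: \<sigma>)
  case (Suc m)
  have "column (V (Suc m)) (core n) (core_grid n m \<psi>) \<sigma> = 0"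
  proof (rule column_zero_on[of "{\<tau>. \<tau> l}"])
    show "core_grid n m \<psi> \<tau> = 0" if "\<tau> \<in> {\<tau>. \<tau> l}" for \<tau>
      using Suc.prems(1) that by (intro Suc.IH) auto
    show "\<tau>(r := a, V (Suc m) := b) \<in> {\<tau>. \<tau> l}" if "r \<in> fst ` set (core n)" "\<tau> \<in> {\<tau>. \<tau> l}" for \<tau> a b r
      using Suc.prems(1)[of "Suc m"] that assms(2) by auto
  qed (simp add: Suc.prems(2))
  then show ?case by simp
qed (use assms(1) in simp)

text \<open>The vertical line \<open>x\<close> passes \<open>x\<close> empty diagonals above the
  core while empty itself, and \<open>x - 1\<close> empty horizontal lines below it while occupied.
  Each passage weighs \<open>sqrt 2\<close>, and the sum of \<open>2 * x - 1\<close> over the first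
  \<open>m\<close> lines is \<open>m\<^sup>2\<close>.\<close>

lemma all_pulled_core:
  assumes n: "1 \<le> n" "m \<le> n"
    and V: "\<And>\<sigma> x. 1 \<le> x \<Longrightarrow> x \<le> n \<Longrightarrow> \<sigma> (V x) \<Longrightarrow> \<psi> \<sigma> = 0"
    and D: "\<And>\<sigma> c. 2 * n \<le> c \<Longrightarrow> c < 3 * n \<Longrightarrow> \<sigma> (D c) \<Longrightarrow> \<psi> \<sigma> = 0"
    and H: "\<And>\<sigma> y. 1 \<le> y \<Longrightarrow> y < n \<Longrightarrow> \<sigma> (H y) \<Longrightarrow> \<psi> \<sigma> = 0"
    and "\<forall>x. 1 \<le> x \<and> x \<le> m \<longrightarrow> \<sigma> (V x)"
  shows "all_pulled n m \<psi> \<sigma> = sqrt 2 ^ (m\<^sup>2) * core_grid n m \<psi> \<sigma>"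
  using assms(2,6)
proof (induction m arbitrary: \<sigma>)
  case (Suc m)
  let ?v = "V (Suc m)" and ?\<Phi> = "core_grid n m \<psi>" and ?A = "{\<tau>. \<forall>x. 1 \<le> x \<and> x \<le> m \<longrightarrow> \<tau> (V x)}"
  have "column ?v (pulled n (Suc m) (Suc 0)) (all_pulled n m \<psi>) \<sigma> =
      column ?v (pulled n (Suc m) (Suc 0)) (\<lambda>\<tau>. sqrt 2 ^ (m\<^sup>2) * ?\<Phi> \<tau>) \<sigma>"
  proof (rule column_cong_on[of "?A"])
    show "all_pulled n m \<psi> \<tau> = sqrt 2 ^ (m\<^sup>2) * ?\<Phi> \<tau>" if "\<tau> \<in> ?A" for \<tau>
      using Suc.IH[of \<tau>] that Suc.prems(1) by simp
    show "\<tau>(r := a, ?v := b) \<in> ?A"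
      if "r \<in> fst ` set (pulled n (Suc m) (Suc 0))" "\<tau> \<in> ?A" for \<tau> r a b
    proof -
      have "r \<noteq> V x" for x
        using that(1) Suc.prems(1) n(1) by (auto simp: pulled_core image_Un fst_core)
      then show ?thesis using that(2) by auto
    qed
  qed (use Suc.prems in auto)
  also have "\<dots> = sqrt 2 ^ (m\<^sup>2) * column ?v (pulled n (Suc m) (Suc 0)) ?\<Phi> \<sigma>"
    by (simp only: column_scale)
  also have "column ?v (pulled n (Suc m) (Suc 0)) ?\<Phi> \<sigma> = sqrt 2 ^ (2 * m + 1) * column ?v (core n) ?\<Phi> \<sigma>"
  proof -
    let ?top = "map (\<lambda>l. (l, diag_weight)) (map D (rev [2 * n..<2 * n + Suc m]))"
    let ?bot = "map (\<lambda>l. (l, hor_weight)) (map H (rev [n + 1 - Suc m..<n]))"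
    have van: "?\<Phi> \<tau> = 0" if "\<tau> l" "\<And>\<sigma>. \<sigma> l \<Longrightarrow> \<psi> \<sigma> = 0" "l \<notin> fst ` set (core n)" "\<And>x. x \<le> m \<Longrightarrow> l \<noteq> V x" for \<tau> l
      using that by (intro core_grid_vanish[of l]) auto
    have top: "column ?v ?top ?\<Phi> = (\<lambda>\<tau>. sqrt 2 ^ length (map D (rev [2 * n..<2 * n + Suc m])) * ?\<Phi> \<tau>)"
    proof (rule column_frozen_top)
      show "?\<Phi> \<tau> = 0" if "\<tau> ?v" for \<tau>
        using that Suc.prems(1) n(1) V by (intro van[of _ ?v]) (auto simp: fst_core)
      show "?\<Phi> \<tau> = 0" if "l \<in> set (map D (rev [2 * n..<2 * n + Suc m]))" "\<tau> l" for \<tau> l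
      proof -
        obtain c where c: "l = D c" "2 * n \<le> c" "c < 3 * n" using \<open>l \<in> _\<close> Suc.prems(1) by auto
        show ?thesis using \<open>\<tau> l\<close> n(1) D[OF c(2,3)] unfolding c(1)
          by (intro van[of _ "D c"]) (use c(2) in \<open>auto simp: fst_core\<close>)
      qed
    qed auto
    have bot: "column ?v ?bot (column ?v (core n) ?\<Phi>) \<sigma> =
        sqrt 2 ^ length (map H (rev [n + 1 - Suc m..<n])) * column ?v (core n) ?\<Phi> \<sigma>"
    proof (rule column_frozen_bottom)
      fix \<tau> l assume l: "l \<in> set (map H (rev [n + 1 - Suc m..<n]))" "\<tau> l"
      then obtain y where y: "l = H y" "1 \<le> y" "y < n" using Suc.prems(1) by auto
      show "column ?v (core n) ?\<Phi> \<tau> = 0"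
      proof (rule column_zero_on[of "{\<tau>. \<tau> l}"])
        show "?\<Phi> \<tau> = 0" if "\<tau> \<in> {\<tau>. \<tau> l}" for \<tau>
          using that y n(1) H by (intro van[of _ l]) (auto simp: fst_core)
      qed (use l y n(1) in \<open>auto simp: fst_core\<close>)
    qed (use Suc.prems in \<open>auto simp: distinct_map inj_on_def\<close>)
    have "column ?v (pulled n (Suc m) (Suc 0)) ?\<Phi> \<sigma> =
        sqrt 2 ^ Suc m * column ?v ?bot (column ?v (core n) ?\<Phi>) \<sigma>"
    proof -
      have "1 \<le> Suc m" by simp
      then show ?thesis
        unfolding pulled_core[OF \<open>1 \<le> Suc m\<close> Suc.prems(1)] column_append top column_scale
        by (simp del: upt_Suc)
    qed
    also have "\<dots> = sqrt 2 ^ Suc m * (sqrt 2 ^ m * column ?v (core n) ?\<Phi> \<sigma>)"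
      unfolding bot using Suc.prems(1) by (simp del: upt_Suc)
    also have "\<dots> = sqrt 2 ^ (2 * m + 1) * column ?v (core n) ?\<Phi> \<sigma>"
      by (simp add: mult_2 power_add)
    finally show ?thesis .
  qed
  also have "sqrt 2 ^ (m\<^sup>2) * (sqrt 2 ^ (2 * m + 1) * column ?v (core n) ?\<Phi> \<sigma>) =
      sqrt 2 ^ ((Suc m)\<^sup>2) * core_grid n (Suc m) \<psi> \<sigma>"
    unfolding mult.assoc[symmetric] power_add[symmetric] by (simp add: power2_eq_square algebra_simps)
  finally show ?case by simp
qed simp

lemma grid_core:
  assumes n: "1 \<le> n" and D: "\<And>\<sigma>. \<sigma> (D n) \<Longrightarrow> \<psi> \<sigma> = 0"
    and "\<forall>x. 1 \<le> x \<and> x \<le> m \<longrightarrow> \<sigma> (V x)"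
  shows "grid (\<lambda>_. (1, 0)) (\<lambda>_. 0) (rev [n..<2 * n]) [1..<Suc m] \<psi> \<sigma> = core_grid n m \<psi> \<sigma>"
  using assms(3)
proof (induction m arbitrary: \<sigma>)
  case (Suc m)
  let ?G = "grid (\<lambda>_. (1, 0)) (\<lambda>_. 0) (rev [n..<2 * n]) [1..<Suc m] \<psi>"
  let ?v = "V (Suc m)" and ?\<Phi> = "core_grid n m \<psi>" and ?A = "{\<tau>. \<forall>x. 1 \<le> x \<and> x \<le> m \<longrightarrow> \<tau> (V x)}"
  let ?C = "core n @ [(D n, diag_weight)]"
  have "grid (\<lambda>_. (1, 0)) (\<lambda>_. 0) (rev [n..<2 * n]) [1..<Suc (Suc m)] \<psi> \<sigma> = column ?v ?C ?G \<sigma>"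
  proof -
    have "[1..<Suc (Suc m)] = [1..<Suc m] @ [Suc m]" by simp
    then show ?thesis by (simp only: grid_append grid_Cons grid_Nil rows_core[OF n])
  qed
  also have "\<dots> = column ?v ?C ?\<Phi> \<sigma>"
  proof (rule column_cong_on[of "?A"])
    show "?G \<tau> = ?\<Phi> \<tau>" if "\<tau> \<in> ?A" for \<tau>
      using Suc.IH[of \<tau>] that by simp
    show "\<tau>(r := a, ?v := b) \<in> ?A"
      if "r \<in> fst ` set ?C" "\<tau> \<in> ?A" for \<tau> r a b
    proof -
      have "r \<noteq> V x" for x using that(1) n by (auto simp: image_Un fst_core)
      then show ?thesis using that(2) by auto
    qed
  qed (use Suc.prems in auto)
  also have "\<dots> = column ?v (map (\<lambda>l. (l, diag_weight)) [D n]) (column ?v (core n) ?\<Phi>) \<sigma>"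
    by simp
  also have "\<dots> = 1 ^ length [D n] * column ?v (core n) ?\<Phi> \<sigma>"
  proof (rule column_frozen_bottom)
    fix \<tau> l assume l: "l \<in> set [D n]" "\<tau> l"
    show "column ?v (core n) ?\<Phi> \<tau> = 0"
    proof (rule column_zero_on[of "{\<tau>. \<tau> (D n)}"])
      show "?\<Phi> \<tau> = 0" if "\<tau> \<in> {\<tau>. \<tau> (D n)}" for \<tau>
        using that n D by (intro core_grid_vanish[of "D n"]) (auto simp: fst_core)
    qed (use l n in \<open>auto simp: fst_core\<close>)
  qed (use Suc.prems in auto)
  finally show ?case by simp
qed simp

definition initial20 :: "nat \<Rightarrow> line state" where
  "initial20 n \<sigma> = of_bool ((\<forall>y. 1 \<le> y \<and> y < 2 * n \<longrightarrow> \<sigma> (H y) = (n \<le> y)) \<and>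
     (\<forall>c. n + 1 \<le> c \<and> c < 3 * n \<longrightarrow> \<not> \<sigma> (D c)) \<and> (\<forall>x. 1 \<le> x \<and> x \<le> n \<longrightarrow> \<not> \<sigma> (V x)))"

theorem all_col20_det:
  assumes n: "1 \<le> n"
  shows "all_col20 n n (initial20 n) final = det (mat n n (\<lambda>(l, k). coeff (num_poly n k) l))"
proof -
  define m where "m = (\<Sum>i<n. i)"
  let ?ys = "rev [n..<2 * n]" and ?xs = "[1..<Suc n]"
  let ?I = "initial (\<lambda>_. (1, 0)) ?ys ?xs"
  have "2 ^ (\<Sum>x<n. n + x) * all_col20 n n (initial20 n) final = sqrt 2 ^ (\<Sum>x<n. n + x) * all_pulled n n (initial20 n) final"
    using fun_cong[OF all_col20_eq[of n n "initial20 n"], of final] by (simp add: all_crossings_final)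
  also have "all_pulled n n (initial20 n) final = sqrt 2 ^ (n\<^sup>2) * core_grid n n (initial20 n) final"
    using n by (intro all_pulled_core) (auto simp: initial20_def)
  \<comment> \<open>The two initial states agree only where the lines outside the core and
    \<open>D n\<close> are empty: \<open>?I\<close> ignores the former and \<open>initial20\<close>
    ignores the latter. The core touches none of them, so \<open>final\<close> stays within this
    set.\<close>
  also have "core_grid n n (initial20 n) final = core_grid n n ?I final"
  proof (rule core_grid_cong_on[of "{\<sigma>. (\<forall>c\<ge>2 * n. \<not> \<sigma> (D c)) \<and> (\<forall>y<n. \<not> \<sigma> (H y)) \<and> \<not> \<sigma> (D n)}"])
    fix \<sigma> assume \<sigma>: "\<sigma> \<in> {\<sigma>. (\<forall>c\<ge>2 * n. \<not> \<sigma> (D c)) \<and> (\<forall>y<n. \<not> \<sigma> (H y)) \<and> \<not> \<sigma> (D n)}"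
    have pb: "(\<Prod>z\<leftarrow>zs. of_bool (Q z)) = (of_bool (\<forall>z\<in>set zs. Q z) :: real)" for zs :: "nat list" and Q
      by (induction zs) auto
    have ut: "uturn (1, 0) h d = of_bool (h \<and> \<not> d)" for h d by (simp add: uturn_def)
    have D': "(\<forall>c. n + 1 \<le> c \<and> c < 3 * n \<longrightarrow> \<not> \<sigma> (D c)) \<longleftrightarrow> (\<forall>y\<in>{n..<2 * n}. \<not> \<sigma> (D y))"
    proof safe
      fix y assume y: "\<forall>c. n + 1 \<le> c \<and> c < 3 * n \<longrightarrow> \<not> \<sigma> (D c)" "y \<in> {n..<2 * n}" "\<sigma> (D y)"
      then have "y \<noteq> n" using \<sigma> by auto
      then show False using y by auto
    next
      fix c assume c: "\<forall>y\<in>{n..<2 * n}. \<not> \<sigma> (D y)" "n + 1 \<le> c" "\<sigma> (D c)"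
      then have "\<not> c < 2 * n" by auto
      then show False using \<sigma> c(3) by auto
    qed
    have H': "(\<forall>y. 1 \<le> y \<and> y < 2 * n \<longrightarrow> \<sigma> (H y) = (n \<le> y)) \<longleftrightarrow> (\<forall>y\<in>{n..<2 * n}. \<sigma> (H y))"
      using \<sigma> n by (auto intro: leI)
    have V': "(\<forall>x. 1 \<le> x \<and> x \<le> n \<longrightarrow> \<not> \<sigma> (V x)) \<longleftrightarrow> (\<forall>x\<in>{1..<Suc n}. \<not> \<sigma> (V x))" by auto
    show "initial20 n \<sigma> = ?I \<sigma>"
      unfolding initial20_def initial_def ut pb D' H' V' by (auto simp del: upt_Suc)
  qed (use n in \<open>auto simp: fst_core\<close>)
  also have "core_grid n n ?I final = uz (\<lambda>_. 0) (\<lambda>_. 0) ?ys ?xs"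
    unfolding uz_def uturn_Z_def
  proof (rule grid_core[OF n, symmetric])
    fix \<sigma> assume "\<sigma> (D n)"
    moreover have "n \<in> set ?ys" using n by simp
    ultimately show "?I \<sigma> = 0"
      unfolding initial_def by (auto simp: prod_list_zero_iff uturn_def image_iff simp del: upt_Suc)
  qed simp
  also have "\<dots> = sqrt 2 ^ m * det (mat n n (\<lambda>(l, k). coeff (num_poly n k) l))"
    unfolding m_def by (intro uz_homogeneous) auto
  finally have "2 ^ (\<Sum>x<n. n + x) * all_col20 n n (initial20 n) final =
      sqrt 2 ^ (\<Sum>x<n. n + x) * (sqrt 2 ^ (n\<^sup>2) * (sqrt 2 ^ m * det (mat n n (\<lambda>(l, k). coeff (num_poly n k) l))))" .
  also have "\<dots> = sqrt 2 ^ ((\<Sum>x<n. n + x) + (n\<^sup>2 + m)) * det (mat n n (\<lambda>(l, k). coeff (num_poly n k) l))"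
    by (simp add: power_add)
  \<comment> \<open>With \<open>M = (\<Sum>x<n. n + x)\<close>, the crossings give the exponent
    \<open>M\<close> of \<open>sqrt 2\<close>, the rows outside the core \<open>n\<^sup>2\<close>
    and the U-turn model \<open>m\<close>. Together this is \<open>2 * M\<close>, matching the
    factor 2 for each of the \<open>M\<close> vertices.\<close>
  also have "n\<^sup>2 + m = (\<Sum>x<n. n + x)"
    by (simp add: m_def sum.distrib power2_eq_square)
  also have "sqrt 2 ^ ((\<Sum>x<n. n + x) + (\<Sum>x<n. n + x)) = (2 :: real) ^ (\<Sum>x<n. n + x)"
    by (simp add: power_add flip: power_mult_distrib)
  finally show ?thesis by simp
qed

section \<open>Counting configurations line by line\<close>

lemma card_split_bool:
  fixes f :: "'a \<Rightarrow> bool"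
  assumes "finite Q"
  shows "real (card Q) = (\<Sum>a\<in>UNIV. real (card {S \<in> Q. f S = a}))"
proof -
  have "Q = {S \<in> Q. f S = False} \<union> {S \<in> Q. f S = True}" by auto
  moreover have "card ({S \<in> Q. f S = False} \<union> {S \<in> Q. f S = True}) =
      card {S \<in> Q. f S = False} + card {S \<in> Q. f S = True}"
    using assms by (intro card_Un_disjoint) auto
  ultimately show ?thesis by (simp add: UNIV_bool)
qed

lemma card_Int_triple:
  assumes "distinct [a, b, c]"
  shows "card (S \<inter> {a, b, c}) = of_bool (a \<in> S) + of_bool (b \<in> S) + of_bool (c \<in> S)"
  using assms by (cases "a \<in> S"; cases "b \<in> S"; cases "c \<in> S") (auto simp: Int_insert_right)

text \<open>One step of a transfer matrix: \<open>C\<close> is a set of partial configurations on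
  the edges \<open>E\<close>, and a vertex with three new edges is attached.\<close>

lemma count_vertex:
  fixes frontier cur' :: "'l \<Rightarrow> 'e" and C :: "'e set set"
  assumes "finite E" "C \<subseteq> Pow E" and hdv: "h \<in> L" "d \<in> L" "v \<in> L" "distinct [h, d, v]"
    and frontier: "\<And>l. l \<in> L \<Longrightarrow> frontier l \<in> E" "distinct [frontier h, frontier d, frontier v]"
    and out: "distinct [cur' h, cur' d, cur' v]" "cur' h \<notin> E" "cur' d \<notin> E" "cur' v \<notin> E"
    and same: "\<And>l. l \<in> L \<Longrightarrow> l \<notin> {h, d, v} \<Longrightarrow> cur' l = frontier l"
  defines "C' \<equiv> {S. S \<subseteq> E \<union> {cur' h, cur' d, cur' v} \<and> S \<inter> E \<in> C \<and>
      card (S \<inter> {frontier h, frontier d, frontier v}) = card (S \<inter> {cur' h, cur' d, cur' v})}"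
  shows "real (card {S \<in> C'. \<forall>l\<in>L. (cur' l \<in> S) = \<sigma> l}) =
    tri h d v (\<lambda>\<sigma>. real (card {S \<in> C. \<forall>l\<in>L. (frontier l \<in> S) = \<sigma> l})) \<sigma>"
proof -
  define k where "k = (of_bool (\<sigma> h) + of_bool (\<sigma> d) + of_bool (\<sigma> v) :: nat)"
  \<comment> \<open>Since \<open>\<sigma>\<close> prescribes the three new edges, the members of
    \<open>Q\<close> are the partial configurations that extend, each in exactly one way, by
    \<open>O'\<close>. Splitting \<open>Q\<close> by its incoming occupations then gives
    \<open>tri\<close>.\<close>
  define Q where "Q = {S \<in> C. (\<forall>l\<in>L - {h, d, v}. (frontier l \<in> S) = \<sigma> l) \<and>
      of_bool (frontier h \<in> S) + of_bool (frontier d \<in> S) + of_bool (frontier v \<in> S) = k}"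
  define O' where "O' = {e. (e = cur' h \<and> \<sigma> h) \<or> (e = cur' d \<and> \<sigma> d) \<or> (e = cur' v \<and> \<sigma> v)}"
  have O': "O' \<inter> E = {}" "O' \<subseteq> {cur' h, cur' d, cur' v}" using out by (auto simp: O'_def)
  have O'k: "card O' = k"
  proof -
    have "O' = O' \<inter> {cur' h, cur' d, cur' v}" using O' by auto
    then have "card O' = of_bool (cur' h \<in> O') + of_bool (cur' d \<in> O') + of_bool (cur' v \<in> O')"
      using card_Int_triple[OF out(1), of O'] by simp
    then show ?thesis using out(1) by (auto simp: O'_def k_def)
  qed
  have "bij_betw (\<lambda>S. S \<union> O') Q {S \<in> C'. \<forall>l\<in>L. (cur' l \<in> S) = \<sigma> l}"
  proof (rule bij_betw_byWitness[where f' = "\<lambda>S. S \<inter> E"])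
    show "\<forall>S\<in>Q. (S \<union> O') \<inter> E = S" using O' assms(2) by (auto simp: Q_def)
    have restore: "S = (S \<inter> E) \<union> O'" if S: "S \<subseteq> E \<union> {cur' h, cur' d, cur' v}" "\<forall>l\<in>L. (cur' l \<in> S) = \<sigma> l" for S
    proof -
      have "(cur' h \<in> S) = \<sigma> h" "(cur' d \<in> S) = \<sigma> d" "(cur' v \<in> S) = \<sigma> v" using S hdv by auto
      then show ?thesis using S(1) unfolding O'_def by auto
    qed
    then show "\<forall>S\<in>{S \<in> C'. \<forall>l\<in>L. (cur' l \<in> S) = \<sigma> l}. S \<inter> E \<union> O' = S" by (auto simp: C'_def)
    show "(\<lambda>S. S \<union> O') ` Q \<subseteq> {S \<in> C'. \<forall>l\<in>L. (cur' l \<in> S) = \<sigma> l}"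
    proof (rule image_subsetI, intro CollectI conjI ballI)
      fix S assume S: "S \<in> Q"
      then have SE: "S \<subseteq> E" using assms(2) by (auto simp: Q_def)
      have "(S \<union> O') \<inter> {cur' h, cur' d, cur' v} = O'" using SE out O' by auto
      moreover have "(S \<union> O') \<inter> {frontier h, frontier d, frontier v} = S \<inter> {frontier h, frontier d, frontier v}"
        using O' frontier(1) hdv by auto
      ultimately have "card ((S \<union> O') \<inter> {frontier h, frontier d, frontier v}) = card ((S \<union> O') \<inter> {cur' h, cur' d, cur' v})"
        using S O'k by (simp add: card_Int_triple[OF frontier(2)] Q_def)
      moreover have "(S \<union> O') \<inter> E = S" using SE O' by auto
      ultimately show "S \<union> O' \<in> C'" using SE O' S by (auto simp: C'_def Q_def)
      fix l assume l: "l \<in> L"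
      show "(cur' l \<in> S \<union> O') = \<sigma> l"
      proof (cases "l \<in> {h, d, v}")
        case True
        then show ?thesis using SE out by (auto simp: O'_def)
      next
        case False
        then have "cur' l = frontier l" "frontier l \<notin> O'" "(frontier l \<in> S) = \<sigma> l"
          using same[OF l] frontier(1)[OF l] O' S l by (auto simp: Q_def)
        then show ?thesis by auto
      qed
    qed
    show "(\<lambda>S. S \<inter> E) ` {S \<in> C'. \<forall>l\<in>L. (cur' l \<in> S) = \<sigma> l} \<subseteq> Q"
    proof (rule image_subsetI)
      fix S assume "S \<in> {S \<in> C'. \<forall>l\<in>L. (cur' l \<in> S) = \<sigma> l}"
      then have S: "S \<subseteq> E \<union> {cur' h, cur' d, cur' v}" "S \<inter> E \<in> C"
        "card (S \<inter> {frontier h, frontier d, frontier v}) = card (S \<inter> {cur' h, cur' d, cur' v})"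
        "\<forall>l\<in>L. (cur' l \<in> S) = \<sigma> l" by (auto simp: C'_def)
      have ch: "frontier h \<in> E" "frontier d \<in> E" "frontier v \<in> E" using frontier(1) hdv by auto
      have "of_bool (frontier h \<in> S \<inter> E) + of_bool (frontier d \<in> S \<inter> E) + of_bool (frontier v \<in> S \<inter> E) = k"
        using S(3,4) hdv ch unfolding card_Int_triple[OF frontier(2)] card_Int_triple[OF out(1)] k_def by auto
      moreover have "(frontier l \<in> S \<inter> E) = \<sigma> l" if "l \<in> L - {h, d, v}" for l
      proof -
        have l: "l \<in> L" "l \<notin> {h, d, v}" using that by auto
        have "(cur' l \<in> S) = \<sigma> l" using S(4) l(1) by (rule bspec)
        then show ?thesis using same[OF l] frontier(1)[OF l(1)] by simp
      qed
      ultimately show "S \<inter> E \<in> Q" using S(2) by (auto simp: Q_def)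
    qed
  qed
  then have "real (card {S \<in> C'. \<forall>l\<in>L. (cur' l \<in> S) = \<sigma> l}) = real (card Q)"
    by (simp add: bij_betw_same_card)
  also have "finite C" using assms(1,2) by (meson finite_Pow_iff finite_subset)
  then have fin: "finite Q" by (simp add: Q_def)
  have "real (card Q) = (\<Sum>a\<in>UNIV. \<Sum>b\<in>UNIV. \<Sum>c\<in>UNIV.
      real (card {S \<in> {S \<in> {S \<in> Q. (frontier h \<in> S) = a}. (frontier d \<in> S) = b}. (frontier v \<in> S) = c}))"
  proof -
    note split = card_split_bool[where f = "\<lambda>S. _ \<in> S"]
    have "real (card Q) = (\<Sum>a\<in>UNIV. real (card {S \<in> Q. (frontier h \<in> S) = a}))"
      using fin by (rule split)
    also have "\<dots> = (\<Sum>a\<in>UNIV. \<Sum>b\<in>UNIV. real (card {S \<in> {S \<in> Q. (frontier h \<in> S) = a}. (frontier d \<in> S) = b}))"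
      by (intro sum.cong refl split) (simp add: fin)
    also have "\<dots> = (\<Sum>a\<in>UNIV. \<Sum>b\<in>UNIV. \<Sum>c\<in>UNIV.
      real (card {S \<in> {S \<in> {S \<in> Q. (frontier h \<in> S) = a}. (frontier d \<in> S) = b}. (frontier v \<in> S) = c}))"
      by (intro sum.cong refl split) (simp add: fin)
    finally show ?thesis .
  qed
  also have "\<dots> = tri h d v (\<lambda>\<sigma>. real (card {S \<in> C. \<forall>l\<in>L. (frontier l \<in> S) = \<sigma> l})) \<sigma>"
    unfolding tri_def
  proof (intro sum.cong refl)
    fix a b c
    have "{S \<in> {S \<in> {S \<in> Q. (frontier h \<in> S) = a}. (frontier d \<in> S) = b}. (frontier v \<in> S) = c} =
      (if of_bool a + of_bool b + of_bool c = k then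
       {S \<in> C. \<forall>l\<in>L. (frontier l \<in> S) = (\<sigma>(h := a, d := b, v := c)) l} else {})"
    proof -
      have "(\<forall>l\<in>L. (frontier l \<in> S) = (\<sigma>(h := a, d := b, v := c)) l) \<longleftrightarrow>
        (\<forall>l\<in>L - {h, d, v}. (frontier l \<in> S) = \<sigma> l) \<and> (frontier h \<in> S) = a \<and> (frontier d \<in> S) = b \<and> (frontier v \<in> S) = c" for S
        using hdv by auto
      then show ?thesis unfolding Q_def by auto
    qed
    then show "real (card {S \<in> {S \<in> {S \<in> Q. (frontier h \<in> S) = a}. (frontier d \<in> S) = b}. (frontier v \<in> S) = c}) =
      (if of_bool a + of_bool b + of_bool c = (of_bool (\<sigma> h) + of_bool (\<sigma> d) + of_bool (\<sigma> v) :: nat)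
       then real (card {S \<in> C. \<forall>l\<in>L. (frontier l \<in> S) = (\<sigma>(h := a, d := b, v := c)) l}) else 0)"
      by (simp add: k_def)
  qed
  finally show ?thesis .
qed

section \<open>The frontier of a sweep through the quadrangle\<close>

definition lines20 :: "nat \<Rightarrow> line set" where
  "lines20 n = H ` {1..<2 * n} \<union> D ` {n + 1..<3 * n} \<union> V ` {1..n}"

text \<open>\<open>frontier n x b l\<close> is the frontier edge of the line \<open>l\<close> once the columns before \<open>x\<close> and the
  vertices \<open>(x, y)\<close> with \<open>b \<le> y\<close> have been processed.\<close>

definition frontier :: "nat \<Rightarrow> nat \<Rightarrow> nat \<Rightarrow> line \<Rightarrow> edge" where
  "frontier n x b l = (case l of
     H y \<Rightarrow> (let X = max (if b \<le> y then x + 1 else x) (n + 1 - y) in ((int X - 1, int y), (int X, int y)))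
   | D c \<Rightarrow> (let X = max (if x + b \<le> c then x + 1 else x) (c + 1 - 2 * n) in
       ((int X - 1, int c - int X + 1), (int X, int c - int X)))
   | V z \<Rightarrow> (let Y = (if z < x then n + 1 - z else if z = x then b else 2 * n) in
       ((int z, int Y), (int z, int Y - 1))))"

lemma cur_step:
  assumes "n + 1 - x \<le> b" "b < 2 * n" "1 \<le> x" "x \<le> n"
  shows "frontier n x (Suc b) (H b) = ((int x - 1, int b), (int x, int b))"
    "frontier n x (Suc b) (D (x + b)) = ((int x - 1, int b + 1), (int x, int b))"
    "frontier n x (Suc b) (V x) = ((int x, int b + 1), (int x, int b))"
    "frontier n x b (H b) = ((int x, int b), (int x + 1, int b))"
    "frontier n x b (D (x + b)) = ((int x, int b), (int x + 1, int b - 1))"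
    "frontier n x b (V x) = ((int x, int b), (int x, int b - 1))"
    "l \<notin> {H b, D (x + b), V x} \<Longrightarrow> frontier n x b l = frontier n x (Suc b) l"
  using assms by (auto simp: frontier_def Let_def max_def split: line.splits)

text \<open>\<open>n + 1 - x\<close> is the lowest row of column \<open>x\<close>. Lines that have
  not yet entered the quadrangle keep their entry edge through the maxima in
  \<open>frontier\<close>.\<close>

lemma cur_next_column:
  assumes "l \<in> lines20 n" "1 \<le> x" "x \<le> n"
  shows "frontier n (Suc x) (2 * n) l = frontier n x (n + 1 - x) l"
  using assms by (auto simp: lines20_def frontier_def Let_def max_def)

definition processed :: "nat \<Rightarrow> nat \<Rightarrow> nat \<Rightarrow> point set" where
  "processed n x b = {p \<in> quadrangle n. fst p < int x \<or> (fst p = int x \<and> int b \<le> snd p)}"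

definition start_edges :: "nat \<Rightarrow> edge set" where
  "start_edges n = frontier n 1 (2 * n) ` lines20 n"

definition known_edges :: "nat \<Rightarrow> nat \<Rightarrow> nat \<Rightarrow> edge set" where
  "known_edges n x b = start_edges n \<union> (\<Union>p\<in>processed n x b. out_edges p)"

text \<open>Only the entry edges carry boundary data; the exit edges stay free until the frontier is
  compared with \<open>final\<close>.\<close>

definition partial_configs :: "nat \<Rightarrow> nat \<Rightarrow> nat \<Rightarrow> edge set set" where
  "partial_configs n x b = {S. S \<subseteq> known_edges n x b \<and> S \<inter> start_edges n = frontier n 1 (2 * n) ` H ` {n..<2 * n} \<and>
     (\<forall>p\<in>processed n x b. card (S \<inter> in_edges p) = card (S \<inter> out_edges p))}"

definition weight_at :: "nat \<Rightarrow> nat \<Rightarrow> nat \<Rightarrow> line state" where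
  "weight_at n x b \<sigma> = real (card {S \<in> partial_configs n x b. \<forall>l\<in>lines20 n. (frontier n x b l \<in> S) = \<sigma> l})"

lemma fst_out_edges: "e \<in> out_edges p \<Longrightarrow> fst e = p"
  by (cases p) auto

lemma start_edges_cases:
  assumes "e \<in> start_edges n" "1 \<le> n"
  obtains y where "1 \<le> y" "y < n" "e = ((int n - int y, int y), (int n - int y + 1, int y))"
  | y where "n \<le> y" "y < 2 * n" "e = ((0, int y), (1, int y))"
  | c where "n + 1 \<le> c" "c \<le> 2 * n" "e = ((0, int c), (1, int c - 1))"
  | c where "2 * n < c" "c < 3 * n" "e = ((int c - 2 * int n, 2 * int n), (int c - 2 * int n + 1, 2 * int n - 1))"
  | z where "1 \<le> z" "z \<le> n" "e = ((int z, 2 * int n), (int z, 2 * int n - 1))"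
proof -
  have H: "frontier n 1 (2 * n) (H y) = (if y < n then ((int n - int y, int y), (int n - int y + 1, int y)) else ((0, int y), (1, int y)))"
    if "y < 2 * n" for y using that by (auto simp: frontier_def Let_def max_def of_nat_diff)
  have D: "frontier n 1 (2 * n) (D c) = (if c \<le> 2 * n then ((0, int c), (1, int c - 1))
      else ((int c - 2 * int n, 2 * int n), (int c - 2 * int n + 1, 2 * int n - 1)))" for c
    by (auto simp: frontier_def Let_def max_def of_nat_diff)
  have V: "frontier n 1 (2 * n) (V z) = ((int z, 2 * int n), (int z, 2 * int n - 1))" if "1 \<le> z" for z
    using that by (auto simp: frontier_def Let_def)
  from assms(1) consider y where "1 \<le> y" "y < 2 * n" "e = frontier n 1 (2 * n) (H y)"
    | c where "n + 1 \<le> c" "c < 3 * n" "e = frontier n 1 (2 * n) (D c)"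
    | z where "1 \<le> z" "z \<le> n" "e = frontier n 1 (2 * n) (V z)"
    by (auto simp: start_edges_def lines20_def)
  then show thesis
  proof cases
    case 1
    then show thesis using that(1,2)[of y] H[of y] by (cases "y < n") auto
  next
    case 2
    then show thesis using that(3,4)[of c] D[of c] by (cases "c \<le> 2 * n") auto
  next
    case 3
    then show thesis using that(5)[of z] V[of z] by auto
  qed
qed

lemma start_edges_outside:
  assumes "e \<in> start_edges n" "1 \<le> n"
  shows "fst e \<notin> quadrangle n" "snd e \<in> quadrangle n" "e \<in> in_edges (snd e)"
  using assms by (cases rule: start_edges_cases; auto simp: quadrangle_def)+

lemma finite_quadrangle: "finite (quadrangle n)"
proof -
  have "quadrangle n \<subseteq> {1..int n} \<times> {1..2 * int n - 1}" by (auto simp: quadrangle_def)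
  then show ?thesis by (rule finite_subset) simp
qed

lemma finite_known_edges: "finite (known_edges n x b)"
proof -
  have "finite (out_edges p)" for p by (cases p) auto
  moreover have "finite (processed n x b)" using finite_quadrangle by (simp add: processed_def)
  ultimately show ?thesis by (auto simp: known_edges_def start_edges_def lines20_def)
qed

lemma processed_step:
  assumes "n + 1 - x \<le> b" "b < 2 * n" "1 \<le> b" "1 \<le> x" "x \<le> n"
  shows "processed n x b = insert (int x, int b) (processed n x (Suc b))" "(int x, int b) \<notin> processed n x (Suc b)"
    "(int x, int b) \<in> quadrangle n"
  using assms by (auto simp: processed_def quadrangle_def prod_eq_iff)

lemma cur_known:
  assumes "l \<in> lines20 n" "1 \<le> x" "x \<le> n" "n + 1 - x \<le> b" "b \<le> 2 * n"
  shows "frontier n x b l \<in> known_edges n x b"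
proof (cases "frontier n x b l = frontier n 1 (2 * n) l")
  case True
  then show ?thesis using assms(1) by (auto simp: known_edges_def start_edges_def)
next
  case False
  then have "fst (frontier n x b l) \<in> processed n x b \<and> frontier n x b l \<in> out_edges (fst (frontier n x b l))"
    using assms by (auto simp: lines20_def frontier_def Let_def processed_def quadrangle_def max_def split: if_splits)
  then show ?thesis by (auto simp: known_edges_def)
qed

text \<open>The incoming edges of a vertex are the frontier edges of its three lines just before it
  is processed. Hence the conditions at old vertices do not see new edges.\<close>

lemma in_edges_known:
  assumes "p \<in> processed n x b" "1 \<le> x" "x \<le> n" "n + 1 - x \<le> b" "b \<le> 2 * n"
  shows "in_edges p \<subseteq> known_edges n x b"
proof -
  obtain z y where zy: "p = (int z, int y)" "1 \<le> z" "z \<le> n" "n + 1 - z \<le> y" "y < 2 * n" "1 \<le> y" "z < x \<or> (z = x \<and> b \<le> y)"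
  proof
    show "p = (int (nat (fst p)), int (nat (snd p)))" "1 \<le> nat (fst p)" "nat (fst p) \<le> n" "n + 1 - nat (fst p) \<le> nat (snd p)"
      "nat (snd p) < 2 * n" "1 \<le> nat (snd p)" "nat (fst p) < x \<or> (nat (fst p) = x \<and> b \<le> nat (snd p))"
      using assms(1) by (auto simp: processed_def quadrangle_def prod_eq_iff)
  qed
  have L: "H y \<in> lines20 n" "D (z + y) \<in> lines20 n" "V z \<in> lines20 n"
    using zy by (auto simp: lines20_def)
  have sub: "known_edges n z (Suc y) \<subseteq> known_edges n x b"
    using zy(7) by (auto simp: known_edges_def processed_def)
  have "{frontier n z (Suc y) (H y), frontier n z (Suc y) (V z), frontier n z (Suc y) (D (z + y))} \<subseteq> known_edges n z (Suc y)"
    using L zy by (auto intro!: cur_known)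
  moreover have "in_edges p = {frontier n z (Suc y) (H y), frontier n z (Suc y) (V z), frontier n z (Suc y) (D (z + y))}"
    unfolding zy(1) cur_step(1-3)[OF zy(4,5,2,3)] by auto
  ultimately show ?thesis using sub by blast
qed

lemma count_step:
  assumes "1 \<le> x" "x \<le> n" "n + 1 - x \<le> b" "b < 2 * n"
  shows "weight_at n x b = tri (H b) (D (x + b)) (V x) (weight_at n x (Suc b))"
proof
  fix \<sigma>
  have b: "1 \<le> b" using assms by simp
  define p where "p = (int x, int b)"
  note ps = processed_step[OF assms(3,4) b assms(1,2), folded p_def]
  note cs = cur_step[OF assms(3,4,1,2)]
  let ?E = "known_edges n x (Suc b)"
  have out: "out_edges p = {frontier n x b (H b), frontier n x b (D (x + b)), frontier n x b (V x)}"
    unfolding p_def cs by auto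
  have inp: "in_edges p = {frontier n x (Suc b) (H b), frontier n x (Suc b) (D (x + b)), frontier n x (Suc b) (V x)}"
    unfolding p_def cs by auto
  \<comment> \<open>Known edges start outside the quadrangle or at a processed vertex, and
    \<open>p\<close> is neither.\<close>
  have fresh: "e \<notin> ?E" if "fst e = p" for e
  proof
    assume "e \<in> ?E"
    then consider "e \<in> start_edges n" | q where "q \<in> processed n x (Suc b)" "e \<in> out_edges q"
      unfolding known_edges_def by blast
    then show False
    proof cases
      case 1
      then have "p \<notin> quadrangle n" using start_edges_outside(1)[OF 1] that assms by simp
      then show False using ps(3) by simp
    next
      case 2
      then show False using fst_out_edges[OF 2(2)] that ps(2) by simp
    qed
  qed
  have E: "known_edges n x b = ?E \<union> out_edges p" unfolding known_edges_def ps(1) by auto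
  have pc: "partial_configs n x b = {S. S \<subseteq> ?E \<union> out_edges p \<and>
      S \<inter> ?E \<in> partial_configs n x (Suc b) \<and> card (S \<inter> in_edges p) = card (S \<inter> out_edges p)}"
  proof -
    have 1: "S \<inter> ?E \<inter> start_edges n = S \<inter> start_edges n" for S by (auto simp: known_edges_def)
    have 2: "S \<inter> ?E \<inter> in_edges q = S \<inter> in_edges q" "S \<inter> ?E \<inter> out_edges q = S \<inter> out_edges q"
      if "q \<in> processed n x (Suc b)" for S q
      using in_edges_known[OF that assms(1,2)] that assms by (auto simp: known_edges_def)
    have 3: "(\<forall>q\<in>processed n x (Suc b). card (S \<inter> ?E \<inter> in_edges q) = card (S \<inter> ?E \<inter> out_edges q)) \<longleftrightarrow>
        (\<forall>q\<in>processed n x (Suc b). card (S \<inter> in_edges q) = card (S \<inter> out_edges q))" for S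
      by (intro ball_cong refl) (simp only: 2)
    show ?thesis
      unfolding partial_configs_def E ps(1) mem_Collect_eq 1 3 ball_simps(7)
      by (intro Collect_cong) blast
  qed
  show "weight_at n x b \<sigma> = tri (H b) (D (x + b)) (V x) (weight_at n x (Suc b)) \<sigma>"
    unfolding weight_at_def[abs_def] pc inp out
  proof (rule count_vertex)
    show "finite ?E" by (rule finite_known_edges)
    show "partial_configs n x (Suc b) \<subseteq> Pow ?E" by (auto simp: partial_configs_def)
    show "H b \<in> lines20 n" "D (x + b) \<in> lines20 n" "V x \<in> lines20 n"
      using assms b by (auto simp: lines20_def)
    show "frontier n x (Suc b) l \<in> ?E" if "l \<in> lines20 n" for l
      using that assms by (intro cur_known) auto
    show "frontier n x b (H b) \<notin> ?E" "frontier n x b (D (x + b)) \<notin> ?E" "frontier n x b (V x) \<notin> ?E"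
      by (intro fresh; simp add: cs p_def)+
  qed (use cs(7) in \<open>auto simp: cs(1-6)\<close>)
qed

lemma count_column:
  assumes "1 \<le> x" "x \<le> n" "n + 1 - x \<le> b" "b \<le> 2 * n"
  shows "weight_at n x b = col20 x (rev [b..<2 * n]) (weight_at n x (2 * n))"
  using assms(4,3)
proof (induction b rule: inc_induct)
  case (step b)
  then have "weight_at n x b = tri (H b) (D (x + b)) (V x) (weight_at n x (Suc b))"
    using assms by (intro count_step) auto
  also have "weight_at n x (Suc b) = col20 x (rev [Suc b..<2 * n]) (weight_at n x (2 * n))"
    using step by simp
  also have "tri (H b) (D (x + b)) (V x) \<dots> = col20 x (rev [Suc b..<2 * n] @ [b]) (weight_at n x (2 * n))"
    by (simp add: col20_def)
  also have "rev [Suc b..<2 * n] @ [b] = rev [b..<2 * n]" using step by (simp add: upt_conv_Cons)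
  finally show ?case .
qed simp

lemma count_next_column:
  assumes "1 \<le> x" "x \<le> n"
  shows "weight_at n (Suc x) (2 * n) = weight_at n x (n + 1 - x)"
proof -
  have "processed n (Suc x) (2 * n) = processed n x (n + 1 - x)"
    using assms by (auto simp: processed_def quadrangle_def)
  then have "partial_configs n (Suc x) (2 * n) = partial_configs n x (n + 1 - x)"
    by (simp add: partial_configs_def known_edges_def)
  then show ?thesis using cur_next_column[OF _ assms] by (simp add: weight_at_def fun_eq_iff)
qed

lemma count_all:
  assumes "x \<le> n" "1 \<le> n"
  shows "weight_at n (Suc x) (2 * n) = all_col20 n x (weight_at n 1 (2 * n))"
  using assms(1)
proof (induction x)
  case (Suc x)
  have "weight_at n (Suc (Suc x)) (2 * n) = weight_at n (Suc x) (n + 1 - Suc x)"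
    using Suc.prems by (intro count_next_column) auto
  also have "\<dots> = col20 (Suc x) (rev [n + 1 - Suc x..<2 * n]) (weight_at n (Suc x) (2 * n))"
    using Suc.prems by (intro count_column) auto
  finally show ?case using Suc by simp
qed simp

lemma count_initial:
  assumes "1 \<le> n"
  shows "weight_at n 1 (2 * n) = initial20 n"
proof
  fix \<sigma>
  let ?S = "frontier n 1 (2 * n) ` H ` {n..<2 * n}"
  have "processed n 1 (2 * n) = {}" by (auto simp: processed_def quadrangle_def)
  moreover have "?S \<subseteq> start_edges n" using assms by (auto simp: start_edges_def lines20_def)
  moreover from this have "(T \<subseteq> start_edges n \<and> T \<inter> start_edges n = ?S) \<longleftrightarrow> T = ?S" for T by blast
  ultimately have pc: "partial_configs n 1 (2 * n) = {?S}"
    by (simp add: partial_configs_def known_edges_def)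
  have mem: "frontier n 1 (2 * n) l \<in> ?S \<longleftrightarrow> (\<exists>y. l = H y \<and> n \<le> y)" if "l \<in> lines20 n" for l
    using that assms by (auto simp: lines20_def frontier_def Let_def max_def image_iff split: if_splits)
  have "(\<forall>l\<in>lines20 n. (frontier n 1 (2 * n) l \<in> ?S) = \<sigma> l) \<longleftrightarrow> (\<forall>l\<in>lines20 n. (\<exists>y. l = H y \<and> n \<le> y) = \<sigma> l)"
    using mem by blast
  also have "\<dots> \<longleftrightarrow> ((\<forall>y. 1 \<le> y \<and> y < 2 * n \<longrightarrow> \<sigma> (H y) = (n \<le> y)) \<and>
     (\<forall>c. n + 1 \<le> c \<and> c < 3 * n \<longrightarrow> \<not> \<sigma> (D c)) \<and> (\<forall>x. 1 \<le> x \<and> x \<le> n \<longrightarrow> \<not> \<sigma> (V x)))"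
    by (auto simp: lines20_def)
  finally show "weight_at n 1 (2 * n) \<sigma> = initial20 n \<sigma>"
    unfolding weight_at_def pc initial20_def by (simp add: Collect_conv_if)
qed

text \<open>After the last column all edges are known, and the boundary is the disjoint union of the
  entry edges and the final frontier. The entry condition sits in \<open>partial_configs\<close>,
  the exit condition in the state \<open>final\<close>.\<close>

lemma count_final:
  assumes "1 \<le> n"
  shows "weight_at n (Suc n) (2 * n) final = real (Z_20V n)"
proof -
  let ?fin = "frontier n (Suc n) (2 * n)"
  have pr: "processed n (Suc n) (2 * n) = quadrangle n" by (auto simp: processed_def quadrangle_def)
  have finq: "?fin l = frontier n n 1 l" if "l \<in> lines20 n" for l
    using cur_next_column[OF that assms] by simp
  have start_in: "e \<in> incident_edges n" if "e \<in> start_edges n" for e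
  proof -
    have "snd e \<in> quadrangle n" "e \<in> in_edges (snd e)" using start_edges_outside that assms by auto
    then show ?thesis by (auto simp: incident_edges_def)
  qed
  have finH: "?fin (H y) = ((int n, int y), (int n + 1, int y))" if "1 \<le> y" "y < 2 * n" for y
    using that by (simp add: frontier_def Let_def max_def)
  have finD: "?fin (D c) = ((int n, int c - int n), (int n + 1, int c - int n - 1))" if "n + 1 \<le> c" "c < 3 * n" for c
    using that by (auto simp: frontier_def Let_def max_def)
  have finV: "?fin (V z) = ((int z, int n + 1 - int z), (int z, int n - int z))" if "1 \<le> z" "z \<le> n" for z
    using that by (auto simp: frontier_def Let_def of_nat_diff)
  have fin_out: "fst (?fin l) \<in> quadrangle n \<and> ?fin l \<in> out_edges (fst (?fin l)) \<and> snd (?fin l) \<notin> quadrangle n"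
    if "l \<in> lines20 n" for l
    using that assms by (auto simp: lines20_def finH finD finV quadrangle_def)
  have known: "known_edges n (Suc n) (2 * n) = incident_edges n"
  proof
    show "known_edges n (Suc n) (2 * n) \<subseteq> incident_edges n"
      using start_in by (auto simp: known_edges_def pr incident_edges_def)
    have "processed n n 1 = quadrangle n" by (auto simp: processed_def quadrangle_def)
    then have "in_edges p \<subseteq> known_edges n n 1" if "p \<in> quadrangle n" for p
      using that assms by (intro in_edges_known) auto
    moreover have "known_edges n n 1 = known_edges n (Suc n) (2 * n)"
      unfolding known_edges_def pr \<open>processed n n 1 = quadrangle n\<close> ..
    ultimately show "incident_edges n \<subseteq> known_edges n (Suc n) (2 * n)"
      unfolding incident_edges_def by (auto simp: known_edges_def pr)
  qed
  have outer: "e \<in> ?fin ` lines20 n" if oe: "e \<in> out_edges p" "p \<in> quadrangle n" "snd e \<notin> quadrangle n" for e p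
  proof -
    obtain x y where p: "p = (int x, int y)" "1 \<le> x" "x \<le> n" "1 \<le> y" "y < 2 * n" "n + 1 \<le> x + y"
    proof
      show "p = (int (nat (fst p)), int (nat (snd p)))" "1 \<le> nat (fst p)" "nat (fst p) \<le> n"
        "1 \<le> nat (snd p)" "nat (snd p) < 2 * n" "n + 1 \<le> nat (fst p) + nat (snd p)"
        using oe(2) by (auto simp: quadrangle_def prod_eq_iff)
    qed
    consider "e = ((int x, int y), (int x + 1, int y))" | "e = ((int x, int y), (int x, int y - 1))"
      | "e = ((int x, int y), (int x + 1, int y - 1))"
      using oe(1) p(1) by auto
    then show ?thesis
    proof cases
      case 1
      then have "x = n" using oe(3) p by (auto simp: quadrangle_def)
      then have "e = ?fin (H y)" using 1 p by (simp add: finH)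
      then show ?thesis using p by (auto simp: lines20_def)
    next
      case 2
      then have "y = n + 1 - x" using oe(3) p by (auto simp: quadrangle_def)
      then have "e = ?fin (V x)" using 2 p by (auto simp: finV)
      then show ?thesis using p by (auto simp: lines20_def)
    next
      case 3
      then have "x = n" using oe(3) p by (auto simp: quadrangle_def)
      then have "e = ?fin (D (n + y))" using 3 p by (auto simp: finD)
      then show ?thesis using p by (auto simp: lines20_def)
    qed
  qed
  have boundary: "boundary_edges n = start_edges n \<union> ?fin ` lines20 n"
  proof (intro equalityI subsetI)
    fix e assume e: "e \<in> boundary_edges n"
    then have "e \<in> known_edges n (Suc n) (2 * n)" by (simp add: known boundary_edges_def)
    then consider "e \<in> start_edges n" | p where "p \<in> quadrangle n" "e \<in> out_edges p"
      by (auto simp: known_edges_def pr)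
    then show "e \<in> start_edges n \<union> ?fin ` lines20 n"
    proof cases
      case 2
      then have "snd e \<notin> quadrangle n"
        using e fst_out_edges[OF 2(2)] by (auto simp: boundary_edges_def internal_edges_def)
      then show ?thesis using outer 2 by auto
    qed simp
  next
    fix e assume "e \<in> start_edges n \<union> ?fin ` lines20 n"
    then show "e \<in> boundary_edges n"
    proof
      assume "e \<in> start_edges n"
      then show ?thesis using start_in start_edges_outside[of e n] assms
        by (auto simp: boundary_edges_def internal_edges_def)
    next
      assume "e \<in> ?fin ` lines20 n"
      then show ?thesis using fin_out by (fastforce simp: boundary_edges_def internal_edges_def incident_edges_def)
    qed
  qed
  have disj: "start_edges n \<inter> ?fin ` lines20 n = {}"
    using start_edges_outside assms fin_out by blast
  have occ_start: "dwbc3_occupied n \<inter> start_edges n = frontier n 1 (2 * n) ` H ` {n..<2 * n}"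
  proof (intro equalityI subsetI)
    fix e assume e: "e \<in> dwbc3_occupied n \<inter> start_edges n"
    then have "fst e \<notin> quadrangle n" using start_edges_outside assms by blast
    then obtain y where y: "e = ((0, y), (1, y))" "(1, y) \<in> quadrangle n"
      using e by (auto simp: dwbc3_occupied_def)
    then have "e = frontier n 1 (2 * n) (H (nat y))" "nat y \<in> {n..<2 * n}"
      by (auto simp: frontier_def Let_def quadrangle_def max_def)
    then show "e \<in> frontier n 1 (2 * n) ` H ` {n..<2 * n}" by blast
  next
    fix e assume "e \<in> frontier n 1 (2 * n) ` H ` {n..<2 * n}"
    then obtain y where y: "n \<le> y" "y < 2 * n" "e = frontier n 1 (2 * n) (H y)" by auto
    then have "e = ((0, int y), (1, int y))" "(1, int y) \<in> quadrangle n"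
      using assms by (auto simp: frontier_def Let_def quadrangle_def max_def)
    moreover have "e \<in> start_edges n" using y assms by (auto simp: start_edges_def lines20_def)
    ultimately show "e \<in> dwbc3_occupied n \<inter> start_edges n" by (auto simp: dwbc3_occupied_def)
  qed
  \<comment> \<open>An exit edge starts inside the quadrangle, so it is occupied only as a downward
    edge, that is, on a vertical line.\<close>
  have occ_fin: "?fin l \<in> dwbc3_occupied n \<longleftrightarrow> final l" if "l \<in> lines20 n" for l
  proof -
    have "fst (?fin l) \<in> quadrangle n" "snd (?fin l) \<notin> quadrangle n" using fin_out[OF that] by auto
    moreover have "fst (0, y) < (1::int)" for y :: int by simp
    ultimately have "?fin l \<in> dwbc3_occupied n \<longleftrightarrow> (\<exists>x y. ?fin l = ((x, y), (x, y - 1)))"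
      by (auto simp: dwbc3_occupied_def quadrangle_def)
    also have "\<dots> \<longleftrightarrow> final l"
      using that assms by (auto simp: lines20_def finH finD finV)
    finally show ?thesis .
  qed
  have bd: "S \<inter> boundary_edges n = dwbc3_occupied n \<longleftrightarrow>
      S \<inter> start_edges n = frontier n 1 (2 * n) ` H ` {n..<2 * n} \<and> (\<forall>l\<in>lines20 n. (?fin l \<in> S) = final l)" for S
  proof -
    have gen: "S \<inter> (A \<union> B) = T \<longleftrightarrow> S \<inter> A = T \<inter> A \<and> S \<inter> B = T \<inter> B" if "T \<subseteq> A \<union> B" for A B T :: "edge set"
      using that by blast
    have "S \<inter> boundary_edges n = dwbc3_occupied n \<longleftrightarrow>
      S \<inter> start_edges n = dwbc3_occupied n \<inter> start_edges n \<and>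
      S \<inter> ?fin ` lines20 n = dwbc3_occupied n \<inter> ?fin ` lines20 n"
      using gen[OF dwbc3_occupied_subset_boundary[of n, unfolded boundary]] unfolding boundary .
    also have "S \<inter> ?fin ` lines20 n = dwbc3_occupied n \<inter> ?fin ` lines20 n \<longleftrightarrow> (\<forall>l\<in>lines20 n. (?fin l \<in> S) = final l)"
      using occ_fin by blast
    finally show ?thesis unfolding occ_start .
  qed
  have "{S \<in> partial_configs n (Suc n) (2 * n). \<forall>l\<in>lines20 n. (?fin l \<in> S) = final l} = dwbc3_configurations n"
    unfolding partial_configs_def known pr dwbc3_configurations_def mem_Collect_eq
    by (intro Collect_cong) (simp only: bd conj_ac)
  then show ?thesis by (simp add: weight_at_def Z_20V_def)
qed

theorem Z_20V_det:
  assumes "1 \<le> n"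
  shows "real (Z_20V n) = det (mat n n (\<lambda>(l, k). coeff (num_poly n k) l))"
  using count_final[OF assms] count_all[OF order_refl assms] count_initial[OF assms] all_col20_det[OF assms]
  by simp

section \<open>Coefficients of the generating function\<close>

text \<open>Multiplying all column series by \<open>c\<close> acts on their coefficients by a lower
  triangular Toeplitz matrix with unit diagonal. This absorbs the power of \<open>1 - u\<close>
  contained in \<open>num_poly\<close>.\<close>

lemma toeplitz_det:
  fixes f :: "nat \<Rightarrow> rat fps"
  assumes "fps_nth c 0 = 1"
  shows "det (mat n n (\<lambda>(i, j). fps_nth (c * f j) i)) = det (mat n n (\<lambda>(i, j). fps_nth (f j) i))"
proof -
  define T where "T = mat n n (\<lambda>(l, i). if i \<le> l then fps_nth c (l - i) else 0)"
  let ?F = "mat n n (\<lambda>(i, j). fps_nth (f j) i)"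
  have "mat n n (\<lambda>(i, j). fps_nth (c * f j) i) = T * ?F"
  proof (rule eq_matI)
    fix l j assume "l < dim_row (T * ?F)" "j < dim_col (T * ?F)"
    then have lj: "l < n" "j < n" by (auto simp: T_def)
    have "(T * ?F) $$ (l, j) = (\<Sum>i = 0..<n. (if i \<le> l then fps_nth c (l - i) else 0) * fps_nth (f j) i)"
      using lj by (auto simp: T_def scalar_prod_def intro!: sum.cong)
    also have "\<dots> = (\<Sum>i = 0..l. fps_nth (f j) i * fps_nth c (l - i))"
      using lj by (intro sum.mono_neutral_cong_right) auto
    also have "\<dots> = fps_nth (c * f j) l" by (simp add: fps_mult_nth mult.commute[of c])
    finally show "mat n n (\<lambda>(i, j). fps_nth (c * f j) i) $$ (l, j) = (T * ?F) $$ (l, j)" using lj by simp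
  qed (auto simp: T_def)
  moreover have "det T = prod_list (diag_mat T)"
    by (rule det_lower_triangular[of n]) (auto simp: T_def)
  moreover have "diag_mat T = map (\<lambda>_. 1) [0..<n]" using assms by (auto simp: diag_mat_def T_def)
  ultimately show ?thesis by (simp add: det_mult[of _ n] T_def map_replicate_const)
qed

lemma poly_fps_num_poly:
  assumes "k < n" "\<psi> * (1 - fps_X) = (1 + fps_X :: rat fps)"
  shows "(1 - fps_X) ^ (2 * n) * ((\<psi>\<^sup>2) ^ Suc k - (fps_X\<^sup>2) ^ Suc k) = fps_of_poly (num_poly n k)"
proof -
  have "(1 - fps_X :: rat fps) ^ (2 * n) = (1 - fps_X) ^ (2 * n - 2 * k - 2) * (1 - fps_X) ^ (2 * Suc k)"
    unfolding power_add[symmetric] using assms(1) by (intro arg_cong[where f = "power (1 - fps_X)"]) simp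
  moreover have "(1 - fps_X) ^ (2 * Suc k) * \<psi> ^ (2 * Suc k) = (1 + fps_X :: rat fps) ^ (2 * Suc k)"
    unfolding power_mult_distrib[symmetric] assms(2)[symmetric] by (simp only: mult.commute)
  ultimately have "(1 - fps_X) ^ (2 * n) * \<psi> ^ (2 * Suc k) = (1 - fps_X) ^ (2 * n - 2 * k - 2) * (1 + fps_X) ^ (2 * Suc k)"
    by (simp only: mult.assoc)
  moreover have "fps_of_poly [:1, 1:] = (1 + fps_X :: rat fps)" "fps_of_poly [:1, - 1:] = (1 - fps_X :: rat fps)"
    by (simp_all add: fps_of_poly_linear fps_of_poly_linear')
  then have "fps_of_poly (num_poly n k) =
      (1 - fps_X :: rat fps) ^ (2 * n - 2 * k - 2) * (1 + fps_X) ^ (2 * Suc k) - (1 - fps_X) ^ (2 * n) * fps_X ^ (2 * Suc k)"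
    by (simp only: num_poly_def fps_of_poly_diff fps_of_poly_mult fps_of_poly_power fps_of_poly_monom' mult.commute)
  ultimately show ?thesis by (simp only: right_diff_distrib power_mult[symmetric])
qed

lemma of_rat_coeff_num_poly: "of_rat (coeff (num_poly n k) l) = (coeff (num_poly n k) l :: real)"
proof -
  have h: "map_poly of_rat (p * q) = map_poly of_rat p * (map_poly of_rat q :: real poly)" for p q
    by (rule poly_eqI) (simp add: coeff_map_poly coeff_mult of_rat_sum of_rat_mult)
  have hp: "map_poly of_rat (p ^ m) = (map_poly of_rat p ^ m :: real poly)" for p m
    by (induction m) (simp_all add: h)
  have hd: "map_poly of_rat (p - q) = map_poly of_rat p - (map_poly of_rat q :: real poly)" for p q
    by (rule poly_eqI) (simp add: coeff_map_poly of_rat_diff)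
  have "map_poly of_rat (num_poly n k) = (num_poly n k :: real poly)"
    by (simp add: num_poly_def h hp hd map_poly_pCons map_poly_monom del: mult_Suc_right power_Suc)
  then show ?thesis by (metis coeff_map_poly of_rat_0)
qed

lemma g_20V_partial_fractions:
  "g_20V = ((1 + fps_u) / (1 - fps_u))\<^sup>2 / (1 - fps_v * ((1 + fps_u) / (1 - fps_u))\<^sup>2)
     - fps_u\<^sup>2 / (1 - fps_v * fps_u\<^sup>2)"
proof -
  define a where "a = (1 + fps_u) / (1 - fps_u)"
  define A where "A = a\<^sup>2 / (1 - fps_v * a\<^sup>2)"
  define B where "B = fps_u\<^sup>2 / (1 - fps_v * fps_u\<^sup>2)"
  define den where "den = (1 - fps_u\<^sup>2 * fps_v) * ((1 - fps_u)\<^sup>2 - fps_v * (1 + fps_u)\<^sup>2)"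
  have a: "a * (1 - fps_u) = 1 + fps_u"
    unfolding a_def by (rule fps_fps_divide_times_cancel) (simp add: fps_u_def)
  have A: "A * (1 - fps_v * a\<^sup>2) = a\<^sup>2"
    unfolding A_def by (rule fps_fps_divide_times_cancel) (simp add: fps_v_def)
  have B: "B * (1 - fps_v * fps_u\<^sup>2) = fps_u\<^sup>2"
    unfolding B_def by (rule fps_fps_divide_times_cancel) (simp add: fps_v_def)
  have den: "den = (1 - fps_v * fps_u\<^sup>2) * ((1 - fps_u)\<^sup>2 * (1 - fps_v * a\<^sup>2))"
    unfolding den_def a[symmetric] by (simp add: power2_eq_square algebra_simps)
  \<comment> \<open>Stated with letters so that the products \<open>A * X\<close> and
    \<open>B * Y\<close> stay intact and their defining equations can be inserted.\<close>
  have expand: "(A - B) * (Y * (s * X)) = s * ((A * X) * Y - (B * Y) * X)" for X Y s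
    by (simp add: algebra_simps)
  have "(A - B) * den = (1 - fps_u)\<^sup>2 * ((A * (1 - fps_v * a\<^sup>2)) * (1 - fps_v * fps_u\<^sup>2) - (B * (1 - fps_v * fps_u\<^sup>2)) * (1 - fps_v * a\<^sup>2))"
    unfolding den expand ..
  also have "\<dots> = (a * (1 - fps_u))\<^sup>2 - fps_u\<^sup>2 * (1 - fps_u)\<^sup>2"
    unfolding A B by (simp add: power2_eq_square algebra_simps)
  also have "\<dots> = (1 + fps_u\<^sup>2) * (1 + 2 * fps_u - fps_u\<^sup>2)"
    unfolding a by (simp add: power2_eq_square algebra_simps)
  also have "\<dots> = g_20V * den" unfolding den_def by (rule g_20V_mult_denominator[symmetric])
  finally have "(A - B) * den = g_20V * den" .
  moreover have "den \<noteq> 0"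
  proof
    assume "den = 0"
    then have "fps_nth (fps_nth den 0) 0 = 0" by simp
    then show False by (simp add: den_def fps_u_def fps_v_def power2_eq_square)
  qed
  ultimately show ?thesis by (simp add: A_def B_def a_def)
qed

lemma fps_geometric:
  fixes c :: "rat fps"
  shows "fps_const c / (1 - fps_v * fps_const c) = Abs_fps (\<lambda>j. c ^ Suc j)"
proof -
  have "Abs_fps (\<lambda>j. c ^ Suc j) * (1 - fps_v * fps_const c) = fps_const c"
  proof (rule fps_ext)
    fix j
    show "fps_nth (Abs_fps (\<lambda>j. c ^ Suc j) * (1 - fps_v * fps_const c)) j = fps_nth (fps_const c) j"
      by (cases j) (simp_all add: fps_v_def right_diff_distrib mult.assoc[symmetric] mult.commute[of _ fps_X])
  qed
  moreover have "fps_const c / (1 - fps_v * fps_const c) * (1 - fps_v * fps_const c) = fps_const c"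
    by (rule fps_fps_divide_times_cancel) (simp add: fps_v_def)
  moreover have "1 - fps_v * fps_const c \<noteq> 0"
  proof
    assume "1 - fps_v * fps_const c = 0"
    then have "fps_nth (1 - fps_v * fps_const c) 0 = 0" by simp
    then show False by (simp add: fps_v_def)
  qed
  ultimately show ?thesis by (metis mult_right_cancel)
qed

text \<open>\<open>\<psi>\<close> stands for (1 + u)/(1 - u). Both partial fractions are geometric
  series in \<open>v\<close>, so the coefficient of \<open>v ^ j\<close> is a difference of powers
  with exponent \<open>Suc j\<close>, as in \<open>num_poly\<close> before clearing
  denominators.\<close>

lemma coeff_uv_g_20V:
  assumes "\<psi> * (1 - fps_X) = (1 + fps_X :: rat fps)"
  shows "coeff_uv g_20V i j = fps_nth ((\<psi>\<^sup>2) ^ Suc j - (fps_X\<^sup>2) ^ Suc j) i"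
proof -
  have "fps_const \<psi> * (1 - fps_u) = 1 + fps_u"
    using arg_cong[OF assms, of fps_const] by (simp add: fps_u_def flip: fps_const_mult fps_const_add fps_const_sub)
  moreover have "(1 + fps_u) / (1 - fps_u) * (1 - fps_u) = 1 + fps_u"
    by (rule fps_fps_divide_times_cancel) (simp add: fps_u_def)
  moreover have "1 - fps_u \<noteq> 0"
  proof
    assume "1 - fps_u = 0"
    then have "fps_nth (fps_nth (1 - fps_u) 0) 0 = 0" by simp
    then show False by (simp add: fps_u_def)
  qed
  ultimately have "(1 + fps_u) / (1 - fps_u) = fps_const \<psi>" by (metis mult_right_cancel)
  then have g: "g_20V = fps_const (\<psi>\<^sup>2) / (1 - fps_v * fps_const (\<psi>\<^sup>2)) - fps_const (fps_X\<^sup>2) / (1 - fps_v * fps_const (fps_X\<^sup>2))"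
    using g_20V_partial_fractions by (simp add: fps_u_def fps_const_power)
  show ?thesis unfolding coeff_uv_def g fps_geometric by simp
qed

theorem theorem2p7:
  fixes n :: nat
  assumes "n \<ge> 1"
  shows "rat_of_nat (Z_20V n) = det (mat n n (\<lambda>(i, j). coeff_uv g_20V i j))
    \<and> g_20V = ((1 + fps_u) / (1 - fps_u))\<^sup>2 / (1 - fps_v * ((1 + fps_u) / (1 - fps_u))\<^sup>2)
              - fps_u\<^sup>2 / (1 - fps_v * fps_u\<^sup>2)"
proof
  define \<psi> :: "rat fps" where "\<psi> = (1 + fps_X) * inverse (1 - fps_X)"
  have \<psi>: "\<psi> * (1 - fps_X) = 1 + fps_X"
    by (simp add: \<psi>_def mult.assoc inverse_mult_eq_1)
  define c :: "rat fps" where "c = (1 - fps_X) ^ (2 * n)"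
  have c0: "fps_nth c 0 = 1" by (simp add: c_def fps_power_zeroth)
  have "det (mat n n (\<lambda>(i, j). coeff_uv g_20V i j)) =
      det (mat n n (\<lambda>(i, j). fps_nth (c * ((\<psi>\<^sup>2) ^ Suc j - (fps_X\<^sup>2) ^ Suc j)) i))"
    unfolding toeplitz_det[OF c0] coeff_uv_g_20V[OF \<psi>] ..
  also have "\<dots> = det (mat n n (\<lambda>(i, j). coeff (num_poly n j) i))"
  proof (intro arg_cong[where f = det] cong_mat refl)
    fix i j assume "j < n"
    then have "c * ((\<psi>\<^sup>2) ^ Suc j - (fps_X\<^sup>2) ^ Suc j) = fps_of_poly (num_poly n j)"
      unfolding c_def by (rule poly_fps_num_poly[OF _ \<psi>])
    then show "(case (i, j) of (i, j) \<Rightarrow> fps_nth (c * ((\<psi>\<^sup>2) ^ Suc j - (fps_X\<^sup>2) ^ Suc j)) i) =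
        (case (i, j) of (i, j) \<Rightarrow> coeff (num_poly n j) i)"
      by (simp only: prod.case fps_of_poly_nth)
  qed
  finally have d: "det (mat n n (\<lambda>(i, j). coeff_uv g_20V i j)) = det (mat n n (\<lambda>(i, j). coeff (num_poly n j) i))" .
  \<comment> \<open>The count is known as a real determinant; its entries are images of rational
    numbers, and injectivity of \<open>of_rat\<close> brings the equation back to the
    rationals.\<close>
  have "real (Z_20V n) = det (mat n n (\<lambda>(i, j). of_rat (coeff (num_poly n j) i)))"
    using Z_20V_det[OF assms] by (simp add: of_rat_coeff_num_poly)
  also have "mat n n (\<lambda>(i, j). of_rat (coeff (num_poly n j) i) :: real) =
      map_mat of_rat (mat n n (\<lambda>(i, j). coeff (num_poly n j) i))"
    by (intro eq_matI) auto
  also have "det \<dots> = of_rat (det (mat n n (\<lambda>(i, j). coeff (num_poly n j) i)))"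
    by (rule of_rat_hom.hom_det)
  finally have "of_rat (rat_of_nat (Z_20V n)) = (of_rat (det (mat n n (\<lambda>(i, j). coeff_uv g_20V i j))) :: real)"
    unfolding d by simp
  then show "rat_of_nat (Z_20V n) = det (mat n n (\<lambda>(i, j). coeff_uv g_20V i j))"
    by (simp only: of_rat_eq_iff)
  show "g_20V = ((1 + fps_u) / (1 - fps_u))\<^sup>2 / (1 - fps_v * ((1 + fps_u) / (1 - fps_u))\<^sup>2)
              - fps_u\<^sup>2 / (1 - fps_v * fps_u\<^sup>2)"
    by (rule g_20V_partial_fractions)
qed

end
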